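(* Let $Z$ be a real-valued Lévy process satisfying $(\mathcal{C})$, i.e. $\Phi(\theta)=\mathbb{E}[\exp(\theta Z(1))]<\infty$ for all $\theta\in\mathbb{R}$, let $c>0$ and $\mu:=\mathbb{E}[Z(1)]$. Then the functional Erdős–Rényi law (FERL) holds for $(\mathcal{L}_n)$ in $(D(0,1),d_{\mathcal{U}})$, with limit set $K_{1/c}+\mu\,\mathrm{i_d}$, where $\mathrm{i_d}$ is the identity function on $[0,1]$ and $K_{1/c}$ is the sublevel set, defined in the context, of the rate function $I$ built from $\Phi$.
   Context: A Lévy process $Z=\{Z(t):t\ge0\}$ is a stochastically continuous real-valued process with stationary independent increments and $Z(0)=0$ a.s.; it is defined on a probability space $(\Omega,\mathcal{F},P)$, and all its sample paths are assumed càdlàg on $[0,\infty)$. For $x\ge0$, $\lambda>0$: $\eta_{x,\lambda}:[0,1]\to\mathbb{R}$, $\eta_{x,\lambda}(s)=\lambda^{-1}(Z(x+s\lambda)-Z(x))$. For $n>1$, $A_n$ is the integer part of $c\log n$, and $\mathcal{L}_n:=\{\eta_{x,A_n}:x\in[0,n-A_n]\}$ ($x$ real; only large $n$ matter). $D(0,1)$ is the space of càdlàg functions on $[0,1]$ and $d_{\mathcal{U}}$ is the uniform distance on it. A subset of $\Omega$ is negligible if it is contained in a set of $\mathcal{F}$ of probability $0$; $\mathcal{N}^{c}$ is the class of complements of negligible sets. For subsets $E_n$ of $\Omega$, $\{E_n\text{ ult.}\}=\bigcup_{n>1}\bigcap_{k\ge n}E_k$. For $K\subset D(0,1)$ and $\epsilon>0$,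 $K^{\epsilon}:=\{f\in D(0,1):\exists g\in K,\ d_{\mathcal{U}}(f,g)<\epsilon\}$. A FERL holds for $(\mathcal{L}_n)$ in $(D(0,1),d_{\mathcal{U}})$ with limit set $\mathcal{K}\subset D(0,1)$ if for every $\epsilon>0$, $\{\mathcal{L}_n\subset\mathcal{K}^{\epsilon}\text{ ult.}\}\in\mathcal{N}^{c}$ and $\{\mathcal{K}\subset(\mathcal{L}_n)^{\epsilon}\text{ ult.}\}\in\mathcal{N}^{c}$. Rate function: let $\Psi(a):=\sup\{a\theta-\log\Phi(\theta):\Phi(\theta)<\infty\}$, $a\in\mathbb{R}$, where $\Phi$ is the moment generating function of $Z(1)$. Define $I:D(0,1)\to[0,\infty]$ by $I(f)=\int_0^1\Psi\big(\tfrac{\mathrm{d}f}{\mathrm{d}s}(s)\big)\,ds$ if $f$ is absolutely continuous with $f(0)=0$, and $I(f)=\infty$ otherwise. For $\alpha>0$, $K_\alpha:=\{f\in D(0,1):I(f)\le\alpha\}$.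
   Formalization: The rate function I defining K_{1/c} is built from the moment generating function of the centred variable Z(1)−μ instead of Z(1); with Z(1) itself the claim fails whenever μ≠0 (for Z(t)=t the increments are i_d but the stated limit set is {2 i_d}). *)

theory Defs
  imports "HOL-Probability.Probability"
begin

text \<open>At an end point of \<open>S\<close> the one-sided filter pointing out of \<open>S\<close> is trivial, so the
  corresponding condition holds vacuously.\<close>

definition cadlag_on :: "real set \<Rightarrow> (real \<Rightarrow> real) \<Rightarrow> bool" where
  "cadlag_on S f \<longleftrightarrow>
     (\<forall>t\<in>S. (f \<longlongrightarrow> f t) (at t within S \<inter> {t<..}) \<and>
            (\<exists>l. (f \<longlongrightarrow> l) (at t within S \<inter> {..<t})))"

locale levy_process = prob_space M for M :: "'a measure" +
  fixes Z :: "real \<Rightarrow> 'a \<Rightarrow> real"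
  assumes random_variable_Z: "t \<ge> 0 \<Longrightarrow> random_variable borel (Z t)"
    and start_zero: "AE \<omega> in M. Z 0 \<omega> = 0"
    and independent_increments:
      "\<And>(t :: nat \<Rightarrow> real) m. 0 \<le> t 0 \<Longrightarrow> (\<And>i. i < m \<Longrightarrow> t i \<le> t (Suc i)) \<Longrightarrow>
         indep_vars (\<lambda>_. borel) (\<lambda>i \<omega>. Z (t (Suc i)) \<omega> - Z (t i) \<omega>) {..<m}"
    and stationary_increments:
      "0 \<le> t \<Longrightarrow> 0 \<le> h \<Longrightarrow>
         distr M borel (\<lambda>\<omega>. Z (t + h) \<omega> - Z t \<omega>) = distr M borel (\<lambda>\<omega>. Z h \<omega> - Z 0 \<omega>)"
    and stochastically_continuous:
      "0 \<le> t \<Longrightarrow> 0 < \<epsilon> \<Longrightarrow>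
         ((\<lambda>s. prob {\<omega> \<in> space M. \<bar>Z s \<omega> - Z t \<omega>\<bar> > \<epsilon>}) \<longlongrightarrow> 0) (at t within {0..})"
    and cadlag_paths: "\<omega> \<in> space M \<Longrightarrow> cadlag_on {0..} (\<lambda>t. Z t \<omega>)"

text \<open>Functions on \<open>[0,1]\<close> are represented by total functions whose values outside \<open>[0,1]\<close> are
  irrelevant: no notion below depends on them.\<close>

definition D01 :: "(real \<Rightarrow> real) set" where
  "D01 = {f. cadlag_on {0..1} f}"

definition dist_U :: "(real \<Rightarrow> real) \<Rightarrow> (real \<Rightarrow> real) \<Rightarrow> real" where
  "dist_U f g = (SUP s\<in>{0..1}. \<bar>f s - g s\<bar>)"

definition nbhd_U :: "(real \<Rightarrow> real) set \<Rightarrow> real \<Rightarrow> (real \<Rightarrow> real) set" where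
  "nbhd_U K \<epsilon> = {f \<in> D01. \<exists>g\<in>K. dist_U f g < \<epsilon>}"

text \<open>A property holds almost everywhere iff the set where it fails is contained in a null set,
  which need not coincide with a measurable set itself: this is membership in \<open>\<N>\<^sup>c\<close>.\<close>

definition FERL :: "'a measure \<Rightarrow> (nat \<Rightarrow> 'a \<Rightarrow> (real \<Rightarrow> real) set) \<Rightarrow> (real \<Rightarrow> real) set \<Rightarrow> bool" where
  "FERL M L K \<longleftrightarrow>
     (\<forall>\<epsilon>>0. (AE \<omega> in M. \<forall>\<^sub>F n in sequentially. L n \<omega> \<subseteq> nbhd_U K \<epsilon>) \<and>
            (AE \<omega> in M. \<forall>\<^sub>F n in sequentially. K \<subseteq> nbhd_U (L n \<omega>) \<epsilon>))"

definition eta :: "(real \<Rightarrow> 'a \<Rightarrow> real) \<Rightarrow> 'a \<Rightarrow> real \<Rightarrow> real \<Rightarrow> real \<Rightarrow> real" where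
  "eta Z \<omega> x l = (\<lambda>s. inverse l * (Z (x + s * l) \<omega> - Z x \<omega>))"

definition window :: "real \<Rightarrow> nat \<Rightarrow> int" where
  "window c n = \<lfloor>c * ln (real n)\<rfloor>"

definition increments :: "(real \<Rightarrow> 'a \<Rightarrow> real) \<Rightarrow> real \<Rightarrow> nat \<Rightarrow> 'a \<Rightarrow> (real \<Rightarrow> real) set" where
  "increments Z c n \<omega> =
     {eta Z \<omega> x (real_of_int (window c n)) | x. 0 \<le> x \<and> x \<le> real n - real_of_int (window c n)}"

definition mgf :: "'a measure \<Rightarrow> ('a \<Rightarrow> real) \<Rightarrow> real \<Rightarrow> ennreal" where
  "mgf M X \<theta> = (\<integral>\<^sup>+ \<omega>. ennreal (exp (\<theta> * X \<omega>)) \<partial>M)"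

definition Psi :: "(real \<Rightarrow> ennreal) \<Rightarrow> real \<Rightarrow> ereal" where
  "Psi \<Phi> a = (SUP \<theta>\<in>{\<theta>. \<Phi> \<theta> < \<infinity>}. ereal (a * \<theta> - ln (enn2real (\<Phi> \<theta>))))"

definition abs_continuous_on :: "real \<Rightarrow> real \<Rightarrow> (real \<Rightarrow> real) \<Rightarrow> bool" where
  "abs_continuous_on a b f \<longleftrightarrow>
     (\<forall>\<epsilon>>0. \<exists>\<delta>>0. \<forall>P. finite P \<and> P \<subseteq> {(u, v). a \<le> u \<and> u \<le> v \<and> v \<le> b} \<and>
         disjoint_family_on (\<lambda>(u, v). {u<..<v}) P \<and> (\<Sum>(u, v)\<in>P. v - u) < \<delta>
         \<longrightarrow> (\<Sum>(u, v)\<in>P. \<bar>f v - f u\<bar>) < \<epsilon>)"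

text \<open>\<open>Psi \<Phi>\<close> is nonnegative for a moment generating function \<open>\<Phi>\<close> of a random variable (take
  \<open>\<theta> = 0\<close>), so the truncation \<^const>\<open>e2ennreal\<close> loses nothing.\<close>

definition rate :: "(real \<Rightarrow> ennreal) \<Rightarrow> (real \<Rightarrow> real) \<Rightarrow> ennreal" where
  "rate \<Phi> f =
     (if abs_continuous_on 0 1 f \<and> f 0 = 0
      then \<integral>\<^sup>+ s\<in>{0..1}. e2ennreal (Psi \<Phi> (deriv f s)) \<partial>lborel
      else \<infinity>)"

definition sublevel :: "(real \<Rightarrow> ennreal) \<Rightarrow> real \<Rightarrow> (real \<Rightarrow> real) set" where
  "sublevel \<Phi> \<alpha> = {f \<in> D01. rate \<Phi> f \<le> ennreal \<alpha>}"

definition add_drift :: "(real \<Rightarrow> real) set \<Rightarrow> real \<Rightarrow> (real \<Rightarrow> real) set" where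
  "add_drift K \<mu> = (\<lambda>f s. f s + \<mu> * s) ` K"

text \<open>Pitfall: the limit set \<open>K + \<mu> i\<^sub>d\<close> carries the drift explicitly, so \<open>K\<close> has to be built from the
  moment generating function of the centred variable \<open>Z(1) - \<mu>\<close>. The Legendre transform belonging
  to \<open>Z(1)\<close> itself already vanishes at \<open>\<mu>\<close>, and adding \<open>\<mu> i\<^sub>d\<close> would count the drift twice: for
  \<open>Z(t) = t\<close> the increments are all \<open>i\<^sub>d\<close>, whereas the uncentred \<open>K + \<mu> i\<^sub>d\<close> is \<open>{2 i\<^sub>d}\<close>.
  The following lemma relates the two transforms; they agree for \<open>\<mu> = 0\<close>.\<close>

lemma Psi_centred:
  assumes "prob_space M" and X: "X \<in> borel_measurable M"
    and fin: "\<And>\<theta>. mgf M X \<theta> < \<infinity>"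
  shows "Psi (mgf M (\<lambda>\<omega>. X \<omega> - m)) a = Psi (mgf M X) (a + m)"
proof -
  interpret prob_space M by fact
  have shift: "mgf M (\<lambda>\<omega>. X \<omega> - m) \<theta> = ennreal (exp (- \<theta> * m)) * mgf M X \<theta>" for \<theta>
    unfolding mgf_def using X
    by (subst nn_integral_cmult[symmetric])
       (auto simp: ennreal_mult[symmetric] mult_exp_exp algebra_simps intro!: nn_integral_cong)
  have pos: "mgf M X \<theta> \<noteq> 0" for \<theta>
  proof
    assume "mgf M X \<theta> = 0"
    then have "AE \<omega> in M. ennreal (exp (\<theta> * X \<omega>)) = 0"
      using X by (simp add: mgf_def nn_integral_0_iff_AE)
    then have "AE \<omega> in M. False" by (rule AE_mp) (auto simp: not_le)
    then show False by simp
  qed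
  have "enn2real (mgf M X \<theta>) > 0" for \<theta>
    using fin[of \<theta>] pos[of \<theta>] by (auto simp: enn2real_positive_iff less_top zero_less_iff_neq_zero)
  then have "enn2real (mgf M X \<theta>) \<noteq> 0" for \<theta>
    by (metis less_irrefl)
  then have "ln (enn2real (mgf M (\<lambda>\<omega>. X \<omega> - m) \<theta>)) = - \<theta> * m + ln (enn2real (mgf M X \<theta>))" for \<theta>
    by (simp add: shift enn2real_mult ln_mult)
  then have "a * \<theta> - ln (enn2real (mgf M (\<lambda>\<omega>. X \<omega> - m) \<theta>)) =
      (a + m) * \<theta> - ln (enn2real (mgf M X \<theta>))" for \<theta>
    by (simp add: algebra_simps)
  moreover have "mgf M (\<lambda>\<omega>. X \<omega> - m) \<theta> < \<infinity>" for \<theta>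
    using fin[of \<theta>] by (simp add: shift ennreal_mult_less_top)
  ultimately show ?thesis
    using fin by (simp only: Psi_def)
qed

end

theory Submission
  imports Defs "HOL-Real_Asymp.Real_Asymp"
begin

text \<open>Write \<open>W t = Z t - \<mu> t\<close>, let \<open>L\<close> be the logarithm of the moment generating function of \<open>W 1\<close> and \<open>L\<^sup>*\<close> its
  Legendre conjugate, and cut a window of length \<open>k = A\<^sub>n\<close> into \<open>m\<close> pieces of length \<open>k / m\<close>. By an exponential
  maximal inequality, for \<open>m\<close> large no piece in the range of interest oscillates by more than \<open>\<epsilon> k\<close>, so
  increments may be replaced by polygons with \<open>m\<close> i.i.d. random slopes \<open>a\<close>, and real starting points by grid
  points. Only the windows \<open>k\<close> matter for Borel-Cantelli, with \<open>e\<^bsup>k/c\<^esup> \<le> n \<le> e\<^bsup>(k+1)/c\<^esup>\<close>.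

  Upper inclusion: Chernoff's bound gives \<open>P ((k/m) L\<^sup>* a > u) \<le> 2 e\<^sup>-\<^sup>u\<close>, hence all exponential moments of order
  below 1, and Markov's inequality shows that eventually every polygon has rate at most any given \<open>\<beta> > 1/c\<close>.
  Contracting it towards the mean by \<open>1 - \<delta>\<close> brings the rate below \<open>1/c\<close>.

  Lower inclusion: Jensen's inequality on the grid maps the limit set to slope vectors of rate at most
  \<open>1/c\<close>, for which a finite net suffices. The contracted vectors of the net have rate strictly below \<open>1/c\<close> and
  admit an exponential tilt, so by Cramer's lower bound one of about \<open>e\<^bsup>k/c\<^esup> / k\<close> independent blocks has slopes
  close to the given ones.\<close>

section \<open>Absolutely continuous functions\<close>

text \<open>The rate is an integral of \<open>deriv f\<close>. Before anything can be said about an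
  arbitrary member of the limit set, absolute continuity must yield an almost everywhere derivative
  whose integral recovers the increments; polygons, which serve the upper inclusion, have explicit
  derivatives. Centring does more than fix the limit set: by Jensen \<open>L\<close> is nonnegative
  with \<open>L 0 = 0\<close>. Hence the conjugate is nonnegative, shrinks at least linearly under
  contraction towards 0, and each step of the maximal inequality costs a factor at least 1. The
  obstacle is that the conjugate may be infinite, and that its supremum need not be attained even
  where it is finite: for the compensated Poisson process of rate 1 the value at slope -1 is 1,
  approached only as \<theta> tends to minus infinity. Therefore conjugates are real-valued on an
  explicit domain, infinite values are excluded inside the Markov bound, and tilts are taken at
  contracted slopes only. Moment generating functions of increments are needed only over rational
  lengths, where independence and stationarity determine them: the grid step \<open>k / m\<close>
  and its dyadic parts are rational.\<close>

definition nonoverlapping :: "real \<Rightarrow> real \<Rightarrow> (real \<times> real) set set" where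
  "nonoverlapping a b =
     {P. finite P \<and> (\<forall>(u, v)\<in>P. a \<le> u \<and> u < v \<and> v \<le> b) \<and>
         disjoint_family_on (\<lambda>(u, v). {u<..<v}) P}"

abbreviation total_increment :: "(real \<Rightarrow> real) \<Rightarrow> (real \<times> real) set \<Rightarrow> real" where
  "total_increment f P \<equiv> (\<Sum>(u, v)\<in>P. f v - f u)"

lemma empty_nonoverlapping [simp]: "{} \<in> nonoverlapping a b"
  by (simp add: nonoverlapping_def disjoint_family_on_def)

lemma nonoverlapping_length:
  assumes P: "P \<in> nonoverlapping a b" and "a \<le> b"
  shows "(\<Sum>(u, v)\<in>P. v - u) \<le> b - a"
proof -
  have fin: "finite P" and le: "\<And>u v. (u, v) \<in> P \<Longrightarrow> a \<le> u \<and> u < v \<and> v \<le> b"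
    and dis: "disjoint_family_on (\<lambda>(u, v). {u<..<v}) P"
    using P by (auto simp: nonoverlapping_def)
  have "(\<Sum>(u, v)\<in>P. v - u) = (\<Sum>p\<in>P. measure lborel (case p of (u, v) \<Rightarrow> {u<..<v}))"
    using le by (intro sum.cong) (auto simp: less_imp_le)
  also have "\<dots> = measure lborel (\<Union>p\<in>P. case p of (u, v) \<Rightarrow> {u<..<v})"
    using fin dis
    by (intro measure_finite_Union[symmetric]) (auto simp: emeasure_lborel_Ioo less_imp_le dest!: le)
  also have "\<dots> \<le> measure lborel {a..b}"
  proof (rule measure_mono_fmeasurable)
    show "(\<Union>p\<in>P. case p of (u, v) \<Rightarrow> {u<..<v}) \<subseteq> {a..b}" using le by force
    show "(\<Union>p\<in>P. case p of (u, v) \<Rightarrow> {u<..<v}) \<in> sets lborel" using fin by (intro sets.finite_UN) auto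
  qed (simp add: fmeasurable_def emeasure_lborel_Icc_eq)
  finally show ?thesis using \<open>a \<le> b\<close> by simp
qed

text \<open>An interval that straddles \<open>x\<close> is cut there and its increment telescopes;
  every other interval goes to one side unchanged.\<close>

lemma nonoverlapping_split:
  assumes P: "P \<in> nonoverlapping a b"
  obtains P1 P2 where "P1 \<in> nonoverlapping a x" "P2 \<in> nonoverlapping x b"
    "total_increment f P = total_increment f P1 + total_increment f P2"
proof
  have fin: "finite P" and le: "\<And>u v. (u, v) \<in> P \<Longrightarrow> a \<le> u \<and> u < v \<and> v \<le> b"
    and dis: "disjoint_family_on (\<lambda>(u, v). {u<..<v}) P"
    using P by (auto simp: nonoverlapping_def)
  have dis': "max u u' \<ge> min v v'" if "(u, v) \<in> P" "(u', v') \<in> P" "(u, v) \<noteq> (u', v')" for u v u' v'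
  proof (rule ccontr)
    assume "\<not> ?thesis"
    then obtain z where "max u u' < z" "z < min v v'" using dense by (metis not_le)
    then have "z \<in> {u<..<v} \<inter> {u'<..<v'}" by auto
    with dis that show False by (force simp: disjoint_family_on_def)
  qed
  \<comment> \<open>Clipping to the left and to the right of \<open>x\<close>. The new sums are
    reindexed along these maps, so injectivity is needed: disjoint nonempty intervals have distinct
    left and distinct right end points.\<close>
  define p1 where "p1 = (\<lambda>(u::real, v). (u, min v x))"
  define p2 where "p2 = (\<lambda>(u, v::real). (max u x, v))"
  define Q1 where "Q1 = {p \<in> P. fst p < x}"
  define Q2 where "Q2 = {p \<in> P. snd p > x}"
  have inj1: "inj_on p1 Q1"
  proof (rule inj_onI, rule ccontr)
    fix p q assume pq: "p \<in> Q1" "q \<in> Q1" "p1 p = p1 q" "p \<noteq> q"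
    obtain u v u' v' where [simp]: "p = (u, v)" "q = (u', v')" by (metis surj_pair)
    show False using dis'[of u v u' v'] pq le[of u v] le[of u' v']
      by (auto simp: p1_def Q1_def)
  qed
  have inj2: "inj_on p2 Q2"
  proof (rule inj_onI, rule ccontr)
    fix p q assume pq: "p \<in> Q2" "q \<in> Q2" "p2 p = p2 q" "p \<noteq> q"
    obtain u v u' v' where [simp]: "p = (u, v)" "q = (u', v')" by (metis surj_pair)
    show False using dis'[of u v u' v'] pq le[of u v] le[of u' v']
      by (auto simp: p2_def Q2_def)
  qed
  show "p1 ` Q1 \<in> nonoverlapping a x"
    unfolding nonoverlapping_def
  proof (intro CollectI conjI)
    show "disjoint_family_on (\<lambda>(u, v). {u<..<v}) (p1 ` Q1)"
      unfolding disjoint_family_on_def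
    proof (intro ballI impI)
      fix m n assume "m \<in> p1 ` Q1" "n \<in> p1 ` Q1" and ne: "m \<noteq> n"
      then obtain u v u' v' where mn: "(u, v) \<in> P" "(u', v') \<in> P" "m = p1 (u, v)" "n = p1 (u', v')"
        by (auto simp: Q1_def)
      with ne have "(u, v) \<noteq> (u', v')" by blast
      from dis'[OF mn(1,2) this]
      show "(case m of (u, v) \<Rightarrow> {u<..<v}) \<inter> (case n of (u, v) \<Rightarrow> {u<..<v}) = {}"
        by (auto simp: mn p1_def)
    qed
  qed (use fin le in \<open>auto simp: p1_def Q1_def\<close>)
  show "p2 ` Q2 \<in> nonoverlapping x b"
    unfolding nonoverlapping_def
  proof (intro CollectI conjI)
    show "disjoint_family_on (\<lambda>(u, v). {u<..<v}) (p2 ` Q2)"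
      unfolding disjoint_family_on_def
    proof (intro ballI impI)
      fix m n assume "m \<in> p2 ` Q2" "n \<in> p2 ` Q2" and ne: "m \<noteq> n"
      then obtain u v u' v' where mn: "(u, v) \<in> P" "(u', v') \<in> P" "m = p2 (u, v)" "n = p2 (u', v')"
        by (auto simp: Q2_def)
      with ne have "(u, v) \<noteq> (u', v')" by blast
      from dis'[OF mn(1,2) this]
      show "(case m of (u, v) \<Rightarrow> {u<..<v}) \<inter> (case n of (u, v) \<Rightarrow> {u<..<v}) = {}"
        by (auto simp: mn p2_def)
    qed
  qed (use fin le in \<open>auto simp: p2_def Q2_def\<close>)
  have "total_increment f (p1 ` Q1) = (\<Sum>p\<in>P. if fst p < x then f (min (snd p) x) - f (fst p) else 0)"
    using fin by (subst sum.reindex[OF inj1])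
      (auto simp: p1_def Q1_def sum.inter_filter case_prod_unfold)
  moreover have "total_increment f (p2 ` Q2) = (\<Sum>p\<in>P. if snd p > x then f (snd p) - f (max (fst p) x) else 0)"
    using fin by (subst sum.reindex[OF inj2])
      (auto simp: p2_def Q2_def sum.inter_filter case_prod_unfold)
  ultimately have "total_increment f (p1 ` Q1) + total_increment f (p2 ` Q2) =
     (\<Sum>p\<in>P. (if fst p < x then f (min (snd p) x) - f (fst p) else 0)
            + (if snd p > x then f (snd p) - f (max (fst p) x) else 0))"
    by (simp add: sum.distrib)
  also have "\<dots> = total_increment f P"
    using le by (intro sum.cong) (force simp: min_def max_def not_less dest: le)+
  finally show "total_increment f P = total_increment f (p1 ` Q1) + total_increment f (p2 ` Q2)" ..
qed

lemma abs_continuous_onD: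
  assumes "abs_continuous_on a b f" "\<epsilon> > 0"
  obtains \<delta> where "\<delta> > 0"
    "\<And>P. P \<in> nonoverlapping a b \<Longrightarrow> (\<Sum>(u, v)\<in>P. v - u) < \<delta> \<Longrightarrow> (\<Sum>(u, v)\<in>P. \<bar>f v - f u\<bar>) < \<epsilon>"
proof -
  obtain \<delta> where "\<delta> > 0" and d: "\<And>P. finite P \<and> P \<subseteq> {(u, v). a \<le> u \<and> u \<le> v \<and> v \<le> b} \<and>
         disjoint_family_on (\<lambda>(u, v). {u<..<v}) P \<and> (\<Sum>(u, v)\<in>P. v - u) < \<delta>
         \<longrightarrow> (\<Sum>(u, v)\<in>P. \<bar>f v - f u\<bar>) < \<epsilon>"
    using assms unfolding abs_continuous_on_def by blast
  show thesis
  proof (rule that[OF \<open>\<delta> > 0\<close>])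
    fix P assume "P \<in> nonoverlapping a b" "(\<Sum>(u, v)\<in>P. v - u) < \<delta>"
    then show "(\<Sum>(u, v)\<in>P. \<bar>f v - f u\<bar>) < \<epsilon>"
      using d[of P] unfolding nonoverlapping_def by force
  qed
qed

lemma nonoverlapping_mono:
  "P \<in> nonoverlapping a b \<Longrightarrow> a' \<le> a \<Longrightarrow> b \<le> b' \<Longrightarrow> P \<in> nonoverlapping a' b'"
  unfolding nonoverlapping_def by fastforce

lemma total_increment_le_abs: "total_increment f P \<le> (\<Sum>(u, v)\<in>P. \<bar>f v - f u\<bar>)"
  by (intro sum_mono) auto

text \<open>With \<open>Suc n\<close> equal pieces shorter than the \<delta> that belongs to 1, each
  piece contributes at most 1; the induction splits off the last piece. This makes the supremum in
  the positive variation finite.\<close>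

lemma abs_continuous_total_increment_bounded:
  assumes "abs_continuous_on 0 1 f"
  obtains B where "\<And>P. P \<in> nonoverlapping 0 1 \<Longrightarrow> total_increment f P \<le> B"
proof -
  obtain \<delta> where "\<delta> > 0" and d: "\<And>P. P \<in> nonoverlapping 0 1 \<Longrightarrow> (\<Sum>(u, v)\<in>P. v - u) < \<delta> \<Longrightarrow>
      (\<Sum>(u, v)\<in>P. \<bar>f v - f u\<bar>) < 1"
    using abs_continuous_onD[OF assms, of 1] by auto
  obtain n where n: "inverse (real (Suc n)) < \<delta>" using reals_Archimedean[OF \<open>\<delta> > 0\<close>] by blast
  have "total_increment f P \<le> real k" if "k \<le> Suc n" "P \<in> nonoverlapping 0 (k / Suc n)" for k P
    using that
  proof (induction k arbitrary: P)
    case 0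
    then have "P = {}" unfolding nonoverlapping_def by fastforce
    then show ?case by simp
  next
    case (Suc k)
    obtain P1 P2 where P: "P1 \<in> nonoverlapping 0 (k / Suc n)" "P2 \<in> nonoverlapping (k / Suc n) (Suc k / Suc n)"
      "total_increment f P = total_increment f P1 + total_increment f P2"
      using nonoverlapping_split[OF Suc.prems(2)] by blast
    have "(\<Sum>(u, v)\<in>P2. v - u) \<le> Suc k / Suc n - k / Suc n"
      by (rule nonoverlapping_length[OF P(2)]) (simp add: divide_right_mono)
    also have "\<dots> < \<delta>" using n by (simp add: diff_divide_distrib[symmetric] inverse_eq_divide)
    finally have "(\<Sum>(u, v)\<in>P2. \<bar>f v - f u\<bar>) < 1"
      using Suc.prems by (intro d nonoverlapping_mono[OF P(2)]) auto
    then have "total_increment f P2 \<le> 1" using total_increment_le_abs[of f P2] by simp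
    moreover have "total_increment f P1 \<le> real k" using Suc P by auto
    ultimately show ?case using P(3) by simp
  qed
  from this[of "Suc n"] show thesis by (intro that[of "real (Suc n)"]) auto
qed

section \<open>Jordan decomposition by the positive variation\<close>

text \<open>Intervals with negative increment can be left out of a family, so the supremum of signed
  sums already counts only upward movement. Both this function and its difference with
  \<open>f\<close> are nondecreasing, which writes \<open>f\<close> as a difference of monotone
  functions.\<close>

definition positive_variation :: "(real \<Rightarrow> real) \<Rightarrow> real \<Rightarrow> real" where
  "positive_variation f x = (SUP P\<in>nonoverlapping 0 x. total_increment f P)"

lemma positive_variation_upper:
  assumes "abs_continuous_on 0 1 f" "x \<le> 1" "P \<in> nonoverlapping 0 x"
  shows "total_increment f P \<le> positive_variation f x"
proof -
  obtain B where "\<And>P. P \<in> nonoverlapping 0 1 \<Longrightarrow> total_increment f P \<le> B"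
    using abs_continuous_total_increment_bounded[OF assms(1)] by blast
  then have "bdd_above (total_increment f ` nonoverlapping 0 x)"
    using assms(2) by (intro bdd_aboveI[of _ B]) (auto dest: nonoverlapping_mono[of _ 0 x 0 1])
  then show ?thesis unfolding positive_variation_def using assms(3) by (intro cSUP_upper)
qed

lemma positive_variation_least:
  assumes "\<And>P. P \<in> nonoverlapping 0 x \<Longrightarrow> total_increment f P \<le> B"
  shows "positive_variation f x \<le> B"
  unfolding positive_variation_def using assms empty_nonoverlapping by (intro cSUP_least) blast+

text \<open>For the second claim, appending \<open>(x, y)\<close> to a family in
  \<open>[0, x]\<close> raises its sum by \<open>f y - f x\<close>.\<close>

lemma positive_variation_increment:
  assumes f: "abs_continuous_on 0 1 f" and "0 \<le> x" "x \<le> y" "y \<le> 1"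
  shows "positive_variation f x \<le> positive_variation f y"
    and "positive_variation f x - f x \<le> positive_variation f y - f y"
proof -
  show "positive_variation f x \<le> positive_variation f y"
    using assms by (intro positive_variation_least positive_variation_upper) (auto dest: nonoverlapping_mono[of _ 0 x 0 y])
  have "positive_variation f x \<le> positive_variation f y - (f y - f x)"
  proof (rule positive_variation_least)
    fix P assume P: "P \<in> nonoverlapping 0 x"
    show "total_increment f P \<le> positive_variation f y - (f y - f x)"
    proof (cases "x = y")
      case True then show ?thesis using positive_variation_upper[OF f _ P] assms by simp
    next
      case False
      then have "insert (x, y) P \<in> nonoverlapping 0 y"
        using P assms unfolding nonoverlapping_def disjoint_family_on_def by fastforce
      moreover have "(x, y) \<notin> P" "finite P" using P False assms unfolding nonoverlapping_def by fastforce+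
      ultimately show ?thesis using positive_variation_upper[OF f assms(4), of "insert (x, y) P"] by simp
    qed
  qed
  then show "positive_variation f x - f x \<le> positive_variation f y - f y" by simp
qed

text \<open>The half of additivity that is needed. If no family on \<open>[x, y]\<close> came within
  \<epsilon>, splitting any family on \<open>[0, y]\<close> at \<open>x\<close> would bound the
  supremum by itself minus \<epsilon>.\<close>

lemma positive_variation_approx:
  assumes f: "abs_continuous_on 0 1 f" and "0 \<le> x" "x \<le> y" "y \<le> 1" "\<epsilon> > 0"
  shows "\<exists>P. P \<in> nonoverlapping x y \<and> positive_variation f y - positive_variation f x \<le> total_increment f P + \<epsilon>"
proof (rule ccontr)
  assume neg: "\<not> ?thesis"
  have "positive_variation f y \<le> positive_variation f y - \<epsilon>"
  proof (rule positive_variation_least)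
    fix P assume "P \<in> nonoverlapping 0 y"
    then obtain P1 P2 where P: "P1 \<in> nonoverlapping 0 x" "P2 \<in> nonoverlapping x y"
      "total_increment f P = total_increment f P1 + total_increment f P2"
      using nonoverlapping_split by blast
    have "total_increment f P1 \<le> positive_variation f x" using assms P(1) by (intro positive_variation_upper) auto
    with P neg show "total_increment f P \<le> positive_variation f y - \<epsilon>" by force
  qed
  with \<open>\<epsilon> > 0\<close> show False by simp
qed

text \<open>Degenerate intervals add nothing to either sum, so testing on families of nonempty
  intervals suffices; there, distinct pairs are distinct disjoint sets.\<close>

lemma abs_continuous_onI:
  assumes "\<And>\<epsilon>. \<epsilon> > 0 \<Longrightarrow> \<exists>\<delta>>0. \<forall>P\<in>nonoverlapping a b. (\<Sum>(u, v)\<in>P. v - u) < \<delta> \<longrightarrow> (\<Sum>(u, v)\<in>P. \<bar>f v - f u\<bar>) < \<epsilon>"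
  shows "abs_continuous_on a b f"
  unfolding abs_continuous_on_def
proof (intro allI impI)
  fix \<epsilon> :: real assume "\<epsilon> > 0"
  then obtain \<delta> where "\<delta> > 0" and d: "\<And>P. P\<in>nonoverlapping a b \<Longrightarrow> (\<Sum>(u, v)\<in>P. v - u) < \<delta> \<Longrightarrow> (\<Sum>(u, v)\<in>P. \<bar>f v - f u\<bar>) < \<epsilon>"
    using assms by meson
  show "\<exists>\<delta>>0. \<forall>P. finite P \<and> P \<subseteq> {(u, v). a \<le> u \<and> u \<le> v \<and> v \<le> b} \<and>
         disjoint_family_on (\<lambda>(u, v). {u<..<v}) P \<and> (\<Sum>(u, v)\<in>P. v - u) < \<delta>
         \<longrightarrow> (\<Sum>(u, v)\<in>P. \<bar>f v - f u\<bar>) < \<epsilon>"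
  proof (intro exI[of _ \<delta>] conjI allI impI \<open>\<delta> > 0\<close>)
    fix P assume P: "finite P \<and> P \<subseteq> {(u, v). a \<le> u \<and> u \<le> v \<and> v \<le> b} \<and>
         disjoint_family_on (\<lambda>(u, v). {u<..<v}) P \<and> (\<Sum>(u, v)\<in>P. v - u) < \<delta>"
    define Q where "Q = {p\<in>P. fst p < snd p}"
    have deg: "fst p = snd p" if "p \<in> P - Q" for p
      using that P by (force simp: Q_def)
    have eq: "(\<Sum>(u, v)\<in>Q. v - u) = (\<Sum>(u, v)\<in>P. v - u)" "(\<Sum>(u, v)\<in>Q. \<bar>f v - f u\<bar>) = (\<Sum>(u, v)\<in>P. \<bar>f v - f u\<bar>)"
      using P deg by (intro sum.mono_neutral_left; force simp: Q_def)+
    have "Q \<in> nonoverlapping a b"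
      using P by (auto simp: Q_def nonoverlapping_def disjoint_family_on_def)
    with d[of Q] P show "(\<Sum>(u, v)\<in>P. \<bar>f v - f u\<bar>) < \<epsilon>" unfolding eq by blast
  qed
qed

text \<open>On each interval of a family the increment of the positive variation is replaced by a
  nearly optimal family inside it. The union of these is again nonoverlapping and not longer, so the
  absolute continuity of \<open>f\<close> applies to it directly.\<close>

lemma abs_continuous_positive_variation:
  assumes f: "abs_continuous_on 0 1 f"
  shows "abs_continuous_on 0 1 (positive_variation f)"
proof (rule abs_continuous_onI)
  fix \<epsilon> :: real assume "\<epsilon> > 0"
  then obtain \<delta> where "\<delta> > 0" and d: "\<And>P. P \<in> nonoverlapping 0 1 \<Longrightarrow> (\<Sum>(u, v)\<in>P. v - u) < \<delta> \<Longrightarrow>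
      (\<Sum>(u, v)\<in>P. \<bar>f v - f u\<bar>) < \<epsilon> / 2"
    using abs_continuous_onD[OF f, of "\<epsilon> / 2"] by auto
  show "\<exists>\<delta>>0. \<forall>P\<in>nonoverlapping 0 1. (\<Sum>(u, v)\<in>P. v - u) < \<delta> \<longrightarrow>
      (\<Sum>(u, v)\<in>P. \<bar>positive_variation f v - positive_variation f u\<bar>) < \<epsilon>"
  proof (intro exI[of _ \<delta>] conjI ballI impI \<open>\<delta> > 0\<close>)
    fix Q assume Q: "Q \<in> nonoverlapping 0 1" "(\<Sum>(u, v)\<in>Q. v - u) < \<delta>"
    have fin: "finite Q" and le: "\<And>u v. (u, v) \<in> Q \<Longrightarrow> 0 \<le> u \<and> u < v \<and> v \<le> 1"
      and dis: "disjoint_family_on (\<lambda>(u, v). {u<..<v}) Q"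
      using Q by (auto simp: nonoverlapping_def)
    \<comment> \<open>The errors of all intervals together stay below \<epsilon>/4, next to the
      \<epsilon>/2 from absolute continuity; the added 1 covers the empty family.\<close>
    define \<eta> where "\<eta> = \<epsilon> / (4 * (real (card Q) + 1))"
    have "\<eta> > 0" using \<open>\<epsilon> > 0\<close> by (simp add: \<eta>_def add_nonneg_pos)
    have "\<forall>q\<in>Q. \<exists>P. P \<in> nonoverlapping (fst q) (snd q) \<and>
       positive_variation f (snd q) - positive_variation f (fst q) \<le> total_increment f P + \<eta>"
      using le \<open>\<eta> > 0\<close> by (intro ballI positive_variation_approx[OF f]) force+
    then obtain R where R: "\<And>q. q \<in> Q \<Longrightarrow> R q \<in> nonoverlapping (fst q) (snd q)"
      and Rv: "\<And>q. q \<in> Q \<Longrightarrow> positive_variation f (snd q) - positive_variation f (fst q) \<le> total_increment f (R q) + \<eta>"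
      by metis
    have finR: "finite (R q)" and leR: "\<And>u v. (u, v) \<in> R q \<Longrightarrow> fst q \<le> u \<and> u < v \<and> v \<le> snd q"
      and disR: "disjoint_family_on (\<lambda>(u, v). {u<..<v}) (R q)" if "q \<in> Q" for q
      using R[OF that] by (auto simp: nonoverlapping_def)
    have cross: "{u<..<v} \<inter> {u'<..<v'} = {}" if "q \<in> Q" "q' \<in> Q" "q \<noteq> q'" "(u, v) \<in> R q" "(u', v') \<in> R q'" for q q' u v u' v'
    proof -
      have "{fst q<..<snd q} \<inter> {fst q'<..<snd q'} = {}"
        using dis that by (force simp: disjoint_family_on_def case_prod_unfold)
      moreover have "{u<..<v} \<subseteq> {fst q<..<snd q}" "{u'<..<v'} \<subseteq> {fst q'<..<snd q'}"
        using leR[OF that(1,4)] leR[OF that(2,5)] by auto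
      ultimately show ?thesis by blast
    qed
    have disj: "R q \<inter> R q' = {}" if "q \<in> Q" "q' \<in> Q" "q \<noteq> q'" for q q'
    proof (rule ccontr)
      assume "R q \<inter> R q' \<noteq> {}"
      then obtain u v where uv: "(u, v) \<in> R q" "(u, v) \<in> R q'" by auto
      with cross[OF that uv] leR[OF that(1) uv(1)] show False by auto
    qed
    have UN: "(\<Sum>p\<in>(\<Union>q\<in>Q. R q). h p) = (\<Sum>q\<in>Q. sum h (R q))" for h :: "real \<times> real \<Rightarrow> real"
      using fin finR disj by (intro sum.UNION_disjoint) auto
    have non: "(\<Union>q\<in>Q. R q) \<in> nonoverlapping 0 1"
      unfolding nonoverlapping_def
    proof (intro CollectI conjI)
      show "\<forall>(u, v)\<in>(\<Union>q\<in>Q. R q). 0 \<le> u \<and> u < v \<and> v \<le> 1"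
      proof safe
        fix u v a b assume "(a, b) \<in> Q" "(u, v) \<in> R (a, b)"
        then show "0 \<le> u" "u < v" "v \<le> 1" using leR[of "(a, b)" u v] le[of a b] by auto
      qed
      show "disjoint_family_on (\<lambda>(u, v). {u<..<v}) (\<Union>q\<in>Q. R q)"
        unfolding disjoint_family_on_def
      proof (intro ballI impI)
        fix p p' assume p: "p \<in> (\<Union>q\<in>Q. R q)" "p' \<in> (\<Union>q\<in>Q. R q)" "p \<noteq> p'"
        then obtain q q' where q: "q \<in> Q" "p \<in> R q" "q' \<in> Q" "p' \<in> R q'" by blast
        show "(case p of (u, v) \<Rightarrow> {u<..<v}) \<inter> (case p' of (u, v) \<Rightarrow> {u<..<v}) = {}"
        proof (cases "q = q'")
          case True then show ?thesis using disR[of q] q p by (auto simp: disjoint_family_on_def)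
        next
          case False then show ?thesis using cross[of q q'] q by (cases p; cases p'; auto)
        qed
      qed
    qed (use fin finR in auto)
    have len: "(\<Sum>(u, v)\<in>(\<Union>q\<in>Q. R q). v - u) \<le> (\<Sum>(u, v)\<in>Q. v - u)"
      unfolding UN case_prod_unfold
      using nonoverlapping_length[OF R] le by (intro sum_mono) (fastforce simp: case_prod_unfold)
    have "(\<Sum>(u, v)\<in>Q. \<bar>positive_variation f v - positive_variation f u\<bar>) =
      (\<Sum>q\<in>Q. positive_variation f (snd q) - positive_variation f (fst q))"
      using le positive_variation_increment(1)[OF f] by (intro sum.cong) (force simp: abs_of_nonneg dest: le)+
    also have "\<dots> \<le> (\<Sum>q\<in>Q. total_increment f (R q) + \<eta>)" using Rv by (intro sum_mono)
    also have "\<dots> = total_increment f (\<Union>q\<in>Q. R q) + card Q * \<eta>" unfolding UN by (simp add: sum.distrib)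
    also have "total_increment f (\<Union>q\<in>Q. R q) < \<epsilon> / 2"
      using d[OF non] len Q(2) total_increment_le_abs[of f "\<Union>q\<in>Q. R q"] by linarith
    also have "card Q * \<eta> \<le> \<epsilon> / 4" using \<open>\<epsilon> > 0\<close> by (simp add: \<eta>_def field_simps)
    finally show "(\<Sum>(u, v)\<in>Q. \<bar>positive_variation f v - positive_variation f u\<bar>) < \<epsilon>" using \<open>\<epsilon> > 0\<close> by simp
  qed
qed

lemma abs_continuous_diff:
  assumes "abs_continuous_on a b f" "abs_continuous_on a b g"
  shows "abs_continuous_on a b (\<lambda>x. f x - g x)"
proof (rule abs_continuous_onI)
  fix \<epsilon> :: real assume "\<epsilon> > 0"
  obtain \<delta> where d: "\<delta> > 0" "\<And>P. P \<in> nonoverlapping a b \<Longrightarrow> (\<Sum>(u, v)\<in>P. v - u) < \<delta> \<Longrightarrow>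
      (\<Sum>(u, v)\<in>P. \<bar>f v - f u\<bar>) < \<epsilon> / 2"
    using abs_continuous_onD[OF assms(1), of "\<epsilon> / 2"] \<open>\<epsilon> > 0\<close> by auto
  obtain \<delta>' where d': "\<delta>' > 0" "\<And>P. P \<in> nonoverlapping a b \<Longrightarrow> (\<Sum>(u, v)\<in>P. v - u) < \<delta>' \<Longrightarrow>
      (\<Sum>(u, v)\<in>P. \<bar>g v - g u\<bar>) < \<epsilon> / 2"
    using abs_continuous_onD[OF assms(2), of "\<epsilon> / 2"] \<open>\<epsilon> > 0\<close> by auto
  show "\<exists>\<delta>>0. \<forall>P\<in>nonoverlapping a b. (\<Sum>(u, v)\<in>P. v - u) < \<delta> \<longrightarrow> (\<Sum>(u, v)\<in>P. \<bar>(f v - g v) - (f u - g u)\<bar>) < \<epsilon>"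
  proof (intro exI[of _ "min \<delta> \<delta>'"] conjI ballI impI)
    fix P assume P: "P \<in> nonoverlapping a b" "(\<Sum>(u, v)\<in>P. v - u) < min \<delta> \<delta>'"
    have "(\<Sum>(u, v)\<in>P. \<bar>(f v - g v) - (f u - g u)\<bar>) \<le> (\<Sum>(u, v)\<in>P. \<bar>f v - f u\<bar>) + (\<Sum>(u, v)\<in>P. \<bar>g v - g u\<bar>)"
      unfolding sum.distrib[symmetric] by (intro sum_mono) auto
    with d(2)[OF P(1)] d'(2)[OF P(1)] P(2) show "(\<Sum>(u, v)\<in>P. \<bar>(f v - g v) - (f u - g u)\<bar>) < \<epsilon>" by auto
  qed (use d d' in auto)
qed

section \<open>Density of a monotone absolutely continuous function\<close>

lemma open_unit_interval_component:
  fixes U :: "real set"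
  assumes "open U" "U \<subseteq> {0<..<1}" "C \<in> components U"
  obtains a b where "C = {a<..<b}" "a < b" "0 \<le> a" "b \<le> 1"
proof -
  have "open C" using open_components[OF assms(1,3)] .
  have "C \<noteq> {}" using in_components_nonempty[OF assms(3)] .
  have sub: "C \<subseteq> {0<..<1}" using in_components_subset[OF assms(3)] assms(2) by blast
  have "is_interval C" using in_components_connected[OF assms(3)] by (simp add: is_interval_connected_1)
  define a where "a = Inf C"
  define b where "b = Sup C"
  have bdd: "bdd_above C" "bdd_below C" using sub by (auto intro!: bdd_aboveI[of _ 1] bdd_belowI[of _ 0])
  have less: "a < x \<and> x < b" if "x \<in> C" for x
  proof -
    obtain e where "e > 0" "cball x e \<subseteq> C" using \<open>open C\<close> \<open>x \<in> C\<close> open_contains_cball by blast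
    then have "x - e \<in> C" "x + e \<in> C" by (auto simp: subset_iff dist_real_def)
    then have "a \<le> x - e" "x + e \<le> b" using bdd by (auto simp: a_def b_def intro: cInf_lower cSup_upper)
    with \<open>e > 0\<close> show ?thesis by auto
  qed
  have "x \<in> C" if "a < x" "x < b" for x
  proof -
    have "\<exists>y\<in>C. y < x" "\<exists>z\<in>C. x < z"
      using cInf_lessD[OF \<open>C \<noteq> {}\<close>, of x] less_cSupD[OF \<open>C \<noteq> {}\<close>, of x] that
      unfolding a_def b_def by auto
    then obtain y z where y: "y \<in> C" "y < x" and z: "z \<in> C" "x < z" by blast
    show ?thesis
      using \<open>is_interval C\<close>[unfolded is_interval_1, rule_format, OF y(1) z(1)] y z by auto
  qed
  with less have C: "C = {a<..<b}" by auto
  have "0 \<le> a" using \<open>C \<noteq> {}\<close> sub unfolding a_def by (intro cInf_greatest) auto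
  moreover have "b \<le> 1" using \<open>C \<noteq> {}\<close> sub unfolding b_def by (intro cSup_least) auto
  moreover have "a < b" using C \<open>C \<noteq> {}\<close> by auto
  ultimately show thesis using C that by blast
qed

text \<open>The components of an open set are countably many disjoint intervals. Finitely many of
  them form a nonoverlapping family of total length below \<delta>, so their measure is at most
  \<epsilon>; continuity from below gives the whole set.\<close>

lemma interval_measure_open_le:
  fixes U :: "real set"
  assumes U: "open U" "U \<subseteq> {0<..<1}" and len: "emeasure lborel U < ennreal \<delta>"
    and mono: "\<And>x y. x \<le> y \<Longrightarrow> G x \<le> G y" and cont: "continuous_on UNIV G"
    and G: "\<And>P. P \<in> nonoverlapping 0 1 \<Longrightarrow> (\<Sum>(u, v)\<in>P. v - u) < \<delta> \<Longrightarrow> total_increment G P \<le> \<epsilon>"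
  shows "emeasure (interval_measure G) U \<le> ennreal \<epsilon>"
proof (cases "U = {}")
  case False
  let ?N = "interval_measure G"
  have rc: "continuous (at_right a) G" for a
    using cont by (simp add: continuous_on_eq_continuous_within continuous_at_imp_continuous_at_within)
  have countable: "countable (components U)"
    using U(1) open_components[OF U(1)] pairwise_disjoint_components[of U]
    by (intro countable_disjoint_open_subsets) (auto simp: disjoint_def pairwise_def disjnt_def)
  have "components U \<noteq> {}" using False by simp
  then have range: "range (from_nat_into (components U)) = components U"
    using countable by (rule range_from_nat_into)
  define C where "C = from_nat_into (components U)"
  have comp: "C n \<in> components U" for n using range by (auto simp: C_def)
  have opC: "open (C n)" for n using open_components[OF U(1) comp] .
  have fin: "emeasure ?N (\<Union>i\<le>n. C i) \<le> ennreal \<epsilon>" for n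
  proof -
    \<comment> \<open>The enumeration may repeat components, so sums run over this set of components
      and not over indices.\<close>
    define DD where "DD = C ` {..n}"
    have finD: "finite DD" by (simp add: DD_def)
    have D: "DD \<subseteq> components U" using comp by (auto simp: DD_def)
    have "\<forall>A\<in>DD. \<exists>p. {fst p<..<snd p} = A \<and> fst p < snd p \<and> 0 \<le> fst p \<and> snd p \<le> 1"
    proof
      fix A assume "A \<in> DD"
      with D have "A \<in> components U" by blast
      from open_unit_interval_component[OF U this]
      show "\<exists>p. {fst p<..<snd p} = A \<and> fst p < snd p \<and> 0 \<le> fst p \<and> snd p \<le> 1"
        by (metis fst_conv snd_conv)
    qed
    then obtain p where p: "\<And>A. A \<in> DD \<Longrightarrow> {fst (p A)<..<snd (p A)} = A \<and> fst (p A) < snd (p A) \<and> 0 \<le> fst (p A) \<and> snd (p A) \<le> 1"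
      by metis
    have inj: "inj_on p DD" by (rule inj_onI) (metis p)
    have dis: "disjoint_family_on (\<lambda>A. A) DD"
      using D pairwise_disjoint_components[of U] by (auto simp: disjoint_family_on_def pairwise_def)
    have P: "p ` DD \<in> nonoverlapping 0 1"
      unfolding nonoverlapping_def
    proof (intro CollectI conjI)
      show "disjoint_family_on (\<lambda>(u, v). {u<..<v}) (p ` DD)"
        unfolding disjoint_family_on_def
      proof (intro ballI impI)
        fix q r assume "q \<in> p ` DD" "r \<in> p ` DD" "q \<noteq> r"
        then obtain A B where AB: "A \<in> DD" "B \<in> DD" "q = p A" "r = p B" "A \<noteq> B" by blast
        have "A \<inter> B = {}" using dis AB unfolding disjoint_family_on_def by blast
        with p[OF AB(1)] p[OF AB(2)] show "(case q of (u, v) \<Rightarrow> {u<..<v}) \<inter> (case r of (u, v) \<Rightarrow> {u<..<v}) = {}"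
          unfolding AB by (simp add: case_prod_unfold \<open>A \<inter> B = {}\<close>)
      qed
      show "\<forall>(u, v)\<in>p ` DD. 0 \<le> u \<and> u < v \<and> v \<le> 1"
      proof
        fix q assume "q \<in> p ` DD"
        then obtain A where "A \<in> DD" "q = p A" by blast
        with p[of A] show "case q of (u, v) \<Rightarrow> 0 \<le> u \<and> u < v \<and> v \<le> 1" by (simp add: case_prod_unfold)
      qed
    qed (simp add: finD)
    have meas: "A \<in> sets borel" if "A \<in> DD" for A using that opC by (auto simp: DD_def)
    have "(\<Sum>(u, v)\<in>p ` DD. v - u) = (\<Sum>A\<in>DD. snd (p A) - fst (p A))"
      by (simp add: sum.reindex[OF inj] case_prod_unfold)
    then have "ennreal (\<Sum>(u, v)\<in>p ` DD. v - u) = (\<Sum>A\<in>DD. ennreal (snd (p A) - fst (p A)))"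
      using p by (simp add: sum_ennreal less_imp_le)
    also have "\<dots> = (\<Sum>A\<in>DD. emeasure lborel A)"
    proof (rule sum.cong[OF refl])
      fix A assume "A \<in> DD"
      from p[OF this] show "ennreal (snd (p A) - fst (p A)) = emeasure lborel A"
        by (metis emeasure_lborel_Ioo less_imp_le)
    qed
    also have "\<dots> = emeasure lborel (\<Union>A\<in>DD. A)"
      using dis meas finD by (intro sum_emeasure) auto
    also have "\<dots> \<le> emeasure lborel U"
      using D U(1) by (intro emeasure_mono) (auto dest: in_components_subset)
    also note len
    finally have "(\<Sum>(u, v)\<in>p ` DD. v - u) < \<delta>"
    proof (subst (asm) ennreal_less_iff)
      show "0 \<le> (\<Sum>(u, v)\<in>p ` DD. v - u)"
        using P unfolding nonoverlapping_def by (intro sum_nonneg) fastforce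
    qed
    then have le: "total_increment G (p ` DD) \<le> \<epsilon>" by (rule G[OF P])
    have "emeasure ?N (\<Union>i\<le>n. C i) = emeasure ?N (\<Union>A\<in>DD. A)" by (simp add: DD_def)
    also have "\<dots> = (\<Sum>A\<in>DD. emeasure ?N A)" 
      using dis meas finD by (intro sum_emeasure[symmetric]) auto
    also have "\<dots> \<le> (\<Sum>A\<in>DD. ennreal (G (snd (p A)) - G (fst (p A))))"
    proof (rule sum_mono)
      fix A assume A: "A \<in> DD"
      have "{fst (p A)<..<snd (p A)} \<subseteq> {fst (p A)<..snd (p A)}" by auto
      then have "A \<subseteq> {fst (p A)<..snd (p A)}" using p[OF A] by simp
      then have "emeasure ?N A \<le> emeasure ?N {fst (p A)<..snd (p A)}" by (rule emeasure_mono) simp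
      also have "\<dots> = ennreal (G (snd (p A)) - G (fst (p A)))"
        using p[OF A] mono rc by (intro emeasure_interval_measure_Ioc) auto
      finally show "emeasure ?N A \<le> ennreal (G (snd (p A)) - G (fst (p A)))" .
    qed
    also have "\<dots> = ennreal (\<Sum>A\<in>DD. G (snd (p A)) - G (fst (p A)))"
      using p mono by (subst sum_ennreal) (auto simp: less_imp_le)
    also have "\<dots> = ennreal (total_increment G (p ` DD))"
      by (simp add: sum.reindex[OF inj] case_prod_unfold)
    also have "\<dots> \<le> ennreal \<epsilon>" using le by (rule ennreal_leI)
    finally show ?thesis .
  qed
  have "U = (\<Union>n. \<Union>i\<le>n. C i)"
  proof -
    have "(\<Union>n. \<Union>i\<le>n. C i) = \<Union>(range C)" by blast
    also have "\<dots> = U" using range by (simp add: C_def)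
    finally show ?thesis ..
  qed
  then have "emeasure ?N U = (SUP n. emeasure ?N (\<Union>i\<le>n. C i))"
  proof (simp, subst SUP_emeasure_incseq)
    show "incseq (\<lambda>n. \<Union>i\<le>n. C i)" by (intro monoI UN_mono) auto
  qed (use opC in auto)
  with fin show ?thesis by (simp add: SUP_le_iff)
qed simp

text \<open>The Stieltjes measure of \<open>F\<close> is absolutely continuous: a null set has open
  neighbourhoods of small length, and these have small Stieltjes measure. The density is then the
  Radon-Nikodym derivative.\<close>

lemma abs_continuous_mono_density:
  assumes ac: "abs_continuous_on 0 1 F" and mono: "\<And>x y. 0 \<le> x \<Longrightarrow> x \<le> y \<Longrightarrow> y \<le> 1 \<Longrightarrow> F x \<le> F y"
  obtains \<phi> where "integrable lborel \<phi>" "\<And>a b. 0 \<le> a \<Longrightarrow> a \<le> b \<Longrightarrow> b \<le> 1 \<Longrightarrow> F b - F a = (LINT x:{a..b}|lborel. \<phi> x)"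
proof -
  \<comment> \<open>The constant extension is monotone and continuous on the whole line and puts no
    mass outside the open unit interval.\<close>
  define G where "G x = F (max 0 (min 1 x))" for x :: real
  have Gmono: "G x \<le> G y" if "x \<le> y" for x y unfolding G_def using that by (intro mono) auto
  have GF: "G x = F x" if "0 \<le> x" "x \<le> 1" for x using that by (simp add: G_def)
  have Fcont: "continuous_on {0..1} F"
    unfolding continuous_on_iff
  proof (intro ballI allI impI)
    fix x :: real and e :: real assume x: "x \<in> {0..1}" and "e > 0"
    obtain \<delta> where d: "\<delta> > 0" "\<And>P. P \<in> nonoverlapping 0 1 \<Longrightarrow> (\<Sum>(u, v)\<in>P. v - u) < \<delta> \<Longrightarrow>
      (\<Sum>(u, v)\<in>P. \<bar>F v - F u\<bar>) < e" using abs_continuous_onD[OF ac \<open>e > 0\<close>] by auto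
    show "\<exists>d>0. \<forall>x'\<in>{0..1}. dist x' x < d \<longrightarrow> dist (F x') (F x) < e"
    proof (intro exI[of _ \<delta>] conjI ballI impI d(1))
      fix y :: real assume y: "y \<in> {0..1}" "dist y x < \<delta>"
      consider "x = y" | "x < y" | "y < x" by linarith
      then show "dist (F y) (F x) < e"
      proof cases
        case 2 then show ?thesis using d(2)[of "{(x, y)}"] x y
          by (auto simp: nonoverlapping_def disjoint_family_on_def dist_real_def)
      next
        case 3 then show ?thesis using d(2)[of "{(y, x)}"] x y
          by (auto simp: nonoverlapping_def disjoint_family_on_def dist_real_def abs_minus_commute)
      qed (use \<open>e > 0\<close> in simp)
    qed
  qed
  have Gcont: "continuous_on UNIV G"
    unfolding G_def by (rule continuous_on_compose2[OF Fcont]) (auto intro!: continuous_intros)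
  have rc: "continuous (at_right a) G" for a
    using Gcont by (simp add: continuous_on_eq_continuous_within continuous_at_imp_continuous_at_within)
  let ?N = "interval_measure G"
  have out: "emeasure ?N (- {0<..<1}) = 0"
  proof -
    have 1: "emeasure ?N {- real n..0} = 0" for n
      by (subst emeasure_interval_measure_Icc[OF _ Gmono Gcont]) (simp_all add: G_def)
    have 2: "emeasure ?N {1..1 + real n} = 0" for n
      by (subst emeasure_interval_measure_Icc[OF _ Gmono Gcont]) (simp_all add: G_def)
    have "- {0<..<1} = (\<Union>n. {- real n..0}) \<union> (\<Union>n. {1..1 + real n})"
    proof (intro set_eqI iffI)
      fix x :: real assume x: "x \<in> - {0<..<1}"
      obtain n where "\<bar>x\<bar> \<le> real n" using real_arch_simple by blast
      with x have "x \<in> {- real n..0} \<or> x \<in> {1..1 + real n}" by auto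
      then show "x \<in> (\<Union>n. {- real n..0}) \<union> (\<Union>n. {1..1 + real n})" by blast
    qed auto
    moreover have "(\<Union>n. {- real n..0}) \<in> null_sets ?N" "(\<Union>n. {1..1 + real n}) \<in> null_sets ?N"
      using 1 2 by (auto intro!: null_sets_UN null_setsI)
    ultimately show ?thesis using null_sets.Un by (metis null_setsD1)
  qed
  have "absolutely_continuous lborel ?N"
    unfolding absolutely_continuous_def
  proof
    fix A :: "real set" assume A: "A \<in> null_sets lborel"
    have "emeasure ?N (A \<inter> {0<..<1}) \<le> ennreal \<epsilon>" if eps: "\<epsilon> > 0" for \<epsilon>
    proof -
      obtain \<delta> where d: "\<delta> > 0" "\<And>P. P \<in> nonoverlapping 0 1 \<Longrightarrow> (\<Sum>(u, v)\<in>P. v - u) < \<delta> \<Longrightarrow>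
        (\<Sum>(u, v)\<in>P. \<bar>F v - F u\<bar>) < \<epsilon>" using abs_continuous_onD[OF ac eps] by auto
      have "A \<in> sets lebesgue" using A by (auto intro: sets_completionI_sets)
      then obtain T where T: "open T" "A \<subseteq> T" "emeasure lebesgue (T - A) < ennreal \<delta>"
        using sets_lebesgue_outer_open[OF _ d(1)] by metis
      have "emeasure lborel T \<le> emeasure lborel ((T - A) \<union> A)"
        using T A by (intro emeasure_mono) auto
      also have "\<dots> \<le> emeasure lborel (T - A) + emeasure lborel A"
        using T A by (intro emeasure_subadditive) auto
      also have "T - A \<in> sets lborel" using T A by auto
      then have "emeasure lborel (T - A) + emeasure lborel A = emeasure lebesgue (T - A)"
        using A by (simp add: null_setsD1)
      also note T(3)
      finally have T': "emeasure lborel T < ennreal \<delta>" .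
      have "emeasure ?N (A \<inter> {0<..<1}) \<le> emeasure ?N (T \<inter> {0<..<1})"
        using T by (intro emeasure_mono) auto
      also have "\<dots> \<le> ennreal \<epsilon>"
      proof (rule interval_measure_open_le[where \<delta> = \<delta>])
        show "open (T \<inter> {0<..<1})" using T by auto
        show "emeasure lborel (T \<inter> {0<..<1}) < ennreal \<delta>"
          using T by (intro le_less_trans[OF emeasure_mono T']) auto
        fix P assume P: "P \<in> nonoverlapping 0 1" "(\<Sum>(u, v)\<in>P. v - u) < \<delta>"
        have "total_increment G P = total_increment F P"
          using P(1) by (intro sum.cong) (auto simp: nonoverlapping_def GF)
        then show "total_increment G P \<le> \<epsilon>" using d(2)[OF P] total_increment_le_abs[of F P] by simp
      qed (fact Gmono Gcont | simp)+
      finally show ?thesis .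
    qed
    then have "emeasure ?N (A \<inter> {0<..<1}) \<le> 0"
      using ennreal_le_epsilon[of 0 "emeasure ?N (A \<inter> {0<..<1})"] by simp
    moreover have "emeasure ?N A \<le> emeasure ?N (A \<inter> {0<..<1}) + emeasure ?N (- {0<..<1})"
      using A by (intro order_trans[OF emeasure_mono emeasure_subadditive]) auto
    ultimately show "A \<in> null_sets ?N" using A out by (auto simp: null_sets_def)
  qed
  then obtain g where g[measurable]: "g \<in> borel_measurable lborel" and dens: "density lborel g = ?N"
    using sigma_finite_measure.Radon_Nikodym[OF sigma_finite_lborel, of ?N] by auto
  have gint: "(\<integral>\<^sup>+x. g x * indicator {a..b} x \<partial>lborel) = ennreal (G b - G a)" if "a \<le> b" for a b
  proof -
    have "(\<integral>\<^sup>+x. g x * indicator {a..b} x \<partial>lborel) = emeasure (density lborel g) {a..b}"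
      by (simp add: emeasure_density)
    also have "\<dots> = ennreal (G b - G a)" unfolding dens
      using that Gmono Gcont by (intro emeasure_interval_measure_Icc) auto
    finally show ?thesis .
  qed
  \<comment> \<open>The Radon-Nikodym density is extended-valued, but finite almost everywhere on
    \<open>[0, 1]\<close> because its integral there is; hence the conversion to reals changes it on
    a null set only.\<close>
  define \<phi> where "\<phi> x = enn2real (g x * indicator {0..1} x)" for x
  have [measurable]: "\<phi> \<in> borel_measurable lborel" unfolding \<phi>_def by measurable
  have ae: "AE x in lborel. g x * indicator {0..1} x \<noteq> \<infinity>"
    by (rule nn_integral_noteq_infinite) (use gint[of 0 1] in auto)
  have fin: "(\<integral>\<^sup>+x. ennreal (\<phi> x) \<partial>lborel) = ennreal (G 1 - G 0)"
    using gint[of 0 1] ae by (simp add: \<phi>_def, subst nn_integral_cong_AE) (auto simp: less_top)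
  have int: "integrable lborel \<phi>"
    by (rule integrableI_nonneg) (use fin in \<open>auto simp: \<phi>_def\<close>)
  show thesis
  proof (rule that[OF int])
    fix a b :: real assume ab: "0 \<le> a" "a \<le> b" "b \<le> 1"
    have "(\<integral>\<^sup>+x. ennreal (indicator {a..b} x *\<^sub>R \<phi> x) \<partial>lborel) = (\<integral>\<^sup>+x. g x * indicator {a..b} x \<partial>lborel)"
    proof (rule nn_integral_cong_AE)
      show "AE x in lborel. ennreal (indicator {a..b} x *\<^sub>R \<phi> x) = g x * indicator {a..b} x"
        using ae by eventually_elim (use ab in \<open>auto simp: \<phi>_def less_top split: split_indicator\<close>)
    qed
    then have "(\<integral>\<^sup>+x. ennreal (indicator {a..b} x *\<^sub>R \<phi> x) \<partial>lborel) = ennreal (G b - G a)"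
      using gint ab by simp
    moreover have "(LINT x:{a..b}|lborel. \<phi> x) = enn2real (\<integral>\<^sup>+x. ennreal (indicator {a..b} x *\<^sub>R \<phi> x) \<partial>lborel)"
      unfolding set_lebesgue_integral_def
      by (intro integral_eq_nn_integral) (auto simp: \<phi>_def)
    ultimately have "(LINT x:{a..b}|lborel. \<phi> x) = G b - G a"
      using ab Gmono by simp
    then show "F b - F a = (LINT x:{a..b}|lborel. \<phi> x)" using ab by (simp add: GF)
  qed
qed

section \<open>Almost everywhere differentiability\<close>

text \<open>Lebesgue differentiation with \<open>x\<close> as the left end point of the averaging
  interval; left-hand averages are obtained by applying it to the reflected function.\<close>

lemma integral_right_derivative_AE:
  fixes \<phi> :: "real \<Rightarrow> real"
  assumes "integrable lborel \<phi>"
  shows "AE x in lborel. \<forall>e>0. \<exists>d>0. \<forall>h. 0 < h \<and> h < d \<longrightarrow> \<bar>integral {x..x + h} \<phi> / h - \<phi> x\<bar> < e"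
proof -
  have "\<phi> integrable_on cbox a b" for a b
    by (rule integrable_on_subcbox[OF integrable_on_lborel[OF assms]]) auto
  then obtain N where N: "negligible N" "\<And>x e. \<lbrakk>x \<notin> N; 0 < e\<rbrakk> \<Longrightarrow> \<exists>d>0. \<forall>h. 0 < h \<and> h < d \<longrightarrow>
       norm(integral (cbox x (x + h *\<^sub>R One)) \<phi> /\<^sub>R h ^ DIM(real) - \<phi> x) < e"
    by (rule integrable_ccontinuous_explicit[of \<phi>]) blast
  have "AE x in lebesgue. x \<notin> N" using N(1) by (simp add: negligible_iff_null_sets AE_not_in)
  then have "AE x in lborel. x \<notin> N" by (simp add: AE_completion_iff)
  then show ?thesis
  proof eventually_elim
    case (elim x)
    show ?case using N(2)[OF elim] by (simp add: divide_inverse mult.commute)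
  qed
qed

lemma AE_lborel_uminus:
  fixes P :: "real \<Rightarrow> bool"
  assumes "AE x in lborel. P x"
  shows "AE x in lborel. P (- x)"
proof -
  have eq: "distr lborel borel uminus = (lborel :: real measure)" using lborel_distr_uminus .
  obtain N where N: "{x. \<not> P x} \<subseteq> N" "N \<in> null_sets lborel"
    using assms by (auto simp: eventually_ae_filter)
  then have "AE x in distr lborel borel uminus. x \<notin> N" unfolding eq by (intro AE_not_in)
  then have "AE x in lborel. - x \<notin> N" 
    by (rule AE_distrD[rotated]) simp
  then show ?thesis by eventually_elim (use N in auto)
qed

text \<open>The density is the difference of the densities of the two monotone parts. Right-hand
  averages of \<phi> and of its reflection converge almost everywhere, and together they give a
  two-sided derivative.\<close>

theorem abs_continuous_derivative_AE:
  assumes f: "abs_continuous_on 0 1 f"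
  obtains \<phi> where "integrable lborel \<phi>"
    "\<And>a b. 0 \<le> a \<Longrightarrow> a \<le> b \<Longrightarrow> b \<le> 1 \<Longrightarrow> f b - f a = (LINT x:{a..b}|lborel. \<phi> x)"
    "AE x in lborel. 0 < x \<longrightarrow> x < 1 \<longrightarrow> (f has_real_derivative \<phi> x) (at x)"
proof -
  let ?F = "positive_variation f"
  have F: "abs_continuous_on 0 1 ?F" using abs_continuous_positive_variation[OF f] .
  obtain \<phi>1 where 1: "integrable lborel \<phi>1" "\<And>a b. 0 \<le> a \<Longrightarrow> a \<le> b \<Longrightarrow> b \<le> 1 \<Longrightarrow> ?F b - ?F a = (LINT x:{a..b}|lborel. \<phi>1 x)"
    using abs_continuous_mono_density[OF F positive_variation_increment(1)[OF f]] by auto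
  obtain \<phi>2 where 2: "integrable lborel \<phi>2" "\<And>a b. 0 \<le> a \<Longrightarrow> a \<le> b \<Longrightarrow> b \<le> 1 \<Longrightarrow> (?F b - f b) - (?F a - f a) = (LINT x:{a..b}|lborel. \<phi>2 x)"
    using abs_continuous_mono_density[OF abs_continuous_diff[OF F f] positive_variation_increment(2)[OF f]] by auto
  define \<phi> where "\<phi> x = \<phi>1 x - \<phi>2 x" for x
  have int: "integrable lborel \<phi>" unfolding \<phi>_def using 1(1) 2(1) by simp
  have inc: "f b - f a = (LINT x:{a..b}|lborel. \<phi> x)" if "0 \<le> a" "a \<le> b" "b \<le> 1" for a b
  proof -
    have "set_integrable lborel {a..b} \<phi>1" "set_integrable lborel {a..b} \<phi>2"
      unfolding set_integrable_def using 1(1) 2(1) by (intro integrable_mult_indicator; simp)+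
    then have "(LINT x:{a..b}|lborel. \<phi> x) = (LINT x:{a..b}|lborel. \<phi>1 x) - (LINT x:{a..b}|lborel. \<phi>2 x)"
      unfolding \<phi>_def by (rule set_integral_diff)
    with 1(2)[OF that] 2(2)[OF that] show ?thesis by simp
  qed
  have inc': "integral {a..b} \<phi> = f b - f a" if "0 \<le> a" "a \<le> b" "b \<le> 1" for a b
  proof -
    have "set_integrable lborel {a..b} \<phi>"
      unfolding set_integrable_def using int by (intro integrable_mult_indicator; simp)
    from set_borel_integral_eq_integral(2)[OF this] show ?thesis using inc[OF that] by simp
  qed
  have "integrable lborel (\<lambda>x. \<phi> (- x))"
    using lborel_integrable_real_affine[OF int, of "-1" 0] by simp
  from AE_lborel_uminus[OF integral_right_derivative_AE[OF this]]
  have "AE x in lborel. \<forall>e>0. \<exists>d>0. \<forall>h. 0 < h \<and> h < d \<longrightarrow> \<bar>integral {x - h..x} \<phi> / h - \<phi> x\<bar> < e"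
  proof eventually_elim
    case (elim x)
    have "integral {- x..- x + h} (\<lambda>x. \<phi> (- x)) = integral {x - h..x} \<phi>" for h
      using Henstock_Kurzweil_Integration.integral_reflect_real[of x "x - h" \<phi>]
      by (simp add: algebra_simps)
    with elim show ?case by simp
  qed
  with integral_right_derivative_AE[OF int]
  have "AE x in lborel. 0 < x \<longrightarrow> x < 1 \<longrightarrow> (f has_real_derivative \<phi> x) (at x)"
  proof eventually_elim
    case (elim x)
    show ?case
    proof (intro impI)
      assume x: "0 < x" "x < 1"
      show "(f has_real_derivative \<phi> x) (at x)"
        unfolding DERIV_def LIM_def
      proof (intro allI impI)
        fix e :: real assume "e > 0"
        obtain d1 where d1: "d1 > 0" "\<And>h. 0 < h \<Longrightarrow> h < d1 \<Longrightarrow> \<bar>integral {x..x + h} \<phi> / h - \<phi> x\<bar> < e"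
          using elim(1) \<open>e > 0\<close> by blast
        obtain d2 where d2: "d2 > 0" "\<And>h. 0 < h \<Longrightarrow> h < d2 \<Longrightarrow> \<bar>integral {x - h..x} \<phi> / h - \<phi> x\<bar> < e"
          using elim(2) \<open>e > 0\<close> by blast
        show "\<exists>s>0. \<forall>h. h \<noteq> 0 \<and> dist h 0 < s \<longrightarrow> dist ((f (x + h) - f x) / h) (\<phi> x) < e"
        proof (intro exI[of _ "min (min d1 d2) (min x (1 - x))"] conjI allI impI)
          fix h :: real assume h: "h \<noteq> 0 \<and> dist h 0 < min (min d1 d2) (min x (1 - x))"
          show "dist ((f (x + h) - f x) / h) (\<phi> x) < e"
          proof (cases "h > 0")
            case True
            have "integral {x..x + h} \<phi> = f (x + h) - f x" using h x True by (intro inc') auto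
            with d1(2)[of h] True h show ?thesis by (simp add: dist_real_def)
          next
            case False
            have "integral {x - (- h)..x} \<phi> = f x - f (x - (- h))" using h x False by (intro inc') (auto simp: dist_real_def)
            then have "integral {x - (- h)..x} \<phi> / (- h) = (f (x + h) - f x) / h"
              by (simp add: divide_simps)
            with d2(2)[of "- h"] False h show ?thesis by (simp add: dist_real_def)
          qed
        qed (use d1 d2 x in auto)
      qed
    qed
  qed
  with int inc show thesis by (rule that)
qed

section \<open>Legendre conjugates and polygons\<close>

definition log_mgf :: "(real \<Rightarrow> ennreal) \<Rightarrow> real \<Rightarrow> real" where
  "log_mgf \<Phi> \<theta> = ln (enn2real (\<Phi> \<theta>))"

lemma Psi_le_iff:
  assumes "\<And>\<theta>. \<Phi> \<theta> < \<infinity>"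
  shows "Psi \<Phi> a \<le> ereal y \<longleftrightarrow> (\<forall>\<theta>. a * \<theta> - log_mgf \<Phi> \<theta> \<le> y)"
  using assms by (simp add: Psi_def SUP_le_iff log_mgf_def less_top)

lemma Psi_ge:
  assumes "\<And>\<theta>. \<Phi> \<theta> < \<infinity>"
  shows "ereal (a * \<theta> - log_mgf \<Phi> \<theta>) \<le> Psi \<Phi> a"
  using assms by (auto simp: Psi_def log_mgf_def intro: SUP_upper)

lemma e2ennreal_ereal: "e2ennreal (ereal x) = ennreal x"
  by (simp add: ennreal.abs_eq e2ennreal_def max_def)

text \<open>The Fenchel-Young inequality, with one fixed parameter \<theta> per cell, integrated
  over the partition. Keeping the parameters free avoids infinite conjugates; the suprema are taken
  later, over finitely many parameters.\<close>

lemma sublevel_partition_le: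
  fixes t \<theta> :: "nat \<Rightarrow> real"
  assumes fin: "\<And>\<theta>. \<Phi> \<theta> < \<infinity>" and f: "f \<in> sublevel \<Phi> \<alpha>" and "\<alpha> \<ge> 0"
    and mono: "\<And>i j. i \<le> j \<Longrightarrow> j \<le> n \<Longrightarrow> t i \<le> t j" and "0 \<le> t 0" "t n \<le> 1"
  shows "(\<Sum>i<n. (f (t (Suc i)) - f (t i)) * \<theta> i - (t (Suc i) - t i) * log_mgf \<Phi> (\<theta> i)) \<le> \<alpha>"
proof -
  have rate: "rate \<Phi> f \<le> ennreal \<alpha>" using f by (simp add: sublevel_def)
  then have ac: "abs_continuous_on 0 1 f"
    by (auto simp: rate_def top_unique split: if_splits)
  with rate have r: "(\<integral>\<^sup>+ s\<in>{0..1}. e2ennreal (Psi \<Phi> (deriv f s)) \<partial>lborel) \<le> ennreal \<alpha>"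
    by (auto simp: rate_def top_unique split: if_splits)
  obtain \<phi> where \<phi>: "integrable lborel \<phi>"
    "\<And>a b. 0 \<le> a \<Longrightarrow> a \<le> b \<Longrightarrow> b \<le> 1 \<Longrightarrow> f b - f a = (LINT x:{a..b}|lborel. \<phi> x)"
    "AE x in lborel. 0 < x \<longrightarrow> x < 1 \<longrightarrow> (f has_real_derivative \<phi> x) (at x)"
    using abs_continuous_derivative_AE[OF ac] by blast
  define w where "w i s = indicator {t i..t (Suc i)} s * (\<phi> s * \<theta> i - log_mgf \<Phi> (\<theta> i))" for i s
  have t01: "0 \<le> t i" "t i \<le> 1" if "i \<le> n" for i
    using mono[of 0 i] mono[of i n] that assms(5,6) by auto
  have w: "integrable lborel (w i)" "integral\<^sup>L lborel (w i) =
      (f (t (Suc i)) - f (t i)) * \<theta> i - (t (Suc i) - t i) * log_mgf \<Phi> (\<theta> i)" if "i < n" for i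
  proof -
    have i1: "integrable lborel (\<lambda>s. indicator {t i..t (Suc i)} s * \<phi> s)"
      using integrable_mult_indicator[OF _ \<phi>(1), of "{t i..t (Suc i)}"] by simp
    have i2: "integrable lborel (\<lambda>s. indicator {t i..t (Suc i)} s :: real)"
      by (simp add: integrable_indicator_iff emeasure_lborel_Icc_eq)
    have eq: "w i = (\<lambda>s. \<theta> i * (indicator {t i..t (Suc i)} s * \<phi> s) - log_mgf \<Phi> (\<theta> i) * indicator {t i..t (Suc i)} s)"
      by (auto simp: w_def algebra_simps)
    show "integrable lborel (w i)" unfolding eq using i1 i2 by auto
    have "(LBINT s. indicator {t i..t (Suc i)} s * \<phi> s) = f (t (Suc i)) - f (t i)"
      using \<phi>(2)[of "t i" "t (Suc i)"] t01 mono[of i "Suc i"] that by (simp add: set_lebesgue_integral_def)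
    moreover have "(LBINT s. indicator {t i..t (Suc i)} s :: real) = t (Suc i) - t i"
      using mono[of i "Suc i"] that by simp
    ultimately show "integral\<^sup>L lborel (w i) =
      (f (t (Suc i)) - f (t i)) * \<theta> i - (t (Suc i) - t i) * log_mgf \<Phi> (\<theta> i)"
      unfolding eq using i1 i2 by (subst Bochner_Integration.integral_diff) (auto simp: mult.commute)
  qed
  define v where "v s = (\<Sum>i<n. w i s)" for s
  have v: "integrable lborel v" "integral\<^sup>L lborel v =
    (\<Sum>i<n. (f (t (Suc i)) - f (t i)) * \<theta> i - (t (Suc i) - t i) * log_mgf \<Phi> (\<theta> i))"
    unfolding v_def using w by auto
  \<comment> \<open>Away from the knots a point lies in at most one closed cell, so only one summand
    of \<open>v\<close> survives; 0 and 1 are removed because the derivative is known only inside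
    the unit interval.\<close>
  have nonknot: "AE s in lborel. s \<notin> insert 0 (insert 1 (t ` {..n}))"
    by (intro AE_not_in finite_imp_null_set_lborel) auto
  have "AE s in lborel. ennreal (v s) \<le> e2ennreal (Psi \<Phi> (deriv f s)) * indicator {0..1} s"
    using nonknot \<phi>(3)
  proof eventually_elim
    case (elim s)
    show ?case
    proof (cases "\<exists>i<n. s \<in> {t i..t (Suc i)}")
      case False
      then have "v s = 0" by (auto simp: v_def w_def)
      then show ?thesis by simp
    next
      case True
      then obtain i where i: "i < n" "s \<in> {t i..t (Suc i)}" by blast
      have other: "s \<notin> {t j..t (Suc j)}" if hj: "j < n" "j \<noteq> i" for j
      proof
        assume s: "s \<in> {t j..t (Suc j)}"
        have kn: "s \<noteq> t k" if "k \<le> n" for k using elim(1) that by auto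
        consider "j < i" | "i < j" using hj by linarith
        then show False
        proof cases
          case 1
          then have "t (Suc j) \<le> t i" using i mono by simp
          with s i kn[of i] show False by auto
        next
          case 2
          then have "t (Suc i) \<le> t j" using hj mono 2 by simp
          with s i kn[of j] hj show False by auto
        qed
      qed
      have "v s = w i s"
        unfolding v_def using i other by (subst sum.remove[of _ i]) (auto simp: w_def intro!: sum.neutral)
      then have vs: "v s = \<phi> s * \<theta> i - log_mgf \<Phi> (\<theta> i)" using i by (simp add: w_def)
      have "0 \<le> s" "s \<le> 1" using i t01[of i] t01[of "Suc i"] by auto
      with elim have s: "0 < s" "s < 1" by auto
      then have "(f has_real_derivative \<phi> s) (at s)" using elim(2) by blast
      then have "deriv f s = \<phi> s" by (rule DERIV_imp_deriv)
      with Psi_ge[OF fin, of "\<phi> s" "\<theta> i"] vs have "ereal (v s) \<le> Psi \<Phi> (deriv f s)" by simp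
      then have "e2ennreal (ereal (v s)) \<le> e2ennreal (Psi \<Phi> (deriv f s))" by (rule e2ennreal_mono)
      then show ?thesis using s by (simp add: e2ennreal_ereal)
    qed
  qed
  then have "(\<integral>\<^sup>+s. ennreal (v s) \<partial>lborel) \<le> (\<integral>\<^sup>+ s\<in>{0..1}. e2ennreal (Psi \<Phi> (deriv f s)) \<partial>lborel)"
    by (rule nn_integral_mono_AE)
  also note r
  finally have "(\<integral>\<^sup>+s. ennreal (v s) \<partial>lborel) \<le> ennreal \<alpha>" .
  \<comment> \<open>\<open>v\<close> may be negative and \<open>ennreal\<close> truncates it at 0,
    so the bound is obtained for its positive part, whose integral dominates that of
    \<open>v\<close>.\<close>
  also have "(\<integral>\<^sup>+s. ennreal (v s) \<partial>lborel) = (\<integral>\<^sup>+s. ennreal (max 0 (v s)) \<partial>lborel)"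
    by (intro nn_integral_cong) (simp add: max_def ennreal_neg)
  also have "\<dots> = ennreal (\<integral>s. max 0 (v s) \<partial>lborel)"
    using v(1) by (intro nn_integral_eq_integral) auto
  finally have "(\<integral>s. max 0 (v s) \<partial>lborel) \<le> \<alpha>" using \<open>\<alpha> \<ge> 0\<close> by (simp add: ennreal_le_iff)
  moreover have "integral\<^sup>L lborel v \<le> (\<integral>s. max 0 (v s) \<partial>lborel)"
    using v(1) by (intro integral_mono) auto
  ultimately show ?thesis using v(2) by simp
qed

section \<open>Conjugates on their effective domain\<close>

text \<open>A real-valued Legendre transform. The supremum is meaningful only where it is finite, so
  facts about it assume \<open>conjugate_dom\<close> or supply an upper bound.\<close>

definition conjugate :: "(real \<Rightarrow> real) \<Rightarrow> real \<Rightarrow> real" where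
  "conjugate L a = (SUP \<theta>. a * \<theta> - L \<theta>)"

definition conjugate_dom :: "(real \<Rightarrow> real) \<Rightarrow> real set" where
  "conjugate_dom L = {a. bdd_above (range (\<lambda>\<theta>. a * \<theta> - L \<theta>))}"

lemma conjugate_upper: "a \<in> conjugate_dom L \<Longrightarrow> a * \<theta> - L \<theta> \<le> conjugate L a"
  unfolding conjugate_def conjugate_dom_def by (auto intro: cSUP_upper)

lemma conjugate_least: "(\<And>\<theta>. a * \<theta> - L \<theta> \<le> y) \<Longrightarrow> conjugate L a \<le> y"
  unfolding conjugate_def by (intro cSUP_least) auto

lemma conjugate_domI: "(\<And>\<theta>. a * \<theta> - L \<theta> \<le> y) \<Longrightarrow> a \<in> conjugate_dom L"
  unfolding conjugate_dom_def by (auto intro!: bdd_aboveI)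

lemma conjugate_nonneg: "a \<in> conjugate_dom L \<Longrightarrow> L 0 = 0 \<Longrightarrow> 0 \<le> conjugate L a"
  using conjugate_upper[of a L 0] by simp

text \<open>Testing the supremum with \<theta> = 1 and \<theta> = -1. It turns a bound on the rate
  into a bound on the slopes.\<close>

lemma abs_le_conjugate:
  assumes "a \<in> conjugate_dom L"
  shows "\<bar>a\<bar> \<le> conjugate L a + max (L 1) (L (-1))"
  using conjugate_upper[OF assms, of 1] conjugate_upper[OF assms, of "-1"] by auto

text \<open>Nonnegativity of \<open>L\<close> gives \<open>r * L \<theta> \<le> L \<theta>\<close>.
  Every gain in rate by contraction comes from this inequality.\<close>

lemma conjugate_scale:
  assumes a: "a \<in> conjugate_dom L" and L: "\<And>\<theta>. 0 \<le> L \<theta>" and r: "0 \<le> r" "r \<le> 1"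
  shows "r * a \<in> conjugate_dom L" "conjugate L (r * a) \<le> r * conjugate L a"
proof -
  have "r * a * \<theta> - L \<theta> \<le> r * conjugate L a" for \<theta>
  proof -
    have "r * L \<theta> \<le> 1 * L \<theta>" using L r by (intro mult_right_mono)
    then have "r * a * \<theta> - L \<theta> \<le> r * (a * \<theta> - L \<theta>)" by (simp add: algebra_simps)
    also have "\<dots> \<le> r * conjugate L a" using r conjugate_upper[OF a] by (intro mult_left_mono)
    finally show ?thesis .
  qed
  then show "r * a \<in> conjugate_dom L" "conjugate L (r * a) \<le> r * conjugate L a"
    by (auto intro: conjugate_domI conjugate_least)
qed

text \<open>A sum of suprema over independent parameters is the supremum of the sum. Setting all
  parameters but one to 0, where \<open>L\<close> vanishes, isolates a single slope and shows that
  its conjugate is finite.\<close>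

lemma conjugate_sum_le:
  assumes L0: "L 0 = 0" and *: "\<And>\<theta> :: nat \<Rightarrow> real. (\<Sum>l<m. a l * \<theta> l - L (\<theta> l)) \<le> y"
  shows "\<forall>l<m. a l \<in> conjugate_dom L" "(\<Sum>l<m. conjugate L (a l)) \<le> y"
proof -
  show dom: "\<forall>l<m. a l \<in> conjugate_dom L"
  proof (intro allI impI)
    fix l assume l: "l < m"
    show "a l \<in> conjugate_dom L"
    proof (rule conjugate_domI)
      fix \<theta> :: real
      have "(\<Sum>k<m. a k * (if k = l then \<theta> else 0) - L (if k = l then \<theta> else 0))
         = (\<Sum>k<m. if k = l then a l * \<theta> - L \<theta> else 0)"
        using L0 by (intro sum.cong) auto
      also have "\<dots> = a l * \<theta> - L \<theta>" using l by (simp add: sum.delta)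
      finally show "a l * \<theta> - L \<theta> \<le> y" using *[of "\<lambda>k. if k = l then \<theta> else 0"] by simp
    qed
  qed
  show "(\<Sum>l<m. conjugate L (a l)) \<le> y"
  proof (rule field_le_epsilon)
    fix e :: real assume "e > 0"
    have "\<exists>\<theta>. conjugate L (a l) - e / (real m + 1) < a l * \<theta> - L \<theta>" if "l < m" for l
    proof (rule ccontr)
      assume "\<not> ?thesis"
      then have "conjugate L (a l) \<le> conjugate L (a l) - e / (real m + 1)"
        by (intro conjugate_least) (auto simp: not_less)
      with \<open>e > 0\<close> show False by (simp add: field_simps)
    qed
    then obtain \<theta> where \<theta>: "\<And>l. l < m \<Longrightarrow> conjugate L (a l) - e / (real m + 1) < a l * \<theta> l - L (\<theta> l)"
      by metis
    have "(\<Sum>l<m. conjugate L (a l)) \<le> (\<Sum>l<m. (a l * \<theta> l - L (\<theta> l)) + e / (real m + 1))"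
      using \<theta> by (intro sum_mono) (fastforce intro: less_imp_le)
    also have "\<dots> = (\<Sum>l<m. a l * \<theta> l - L (\<theta> l)) + real m * (e / (real m + 1))" by (simp add: sum.distrib)
    also have "\<dots> \<le> y + e" using *[of \<theta>] \<open>e > 0\<close> by (intro add_mono) (auto simp: field_simps)
    finally show "(\<Sum>l<m. conjugate L (a l)) \<le> y + e" .
  qed
qed

section \<open>Polygons\<close>

text \<open>The clipped factor is the time spent in cell \<open>l\<close> up to time
  \<open>s\<close>, so the slope there is \<open>a l\<close>. This form is linear in
  \<open>a\<close> and Lipschitz in \<open>s\<close> without any choice of cell.\<close>

definition polygon :: "nat \<Rightarrow> (nat \<Rightarrow> real) \<Rightarrow> real \<Rightarrow> real" where
  "polygon m a s = (\<Sum>l<m. a l * max 0 (min (s - l / m) (1 / m)))"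

lemma polygon_0: "polygon m a 0 = 0"
proof -
  have "max 0 (min (0 - real l / m) (1 / m)) = 0" for l
    by (intro max_absorb1) (simp add: min_le_iff_disj)
  then show ?thesis by (simp add: polygon_def)
qed

lemma polygon_eq:
  assumes "j < m" "real j / m \<le> s" "s \<le> (real j + 1) / m"
  shows "polygon m a s = (\<Sum>l<j. a l) / m + a j * (s - j / m)"
proof -
  have m: "real m > 0" using assms by auto
  have "a l * max 0 (min (s - l / m) (1 / m)) = (if l < j then a l / m else if l = j then a j * (s - j / m) else 0)" for l
  proof -
    consider "l < j" | "l = j" | "l > j" by linarith
    then show ?thesis
    proof cases
      case 1
      then have "real l + 1 \<le> real j" by linarith
      then have "(real l + 1) / m \<le> real j / m" by (intro divide_right_mono) auto
      then have "1 / m \<le> s - l / m" using assms(2) by (simp add: add_divide_distrib)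
      then show ?thesis using 1 m by (simp add: min_def max_def)
    next
      case 2
      then have "s - l / m \<le> 1 / m" using assms(3) by (simp add: add_divide_distrib)
      then show ?thesis using 2 assms(2) by (simp add: min_def max_def)
    next
      case 3
      then have "real j + 1 \<le> real l" by linarith
      then have "(real j + 1) / m \<le> real l / m" by (intro divide_right_mono) auto
      then have "max 0 (min (s - l / m) (1 / m)) = 0"
        using assms(3) by (intro max_absorb1) (simp add: min_le_iff_disj)
      then show ?thesis using 3 by simp
    qed
  qed
  then have "polygon m a s = (\<Sum>l<m. if l < j then a l / m else if l = j then a j * (s - j / m) else 0)"
    by (simp add: polygon_def)
  also have "\<dots> = (\<Sum>l<Suc j. if l < j then a l / m else if l = j then a j * (s - j / m) else 0)"
    using assms(1) by (intro sum.mono_neutral_right) auto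
  also have "\<dots> = (\<Sum>l<j. a l) / m + a j * (s - j / m)"
    by (simp add: sum_divide_distrib)
  finally show ?thesis .
qed

lemma grid_cell:
  assumes "0 \<le> s" "s \<le> (1::real)" "m > 0"
  obtains j :: nat where "j < m" "real j / m \<le> s" "s \<le> (real j + 1) / m"
proof (cases "s = 1")
  case True
  show thesis by (rule that[of "m - 1"]) (use assms True in \<open>auto simp: of_nat_diff field_simps\<close>)
next
  case False
  define j where "j = nat \<lfloor>s * m\<rfloor>"
  have "0 \<le> s * m" "s * m < m" using assms False by auto
  then have "real j \<le> s * m" "s * m < real j + 1" "j < m"
    unfolding j_def by (auto simp: floor_less_iff nat_less_iff)
  then show thesis using assms by (intro that[of j]) (auto simp: field_simps)
qed

lemma polygon_diff_le:
  "\<bar>polygon m a s - polygon m b s\<bar> \<le> (\<Sum>l<m. \<bar>a l - b l\<bar>) / m"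
proof -
  have "\<bar>polygon m a s - polygon m b s\<bar> = \<bar>\<Sum>l<m. (a l - b l) * max 0 (min (s - l / m) (1 / m))\<bar>"
    by (simp add: polygon_def sum_subtractf algebra_simps)
  also have "\<dots> \<le> (\<Sum>l<m. \<bar>(a l - b l) * max 0 (min (s - l / m) (1 / m))\<bar>)" by (rule sum_abs)
  also have "\<dots> \<le> (\<Sum>l<m. \<bar>a l - b l\<bar> * (1 / m))"
    unfolding abs_mult by (intro sum_mono mult_left_mono) (auto simp: abs_le_iff)
  finally show ?thesis by (simp add: sum_divide_distrib)
qed

lemma polygon_lipschitz:
  "\<bar>polygon m a s - polygon m a t\<bar> \<le> (\<Sum>l<m. \<bar>a l\<bar>) * \<bar>s - t\<bar>"
proof -
  have "\<bar>polygon m a s - polygon m a t\<bar> =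
      \<bar>\<Sum>l<m. a l * (max 0 (min (s - l / m) (1 / m)) - max 0 (min (t - l / m) (1 / m)))\<bar>"
    by (simp add: polygon_def sum_subtractf algebra_simps)
  also have "\<dots> \<le> (\<Sum>l<m. \<bar>a l * (max 0 (min (s - l / m) (1 / m)) - max 0 (min (t - l / m) (1 / m)))\<bar>)" by (rule sum_abs)
  also have "\<dots> \<le> (\<Sum>l<m. \<bar>a l\<bar> * \<bar>s - t\<bar>)"
    unfolding abs_mult by (intro sum_mono mult_left_mono) (auto simp: min_def max_def)
  finally show ?thesis by (simp add: sum_distrib_right)
qed

lemma abs_continuous_polygon: "abs_continuous_on 0 1 (polygon m a)"
proof (rule abs_continuous_onI)
  fix \<epsilon> :: real assume "\<epsilon> > 0"
  define C where "C = (\<Sum>l<m. \<bar>a l\<bar>)"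
  have "C \<ge> 0" by (simp add: C_def sum_nonneg)
  show "\<exists>\<delta>>0. \<forall>P\<in>nonoverlapping 0 1. (\<Sum>(u, v)\<in>P. v - u) < \<delta> \<longrightarrow> (\<Sum>(u, v)\<in>P. \<bar>polygon m a v - polygon m a u\<bar>) < \<epsilon>"
  proof (intro exI[of _ "\<epsilon> / (C + 1)"] conjI ballI impI)
    fix P assume P: "P \<in> nonoverlapping 0 1" and len: "(\<Sum>(u, v)\<in>P. v - u) < \<epsilon> / (C + 1)"
    have "(\<Sum>(u, v)\<in>P. \<bar>polygon m a v - polygon m a u\<bar>) \<le> (\<Sum>p\<in>P. C * (snd p - fst p))"
    proof (rule sum_mono)
      fix p assume "p \<in> P"
      then have "fst p < snd p" using P unfolding nonoverlapping_def by fastforce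
      then show "(case p of (u, v) \<Rightarrow> \<bar>polygon m a v - polygon m a u\<bar>) \<le> C * (snd p - fst p)"
        using polygon_lipschitz[of m a "snd p" "fst p"] by (simp add: C_def case_prod_unfold)
    qed
    also have "\<dots> = C * (\<Sum>(u, v)\<in>P. v - u)" by (simp add: sum_distrib_left case_prod_unfold)
    also have "\<dots> \<le> C * (\<epsilon> / (C + 1))" using len \<open>C \<ge> 0\<close> by (intro mult_left_mono) auto
    also have "\<dots> < \<epsilon>" using \<open>C \<ge> 0\<close> \<open>\<epsilon> > 0\<close> by (simp add: field_simps)
    finally show "(\<Sum>(u, v)\<in>P. \<bar>polygon m a v - polygon m a u\<bar>) < \<epsilon>" .
  qed (use \<open>C \<ge> 0\<close> \<open>\<epsilon> > 0\<close> in auto)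
qed

lemma continuous_imp_cadlag_on:
  assumes "continuous_on S f"
  shows "cadlag_on S f"
  unfolding cadlag_on_def
proof (intro ballI conjI)
  fix t assume "t \<in> S"
  then have "(f \<longlongrightarrow> f t) (at t within S)" using assms by (simp add: continuous_on_def)
  then have "(f \<longlongrightarrow> f t) (at t within S \<inter> {t<..})" "(f \<longlongrightarrow> f t) (at t within S \<inter> {..<t})"
    by (auto intro: tendsto_within_subset)
  then show "(f \<longlongrightarrow> f t) (at t within S \<inter> {t<..})" "\<exists>l. (f \<longlongrightarrow> l) (at t within S \<inter> {..<t})"
    by auto
qed

lemma polygon_in_D01: "polygon m a \<in> D01"
  unfolding D01_def polygon_def by (auto intro!: continuous_imp_cadlag_on continuous_intros)

text \<open>Off the finitely many knots the derivative is the slope of the cell, so the rate is at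
  most the mean of the \<open>m\<close> conjugates.\<close>

lemma polygon_in_sublevel:
  assumes fin: "\<And>\<theta>. \<Phi> \<theta> < \<infinity>" and m: "m > 0"
    and dom: "\<And>l. l < m \<Longrightarrow> a l \<in> conjugate_dom (log_mgf \<Phi>)"
    and L0: "log_mgf \<Phi> 0 = 0"
    and le: "(\<Sum>l<m. conjugate (log_mgf \<Phi>) (a l)) \<le> m * \<alpha>"
  shows "polygon m a \<in> sublevel \<Phi> \<alpha>"
proof -
  let ?p = "polygon m a" and ?I = "conjugate (log_mgf \<Phi>)"
  define J where "J l = {real l / m<..<(real l + 1) / m}" for l
  have ae: "AE s in lborel. s \<notin> (\<lambda>l. real l / m) ` {..m}"
    by (intro AE_not_in finite_imp_null_set_lborel) auto
  have "(\<integral>\<^sup>+ s\<in>{0..1}. e2ennreal (Psi \<Phi> (deriv ?p s)) \<partial>lborel) \<le>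
    (\<integral>\<^sup>+ s. (\<Sum>l<m. ennreal (?I (a l)) * indicator (J l) s) \<partial>lborel)"
  proof (rule nn_integral_mono_AE, use ae in eventually_elim)
    case (elim s)
    show ?case
    proof (cases "s \<in> {0..1}")
      case True
      then obtain j where j: "j < m" "real j / m \<le> s" "s \<le> (real j + 1) / m"
        using grid_cell[of s m] m by auto
      have "real j / m \<in> (\<lambda>l. real l / m) ` {..m}" "real (Suc j) / m \<in> (\<lambda>l. real l / m) ` {..m}"
        using j(1) by (intro imageI; simp)+
      then have "s \<noteq> real j / m" "s \<noteq> real (Suc j) / m" using elim by metis+
      then have sJ: "s \<in> J j" using j by (auto simp: J_def add.commute)
      have "((\<lambda>s. (\<Sum>l<j. a l) / m + a j * (s - j / m)) has_real_derivative a j) (at s)"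
        by (auto intro!: derivative_eq_intros)
      then have "(?p has_real_derivative a j) (at s)"
        by (rule has_field_derivative_transform_within_open[of _ _ _ "J j"])
           (use sJ in \<open>auto simp: J_def polygon_eq[OF j(1)]\<close>)
      then have "deriv ?p s = a j" by (rule DERIV_imp_deriv)
      moreover have "Psi \<Phi> (a j) \<le> ereal (?I (a j))"
        using conjugate_upper[OF dom[OF j(1)]] by (simp add: Psi_le_iff[OF fin])
      ultimately have "e2ennreal (Psi \<Phi> (deriv ?p s)) \<le> e2ennreal (ereal (?I (a j)))"
        by (intro e2ennreal_mono) simp
      also have "\<dots> = ennreal (?I (a j)) * indicator (J j) s" using sJ by (simp add: e2ennreal_ereal)
      also have "\<dots> \<le> (\<Sum>l<m. ennreal (?I (a l)) * indicator (J l) s)"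
        using j(1) by (intro member_le_sum) auto
      finally show ?thesis using True by simp
    qed simp
  qed
  also have "\<dots> = (\<Sum>l<m. ennreal (?I (a l)) * emeasure lborel (J l))"
    by (subst nn_integral_sum) (auto simp: J_def nn_integral_cmult_indicator)
  also have "\<dots> = (\<Sum>l<m. ennreal (?I (a l) * (1 / m)))"
  proof (rule sum.cong[OF refl])
    fix l assume "l \<in> {..<m}"
    have "real l / m \<le> (real l + 1) / m" by (intro divide_right_mono) auto
    then have "emeasure lborel (J l) = ennreal (1 / m)"
      by (simp add: J_def diff_divide_distrib[symmetric])
    then show "ennreal (?I (a l)) * emeasure lborel (J l) = ennreal (?I (a l) * (1 / m))"
      using ennreal_mult''[of "1 / real m" "?I (a l)"] by simp
  qed
  also have "\<dots> = ennreal (\<Sum>l<m. ?I (a l) * (1 / m))"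
    using conjugate_nonneg[OF dom L0] by (intro sum_ennreal) auto
  also have "\<dots> \<le> ennreal \<alpha>"
    using le m by (intro ennreal_leI) (simp add: sum_distrib_right[symmetric] field_simps sum_divide_distrib[symmetric])
  finally show ?thesis
    by (auto simp: sublevel_def rate_def polygon_in_D01 abs_continuous_polygon polygon_0)
qed

text \<open>The partition inequality for the single cell \<open>[u, v]\<close> with parameters of
  both signs. It is a modulus of continuity common to the whole sublevel set: \<theta> is taken
  large, then \<open>v - u\<close> small.\<close>

lemma sublevel_increment_le:
  assumes fin: "\<And>\<theta>. \<Phi> \<theta> < \<infinity>" and f: "f \<in> sublevel \<Phi> \<alpha>" and "\<alpha> \<ge> 0"
    and "0 \<le> u" "u \<le> v" "v \<le> 1" "\<theta> > 0"
  shows "\<bar>f v - f u\<bar> * \<theta> \<le> \<alpha> + (v - u) * max (log_mgf \<Phi> \<theta>) (log_mgf \<Phi> (- \<theta>))"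
proof -
  have *: "(f v - f u) * \<eta> - (v - u) * log_mgf \<Phi> \<eta> \<le> \<alpha>" for \<eta>
    using sublevel_partition_le[OF fin f \<open>\<alpha> \<ge> 0\<close>, of 1 "\<lambda>i. if i = 0 then u else v" "\<lambda>_. \<eta>"] assms
    by auto
  have "(v - u) * log_mgf \<Phi> \<eta> \<le> (v - u) * max (log_mgf \<Phi> \<theta>) (log_mgf \<Phi> (- \<theta>))" if "\<eta> = \<theta> \<or> \<eta> = - \<theta>" for \<eta>
    using that assms by (intro mult_left_mono) auto
  from *[of \<theta>] *[of "- \<theta>"] this[of \<theta>] this[of "- \<theta>"] show ?thesis by (auto simp: abs_if left_diff_distrib)
qed

definition slopes :: "nat \<Rightarrow> (real \<Rightarrow> real) \<Rightarrow> nat \<Rightarrow> real" where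
  "slopes m f l = m * (f ((real l + 1) / m) - f (real l / m))"

text \<open>Jensen's inequality in dual form: the partition inequality on the uniform grid holds for
  all parameters, hence for the conjugates of the averaged slopes.\<close>

lemma sublevel_slopes:
  assumes fin: "\<And>\<theta>. \<Phi> \<theta> < \<infinity>" and f: "f \<in> sublevel \<Phi> \<alpha>" and "\<alpha> \<ge> 0" and m: "m > 0"
    and L0: "log_mgf \<Phi> 0 = 0"
  shows "\<forall>l<m. slopes m f l \<in> conjugate_dom (log_mgf \<Phi>)"
    "(\<Sum>l<m. conjugate (log_mgf \<Phi>) (slopes m f l)) \<le> m * \<alpha>"
proof -
  have *: "(\<Sum>l<m. slopes m f l * \<theta> l - log_mgf \<Phi> (\<theta> l)) \<le> m * \<alpha>" for \<theta>
  proof -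
    have "(\<Sum>i<m. (f (real (Suc i) / m) - f (real i / m)) * \<theta> i - (real (Suc i) / m - real i / m) * log_mgf \<Phi> (\<theta> i)) \<le> \<alpha>"
      using m by (intro sublevel_partition_le[OF fin f \<open>\<alpha> \<ge> 0\<close>, where t = "\<lambda>i. real i / m"]) (auto simp: divide_right_mono)
    moreover have "(\<Sum>l<m. slopes m f l * \<theta> l - log_mgf \<Phi> (\<theta> l)) =
      m * (\<Sum>i<m. (f (real (Suc i) / m) - f (real i / m)) * \<theta> i - (real (Suc i) / m - real i / m) * log_mgf \<Phi> (\<theta> i))"
      using m unfolding sum_distrib_left
      by (intro sum.cong) (auto simp: slopes_def add.commute right_diff_distrib diff_divide_distrib[symmetric])
    ultimately show ?thesis using m by simp
  qed
  show "\<forall>l<m. slopes m f l \<in> conjugate_dom (log_mgf \<Phi>)"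
    "(\<Sum>l<m. conjugate (log_mgf \<Phi>) (slopes m f l)) \<le> m * \<alpha>"
    using conjugate_sum_le[where L = "log_mgf \<Phi>" and a = "slopes m f", OF L0 *] by auto
qed

text \<open>The two functions agree at the knots, and inside a cell each stays within \<epsilon> of
  the value at the left knot.\<close>

lemma polygon_slopes_dist:
  assumes m: "m > 0" and s: "0 \<le> s" "s \<le> 1" and f0: "f 0 = 0"
    and osc: "\<And>l u. l < m \<Longrightarrow> real l / m \<le> u \<Longrightarrow> u \<le> (real l + 1) / m \<Longrightarrow> \<bar>f u - f (real l / m)\<bar> \<le> \<epsilon>"
  shows "\<bar>f s - polygon m (slopes m f) s\<bar> \<le> 2 * \<epsilon>"
proof -
  obtain j where j: "j < m" "real j / m \<le> s" "s \<le> (real j + 1) / m" using grid_cell[OF s m] .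
  have sum: "(\<Sum>l<j. slopes m f l) / m = f (real j / m)"
  proof -
    have "(\<Sum>l<j. slopes m f l) / m = (\<Sum>l<j. f (real (Suc l) / m) - f (real l / m))"
      using m by (simp add: slopes_def sum_divide_distrib add.commute)
    also have "\<dots> = f (real j / m)" by (subst sum_lessThan_telescope) (simp add: f0)
    finally show ?thesis .
  qed
  have "\<bar>slopes m f j * (s - j / m)\<bar> = \<bar>f ((real j + 1) / m) - f (real j / m)\<bar> * (m * (s - j / m))"
    using j m by (simp add: slopes_def abs_mult)
  also have "\<dots> \<le> \<epsilon> * 1"
  proof (rule mult_mono)
    show "\<bar>f ((real j + 1) / m) - f (real j / m)\<bar> \<le> \<epsilon>" using j(1) by (intro osc) (auto simp: divide_right_mono)
    then show "0 \<le> \<epsilon>" by simp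
    show "m * (s - j / m) \<le> 1" "0 \<le> m * (s - j / m)" using j m by (auto simp: right_diff_distrib pos_le_divide_eq pos_divide_le_eq mult.commute)
  qed
  finally have "\<bar>slopes m f j * (s - j / m)\<bar> \<le> \<epsilon>" by simp
  moreover have "\<bar>f s - f (real j / m)\<bar> \<le> \<epsilon>" using osc[OF j] .
  ultimately show ?thesis unfolding polygon_eq[OF j] sum by linarith
qed

section \<open>Maximal inequality and oscillation\<close>

context prob_space
begin

lemma prob_ge_1_le:
  assumes [measurable]: "f \<in> borel_measurable M" and le: "(\<integral>\<^sup>+\<omega>. f \<omega> \<partial>M) \<le> ennreal B" and "0 \<le> B"
  shows "prob {\<omega> \<in> space M. 1 \<le> f \<omega>} \<le> B"
proof -
  have "emeasure M {\<omega> \<in> space M. 1 \<le> f \<omega>} \<le> (\<integral>\<^sup>+\<omega>. f \<omega> \<partial>M)"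
    using nn_integral_Markov_inequality[of f "space M" M 1] by (simp cong: nn_integral_cong)
  with le have "ennreal (prob {\<omega> \<in> space M. 1 \<le> f \<omega>}) \<le> ennreal B"
    by (simp add: emeasure_eq_measure)
  then show ?thesis using \<open>0 \<le> B\<close> by simp
qed

lemma chernoff_upper:
  assumes [measurable]: "random_variable borel S" and "\<theta> \<ge> 0"
    and mgf: "(\<integral>\<^sup>+\<omega>. ennreal (exp (\<theta> * S \<omega>)) \<partial>M) = ennreal r" and "0 \<le> r"
  shows "prob {\<omega> \<in> space M. a \<le> S \<omega>} \<le> exp (- \<theta> * a) * r"
proof -
  have "prob {\<omega> \<in> space M. a \<le> S \<omega>} \<le> prob {\<omega> \<in> space M. 1 \<le> ennreal (exp (- \<theta> * a)) * ennreal (exp (\<theta> * S \<omega>))}"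
  proof (rule finite_measure_mono)
    show "{\<omega> \<in> space M. a \<le> S \<omega>} \<subseteq> {\<omega> \<in> space M. 1 \<le> ennreal (exp (- \<theta> * a)) * ennreal (exp (\<theta> * S \<omega>))}"
      using \<open>\<theta> \<ge> 0\<close> by (auto simp: ennreal_mult'[symmetric] exp_add[symmetric] mult_left_mono)
  qed measurable
  also have "\<dots> \<le> exp (- \<theta> * a) * r"
  proof (rule prob_ge_1_le)
    have "(\<integral>\<^sup>+\<omega>. ennreal (exp (- \<theta> * a)) * ennreal (exp (\<theta> * S \<omega>)) \<partial>M) = ennreal (exp (- \<theta> * a)) * ennreal r"
      by (subst nn_integral_cmult) (auto simp: mgf)
    then show "(\<integral>\<^sup>+\<omega>. ennreal (exp (- \<theta> * a)) * ennreal (exp (\<theta> * S \<omega>)) \<partial>M) \<le> ennreal (exp (- \<theta> * a) * r)"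
      using \<open>0 \<le> r\<close> by (simp add: ennreal_mult)
  qed (use \<open>0 \<le> r\<close> in auto)
  finally show ?thesis .
qed

lemma indep_var_nn_integral_mult:
  fixes f g :: "'a \<Rightarrow> ennreal"
  assumes "indep_var borel f borel g"
  shows "(\<integral>\<^sup>+\<omega>. f \<omega> * g \<omega> \<partial>M) = (\<integral>\<^sup>+\<omega>. f \<omega> \<partial>M) * (\<integral>\<^sup>+\<omega>. g \<omega> \<partial>M)"
proof -
  have "(\<lambda>b. case b of True \<Rightarrow> borel | False \<Rightarrow> borel) = (\<lambda>_ :: bool. borel :: ennreal measure)"
    by (auto split: bool.split)
  then have "indep_vars (\<lambda>_. borel) (case_bool f g) UNIV"
    using assms by (simp add: indep_var_def)
  then have "(\<integral>\<^sup>+\<omega>. (\<Prod>b\<in>UNIV. case_bool f g b \<omega>) \<partial>M) = (\<Prod>b\<in>UNIV. \<integral>\<^sup>+\<omega>. case_bool f g b \<omega> \<partial>M)"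
    by (intro indep_vars_nn_integral) auto
  then show ?thesis by (simp add: UNIV_bool mult.commute)
qed

text \<open>Doob's maximal inequality for the exponential martingale, stopped at the first passage
  above \<open>a\<close>; \<open>w k\<close> is the stopped exponential.\<close>

lemma exp_maximal_inequality:
  fixes X :: "nat \<Rightarrow> 'a \<Rightarrow> real"
  assumes ind: "indep_vars (\<lambda>_. borel) X {..<n}"
    and mgf: "\<And>i. i < n \<Longrightarrow> (\<integral>\<^sup>+\<omega>. ennreal (exp (\<theta> * X i \<omega>)) \<partial>M) = ennreal r"
    and "1 \<le> r" "0 \<le> \<theta>" "0 < a"
  shows "prob {\<omega> \<in> space M. \<exists>k\<in>{..n}. a \<le> (\<Sum>i<k. X i \<omega>)} \<le> exp (- \<theta> * a) * r ^ n"
proof -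
  have rv[measurable]: "random_variable borel (X i)" if "i < n" for i
    using ind that by (auto simp: indep_vars_def)
  define below where "below l x \<longleftrightarrow> (\<forall>j\<in>{..l}. (\<Sum>i<j. x i) < a)" for l and x :: "nat \<Rightarrow> real"
  define w where "w k x = (\<Prod>l<k. if below l x then ennreal (exp (\<theta> * x l)) else 1)" for k x
  \<comment> \<open>\<open>U\<close> and \<open>V\<close> split \<open>w k\<close> by whether
    passage is still to come at time \<open>k\<close>. Only on \<open>U\<close> does the next step
    multiply by a new factor, and that factor is independent of \<open>U\<close>.\<close>
  define U where "U k x = w k x * indicator {x. below k x} x" for k x
  define V where "V k x = w k x * indicator {x. \<not> below k x} x" for k x
  have w_cong: "w k x = w k y" "below k x = below k y" if "\<And>i. i < k \<Longrightarrow> x i = y i" for k x y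
  proof -
    have *: "below l x = below l y" if "l \<le> k" for l
    proof -
      have "(\<Sum>i<j. x i) = (\<Sum>i<j. y i)" if "j \<le> l" for j
        using \<open>\<And>i. i < k \<Longrightarrow> x i = y i\<close> \<open>l \<le> k\<close> that by (intro sum.cong) auto
      then show ?thesis by (simp add: below_def)
    qed
    show "below k x = below k y" using * by simp
    show "w k x = w k y" unfolding w_def using * that by (intro prod.cong) auto
  qed
  have below_meas: "Measurable.pred (PiM {..<k} (\<lambda>_. borel)) (below l)" if "l \<le> k" for l k :: nat
    unfolding below_def
  proof (intro pred_intros_finite)
    fix j assume "j \<in> {..l}"
    then have "(\<lambda>x. \<Sum>i<j. x i) \<in> borel_measurable (PiM {..<k} (\<lambda>_. borel :: real measure))"
      using that by (intro borel_measurable_sum measurable_component_singleton) auto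
    then show "Measurable.pred (PiM {..<k} (\<lambda>_. borel)) (\<lambda>x. (\<Sum>i<j. x i) < a)" by measurable
  qed simp
  have w_meas: "w k \<in> borel_measurable (PiM {..<k} (\<lambda>_. borel))" for k
    unfolding w_def
  proof (intro borel_measurable_prod_ennreal)
    fix l assume l: "l \<in> {..<k}"
    then have [measurable]: "(\<lambda>x. x l) \<in> borel_measurable (PiM {..<k} (\<lambda>_. borel :: real measure))"
      by (intro measurable_component_singleton) auto
    have [measurable]: "Measurable.pred (PiM {..<k} (\<lambda>_. borel)) (below l)" using l by (intro below_meas) auto
    show "(\<lambda>x. if below l x then ennreal (exp (\<theta> * x l)) else 1) \<in> borel_measurable (PiM {..<k} (\<lambda>_. borel))"
      by measurable
  qed
  have UV_meas: "U k \<in> borel_measurable (PiM {..<k} (\<lambda>_. borel))" "V k \<in> borel_measurable (PiM {..<k} (\<lambda>_. borel))" for k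
  proof -
    note [measurable] = w_meas[of k] below_meas[of k k, OF order_refl]
    have *: "indicator {x. below k x} x = (if below k x then 1 else 0 :: ennreal)"
      "indicator {x. \<not> below k x} x = (if below k x then 0 else 1 :: ennreal)" for x by auto
    show "U k \<in> borel_measurable (PiM {..<k} (\<lambda>_. borel))" "V k \<in> borel_measurable (PiM {..<k} (\<lambda>_. borel))"
      unfolding U_def V_def * by measurable
  qed
  have past: "(\<lambda>\<omega>. restrict (\<lambda>i. X i \<omega>) {..<k}) \<in> measurable M (PiM {..<k} (\<lambda>_. borel))" if "k \<le> n" for k
    using that by (intro measurable_restrict) auto
  have re: "g (\<lambda>i. X i \<omega>) = g (restrict (\<lambda>i. X i \<omega>) {..<k})" if "g = w k \<or> g = U k \<or> g = V k" for g k \<omega>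
    using that w_cong[of k "\<lambda>i. X i \<omega>" "restrict (\<lambda>i. X i \<omega>) {..<k}"] by (auto simp: U_def V_def indicator_def)
  have gm: "(\<lambda>\<omega>. g (\<lambda>i. X i \<omega>)) \<in> borel_measurable M" if "g = w k \<or> g = U k \<or> g = V k" "k \<le> n" for g k
    unfolding re[OF that(1)] using that UV_meas w_meas
    by (intro measurable_compose[OF past[OF that(2)]]) auto
  have E: "(\<integral>\<^sup>+\<omega>. w k (\<lambda>i. X i \<omega>) \<partial>M) \<le> ennreal (r ^ k)" if "k \<le> n" for k
    using that
  proof (induction k)
    case 0
    then show ?case by (simp add: w_def emeasure_space_1)
  next
    case (Suc k)
    then have k: "k < n" "k \<le> n" by auto
    note [measurable] = rv[OF k(1)] gm[of "U k" k] gm[of "V k" k] gm[of "w k" k]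
    have "indep_var (PiM {..<k} (\<lambda>_. borel)) (\<lambda>\<omega>. restrict (\<lambda>i. X i \<omega>) {..<k})
       (PiM {k} (\<lambda>_. borel)) (\<lambda>\<omega>. restrict (\<lambda>i. X i \<omega>) {k})"
      using k by (intro indep_var_restrict[OF ind]) auto
    then have "indep_var borel (U k \<circ> (\<lambda>\<omega>. restrict (\<lambda>i. X i \<omega>) {..<k}))
       borel ((\<lambda>x. ennreal (exp (\<theta> * x k))) \<circ> (\<lambda>\<omega>. restrict (\<lambda>i. X i \<omega>) {k}))"
      by (rule indep_var_compose) (use UV_meas in auto)
    then have indep: "indep_var borel (\<lambda>\<omega>. U k (\<lambda>i. X i \<omega>)) borel (\<lambda>\<omega>. ennreal (exp (\<theta> * X k \<omega>)))"
      by (simp add: comp_def re[of "U k" k, symmetric])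
    have split: "w (Suc k) (\<lambda>i. X i \<omega>) = V k (\<lambda>i. X i \<omega>) + U k (\<lambda>i. X i \<omega>) * ennreal (exp (\<theta> * X k \<omega>))" for \<omega>
      by (auto simp: w_def U_def V_def)
    have "(\<integral>\<^sup>+\<omega>. w (Suc k) (\<lambda>i. X i \<omega>) \<partial>M) =
        (\<integral>\<^sup>+\<omega>. V k (\<lambda>i. X i \<omega>) \<partial>M) + (\<integral>\<^sup>+\<omega>. U k (\<lambda>i. X i \<omega>) * ennreal (exp (\<theta> * X k \<omega>)) \<partial>M)"
      unfolding split using k by (intro nn_integral_add) (auto intro!: gm)
    also have "(\<integral>\<^sup>+\<omega>. U k (\<lambda>i. X i \<omega>) * ennreal (exp (\<theta> * X k \<omega>)) \<partial>M) = (\<integral>\<^sup>+\<omega>. U k (\<lambda>i. X i \<omega>) \<partial>M) * ennreal r"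
      by (simp add: indep_var_nn_integral_mult[OF indep] mgf[OF k(1)])
    \<comment> \<open>The stopped part gains no factor; since \<open>r\<close> is at least 1 it may
      be given one, and the two parts recombine.\<close>
    also have "(\<integral>\<^sup>+\<omega>. V k (\<lambda>i. X i \<omega>) \<partial>M) \<le> (\<integral>\<^sup>+\<omega>. V k (\<lambda>i. X i \<omega>) \<partial>M) * ennreal r"
      using mult_left_mono[of 1 "ennreal r" "\<integral>\<^sup>+\<omega>. V k (\<lambda>i. X i \<omega>) \<partial>M"] \<open>1 \<le> r\<close> by simp
    also have "(\<integral>\<^sup>+\<omega>. V k (\<lambda>i. X i \<omega>) \<partial>M) * ennreal r + (\<integral>\<^sup>+\<omega>. U k (\<lambda>i. X i \<omega>) \<partial>M) * ennreal r
       = (\<integral>\<^sup>+\<omega>. V k (\<lambda>i. X i \<omega>) + U k (\<lambda>i. X i \<omega>) \<partial>M) * ennreal r"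
      using k by (subst nn_integral_add) (auto intro!: gm simp: distrib_right)
    also have "(\<integral>\<^sup>+\<omega>. V k (\<lambda>i. X i \<omega>) + U k (\<lambda>i. X i \<omega>) \<partial>M) = (\<integral>\<^sup>+\<omega>. w k (\<lambda>i. X i \<omega>) \<partial>M)"
      by (intro nn_integral_cong) (auto simp: U_def V_def indicator_def)
    also have "\<dots> * ennreal r \<le> ennreal (r ^ k) * ennreal r"
      using Suc.IH k by (intro mult_right_mono) auto
    also have "\<dots> = ennreal (r ^ Suc k)" using \<open>1 \<le> r\<close> by (simp add: ennreal_mult'[symmetric] mult.commute)
    finally show ?case by (simp add: add_right_mono)
  qed
  \<comment> \<open>If level \<open>a\<close> is reached, the product stops at the first passage and
    equals the exponential of \<theta> times a sum that is at least \<open>a\<close>.\<close>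
  have cross: "1 \<le> ennreal (exp (- \<theta> * a)) * w n x" if ex: "\<exists>k\<le>n. a \<le> (\<Sum>i<k. x i)" for x :: "nat \<Rightarrow> real"
  proof -
    define k where "k = (LEAST k. a \<le> (\<Sum>i<k. x i))"
    have k: "a \<le> (\<Sum>i<k. x i)" unfolding k_def by (rule LeastI_ex) (use ex in blast)
    have least: "(\<Sum>i<j. x i) < a" if "j < k" for j using not_less_Least[of j] that unfolding k_def by force
    obtain k0 where k0: "k0 \<le> n" "a \<le> (\<Sum>i<k0. x i)" using ex by blast
    have "k \<le> k0" unfolding k_def by (rule Least_le) (rule k0(2))
    with k0(1) have "k \<le> n" by simp
    have "w n x = (\<Prod>l<n. if l < k then ennreal (exp (\<theta> * x l)) else 1)"
    proof -
      have "below l x \<longleftrightarrow> l < k" for l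
      proof (cases "l < k")
        case True then show ?thesis using least by (auto simp: below_def)
      next
        case False then show ?thesis using k by (auto simp: below_def not_less intro!: bexI[of _ k])
      qed
      then show ?thesis by (simp add: w_def)
    qed
    also have "\<dots> = (\<Prod>l<k. ennreal (exp (\<theta> * x l)))"
      using \<open>k \<le> n\<close> by (intro prod.mono_neutral_cong_right) auto
    also have "\<dots> = ennreal (exp (\<theta> * (\<Sum>l<k. x l)))" 
      by (simp add: prod_ennreal exp_sum sum_distrib_left)
    finally show ?thesis using k \<open>0 \<le> \<theta>\<close> by (simp add: ennreal_mult'[symmetric] exp_add[symmetric] mult_left_mono)
  qed
  have wn[measurable]: "(\<lambda>\<omega>. w n (\<lambda>i. X i \<omega>)) \<in> borel_measurable M"
    by (rule gm) auto
  have "prob {\<omega> \<in> space M. \<exists>k\<in>{..n}. a \<le> (\<Sum>i<k. X i \<omega>)} \<le> prob {\<omega> \<in> space M. 1 \<le> ennreal (exp (- \<theta> * a)) * w n (\<lambda>i. X i \<omega>)}"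
  proof (rule finite_measure_mono)
    show "{\<omega> \<in> space M. 1 \<le> ennreal (exp (- \<theta> * a)) * w n (\<lambda>i. X i \<omega>)} \<in> events"
      by measurable
  qed (use cross in auto)
  also have "\<dots> \<le> exp (- \<theta> * a) * r ^ n"
  proof (rule prob_ge_1_le)
    show "(\<lambda>\<omega>. ennreal (exp (- \<theta> * a)) * w n (\<lambda>i. X i \<omega>)) \<in> borel_measurable M" by measurable
    have "(\<integral>\<^sup>+\<omega>. ennreal (exp (- \<theta> * a)) * w n (\<lambda>i. X i \<omega>) \<partial>M) = ennreal (exp (- \<theta> * a)) * (\<integral>\<^sup>+\<omega>. w n (\<lambda>i. X i \<omega>) \<partial>M)"
      by (rule nn_integral_cmult[OF wn])
    also have "\<dots> \<le> ennreal (exp (- \<theta> * a)) * ennreal (r ^ n)" using E by (intro mult_left_mono) auto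
    finally show "(\<integral>\<^sup>+\<omega>. ennreal (exp (- \<theta> * a)) * w n (\<lambda>i. X i \<omega>) \<partial>M) \<le> ennreal (exp (- \<theta> * a) * r ^ n)"
      using \<open>1 \<le> r\<close> by (simp add: ennreal_mult')
  qed (use \<open>1 \<le> r\<close> in simp)
  finally show ?thesis .
qed

lemma AE_eventually_not_in:
  assumes A: "\<And>k. A k \<in> events" and le: "\<forall>\<^sub>F k in sequentially. prob (A k) \<le> b k" and b: "summable b"
  shows "AE \<omega> in M. \<forall>\<^sub>F k in sequentially. \<omega> \<notin> A k"
proof -
  have "summable (\<lambda>k. prob (A k))"
    using le by (intro summable_comparison_test_ev[OF _ b]) simp
  then have "AE \<omega> in M. \<forall>\<^sub>F k in sequentially. \<omega> \<in> space M - A k"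
    using A by (intro borel_cantelli_AE1) (auto simp: emeasure_eq_measure)
  then show ?thesis by eventually_elim (auto elim: eventually_mono)
qed

end

section \<open>Oscillation between grid points\<close>

text \<open>With \<open>n\<close> at most \<open>exp ((k + 1) / c)\<close>, a grid point
  \<open>i * (k / m)\<close> not beyond \<open>n\<close> has an index \<open>i\<close> at most
  \<open>n * m / k\<close>. The factor \<open>1 / k\<close> is given away; what matters is that the
  number of indices is of order \<open>exp (k / c)\<close>.\<close>

definition grid_indices :: "nat \<Rightarrow> real \<Rightarrow> nat \<Rightarrow> nat set" where
  "grid_indices m c k = {i. real i \<le> m * exp ((real k + 1) / c)}"

lemma grid_indices_eq: "grid_indices m c k = {..nat \<lfloor>m * exp ((real k + 1) / c)\<rfloor>}"
  by (auto simp: grid_indices_def le_nat_floor le_nat_iff le_floor_iff)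

lemma finite_grid_indices: "finite (grid_indices m c k)"
  by (simp add: grid_indices_eq)

lemma card_grid_indices:
  assumes c: "c > 0"
  shows "real (card (grid_indices m c k)) \<le> (m * exp (1 / c) + 1) * exp (real k / c)"
proof -
  have "real (card (grid_indices m c k)) \<le> m * exp ((real k + 1) / c) + 1" by (simp add: grid_indices_eq)
  also have "m * exp ((real k + 1) / c) = m * exp (1 / c) * exp (real k / c)"
    by (simp add: add_divide_distrib exp_add)
  also have "\<dots> + 1 \<le> m * exp (1 / c) * exp (real k / c) + exp (real k / c)"
    using c by simp
  finally show ?thesis by (simp add: distrib_right)
qed

text \<open>The properties of the centred process on which the estimates rest. The logarithm of the
  moment generating function is linear in time; only rational lengths \<open>p / q\<close> are asked
  for.\<close>

locale exp_moment_increments = prob_space M for M :: "'a measure" +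
  fixes W :: "real \<Rightarrow> 'a \<Rightarrow> real" and L :: "real \<Rightarrow> real"
  assumes rv: "\<And>t. 0 \<le> t \<Longrightarrow> random_variable borel (W t)"
    and indep: "\<And>(t :: nat \<Rightarrow> real) m. 0 \<le> t 0 \<Longrightarrow> (\<And>i. i < m \<Longrightarrow> t i \<le> t (Suc i)) \<Longrightarrow>
         indep_vars (\<lambda>_. borel) (\<lambda>i \<omega>. W (t (Suc i)) \<omega> - W (t i) \<omega>) {..<m}"
    and mgf: "\<And>x (p :: nat) (q :: nat) \<theta>. 0 \<le> x \<Longrightarrow> q > 0 \<Longrightarrow>
         (\<integral>\<^sup>+\<omega>. ennreal (exp (\<theta> * (W (x + p / q) \<omega> - W x \<omega>))) \<partial>M) = ennreal (exp (p / q * L \<theta>))"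
    and L_0: "L 0 = 0" and L_nonneg: "\<And>\<theta>. 0 \<le> L \<theta>"
    and right_continuous: "\<And>\<omega> t. \<omega> \<in> space M \<Longrightarrow> 0 \<le> t \<Longrightarrow> ((\<lambda>t. W t \<omega>) \<longlongrightarrow> W t \<omega>) (at_right t)"
begin

text \<open>Testing at dyadic fractions of \<open>h\<close> only makes this a countable union of
  events, each accessible to the discrete maximal inequality.\<close>

definition dyadic_osc :: "real \<Rightarrow> real \<Rightarrow> real \<Rightarrow> 'a set" where
  "dyadic_osc x h a = (\<Union>j. {\<omega> \<in> space M. \<exists>k\<in>{..2 ^ j}. a < \<bar>W (x + h * (real k / 2 ^ j)) \<omega> - W x \<omega>\<bar>})"

lemma dyadic_osc_event:
  assumes "0 \<le> x" "0 \<le> h"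
  shows "dyadic_osc x h a \<in> events"
proof -
  have "{\<omega> \<in> space M. \<exists>k\<in>{..2 ^ j}. a < \<bar>W (x + h * (real k / 2 ^ j)) \<omega> - W x \<omega>\<bar>} \<in> events" for j :: nat
  proof (rule sets.sets_Collect_finite_Ex)
    fix k :: nat
    have [measurable]: "random_variable borel (W (x + h * (real k / 2 ^ j)))" "random_variable borel (W x)"
      using assms by (auto intro!: rv)
    show "{\<omega> \<in> space M. a < \<bar>W (x + h * (real k / 2 ^ j)) \<omega> - W x \<omega>\<bar>} \<in> events" by measurable
  qed simp
  then show ?thesis unfolding dyadic_osc_def by (intro sets.countable_UN) auto
qed

text \<open>Right continuity transfers the bound from dyadic points decreasing to
  \<open>x + s\<close>. The end point \<open>s = h\<close> cannot be approached from the right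
  inside the window, but it is itself a tested point.\<close>

lemma not_dyadic_osc:
  assumes \<omega>: "\<omega> \<in> space M" "\<omega> \<notin> dyadic_osc x h a" and "0 \<le> x" "0 < h" and s: "0 \<le> s" "s \<le> h"
  shows "\<bar>W (x + s) \<omega> - W x \<omega>\<bar> \<le> a"
proof (cases "s = h")
  case True
  have "\<not> a < \<bar>W (x + h * (real 1 / 2 ^ 0)) \<omega> - W x \<omega>\<bar>"
  proof
    assume "a < \<bar>W (x + h * (real 1 / 2 ^ 0)) \<omega> - W x \<omega>\<bar>"
    then have "\<omega> \<in> dyadic_osc x h a"
      unfolding dyadic_osc_def using \<omega>(1) by (intro UN_I[of 0]) (auto intro!: bexI[of _ 1])
    with \<omega> show False by simp
  qed
  then show ?thesis using True by simp
next
  case False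
  with s have "s < h" by simp
  \<comment> \<open>The added 1 puts the point strictly to the right of \<open>x + s\<close>, as the
    limit along \<open>at_right\<close> requires; \<open>s < h\<close> keeps it inside the
    window.\<close>
  define d where "d j = x + h * (real (nat \<lfloor>s / h * 2 ^ j\<rfloor> + 1) / 2 ^ j)" for j :: nat
  have k: "real (nat \<lfloor>s / h * 2 ^ j\<rfloor>) \<le> s / h * 2 ^ j" "s / h * 2 ^ j < real (nat \<lfloor>s / h * 2 ^ j\<rfloor> + 1)" for j
  proof -
    have "0 \<le> s / h * 2 ^ j" using s \<open>0 < h\<close> by simp
    then have "real (nat \<lfloor>s / h * 2 ^ j\<rfloor>) = \<lfloor>s / h * 2 ^ j\<rfloor>" by simp
    then show "real (nat \<lfloor>s / h * 2 ^ j\<rfloor>) \<le> s / h * 2 ^ j" "s / h * 2 ^ j < real (nat \<lfloor>s / h * 2 ^ j\<rfloor> + 1)"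
      by linarith+
  qed
  have "s / h < 1" using \<open>s < h\<close> \<open>0 < h\<close> by simp
  have kj: "nat \<lfloor>s / h * 2 ^ j\<rfloor> + 1 \<le> 2 ^ j" for j
  proof -
    have "s / h * 2 ^ j < 1 * 2 ^ j" using \<open>s / h < 1\<close> by (intro mult_strict_right_mono) auto
    also have "\<dots> = real (2 ^ j)" by simp
    finally have "real (nat \<lfloor>s / h * 2 ^ j\<rfloor>) < real (2 ^ j)" using k(1)[of j] by linarith
    then have "nat \<lfloor>s / h * 2 ^ j\<rfloor> < 2 ^ j" by (simp only: of_nat_less_iff)
    then show ?thesis by linarith
  qed
  have le: "\<bar>W (d j) \<omega> - W x \<omega>\<bar> \<le> a" for j
  proof (rule ccontr)
    assume "\<not> ?thesis"
    then have "\<omega> \<in> dyadic_osc x h a"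
      unfolding dyadic_osc_def d_def using \<omega>(1) kj[of j] by (intro UN_I[of j] CollectI conjI bexI[of _ "nat \<lfloor>s / h * 2 ^ j\<rfloor> + 1"]) (auto simp: not_le)
    with \<omega> show False by simp
  qed
  have gt: "x + s < d j" for j
  proof -
    have "s / h < real (nat \<lfloor>s / h * 2 ^ j\<rfloor> + 1) / 2 ^ j" using k(2)[of j] by (simp add: field_simps)
    then have "h * (s / h) < h * (real (nat \<lfloor>s / h * 2 ^ j\<rfloor> + 1) / 2 ^ j)"
      using \<open>0 < h\<close> by (intro mult_strict_left_mono)
    then show ?thesis using \<open>0 < h\<close> by (simp add: d_def)
  qed
  have upper: "d j \<le> x + s + h * (1 / 2) ^ j" for j
  proof -
    have "real (nat \<lfloor>s / h * 2 ^ j\<rfloor> + 1) / 2 ^ j \<le> (s / h * 2 ^ j + 1) / 2 ^ j"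
      using k(1)[of j] by (intro divide_right_mono) auto
    also have "\<dots> = s / h + (1 / 2) ^ j" by (simp add: add_divide_distrib power_one_over)
    finally have "h * (real (nat \<lfloor>s / h * 2 ^ j\<rfloor> + 1) / 2 ^ j) \<le> h * (s / h + (1 / 2) ^ j)"
      using \<open>0 < h\<close> by (intro mult_left_mono) auto
    then show ?thesis using \<open>0 < h\<close> by (simp add: d_def distrib_left)
  qed
  have "(\<lambda>j. x + s + h * (1 / 2) ^ j) \<longlonglongrightarrow> x + s + h * 0"
    by (intro tendsto_intros LIMSEQ_realpow_zero) auto
  then have "d \<longlonglongrightarrow> x + s"
    by (intro tendsto_sandwich[of "\<lambda>_. x + s" d sequentially "\<lambda>j. x + s + h * (1 / 2) ^ j"])
       (auto intro!: always_eventually less_imp_le[OF gt] upper)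
  then have "filterlim d (at_right (x + s)) sequentially"
    using gt by (auto simp: filterlim_at intro!: always_eventually) (metis less_irrefl)
  then have "(\<lambda>j. W (d j) \<omega>) \<longlonglongrightarrow> W (x + s) \<omega>"
    using \<open>0 \<le> x\<close> s by (intro filterlim_compose[OF right_continuous[OF \<omega>(1)]]) auto
  then have "(\<lambda>j. \<bar>W (d j) \<omega> - W x \<omega>\<bar>) \<longlonglongrightarrow> \<bar>W (x + s) \<omega> - W x \<omega>\<bar>"
    by (intro tendsto_intros)
  then show ?thesis by (rule LIMSEQ_le_const2) (use le in auto)
qed

text \<open>The maximal inequality is applied to \<open>W\<close> and to its negative at each dyadic
  level. The bound does not depend on the level, since the factors of the \<open>N\<close> small
  steps multiply to the one for the whole length; the events increase with the level.\<close>

lemma prob_dyadic_osc_le: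
  assumes x: "0 \<le> x" and q: "q > 0" and \<theta>: "\<theta> \<ge> 0" and a: "a > 0"
  shows "prob (dyadic_osc x (real p / real q) a) \<le>
    exp (- \<theta> * a) * (exp (real p / real q * L \<theta>) + exp (real p / real q * L (- \<theta>)))"
    (is "_ \<le> ?B")
proof -
  define h where "h = real p / real q"
  have h: "0 \<le> h" by (simp add: h_def)
  define D where "D j = {\<omega> \<in> space M. \<exists>k\<in>{..2 ^ j}. a < \<bar>W (x + h * (real k / 2 ^ j)) \<omega> - W x \<omega>\<bar>}" for j :: nat
  have W_meas[measurable]: "random_variable borel (W (x + h * (real k / 2 ^ j)))" "random_variable borel (W x)" for k j :: nat
    using x h by (auto intro!: rv)
  have D_meas: "D j \<in> events" for j
  proof -
    have "{\<omega> \<in> space M. \<exists>k\<in>{..2 ^ j}. a < \<bar>W (x + h * (real k / 2 ^ j)) \<omega> - W x \<omega>\<bar>} \<in> events"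
    proof (rule sets.sets_Collect_finite_Ex)
      fix k show "{\<omega> \<in> space M. a < \<bar>W (x + h * (real k / 2 ^ j)) \<omega> - W x \<omega>\<bar>} \<in> events" by measurable
    qed simp
    then show ?thesis unfolding D_def .
  qed
  have inc: "incseq D"
  proof (rule incseq_SucI, rule subsetI)
    fix j \<omega> assume "\<omega> \<in> D j"
    then obtain k where "\<omega> \<in> space M" "k \<le> 2 ^ j" "a < \<bar>W (x + h * (real k / 2 ^ j)) \<omega> - W x \<omega>\<bar>"
      by (auto simp: D_def)
    then show "\<omega> \<in> D (Suc j)" unfolding D_def by (auto intro!: bexI[of _ "2 * k"])
  qed
  have bound: "prob (D j) \<le> ?B" for j
  proof -
    define N :: nat where "N = 2 ^ j"
    define t where "t i = x + h * (real i / 2 ^ j)" for i :: nat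
    define X where "X i \<omega> = W (t (Suc i)) \<omega> - W (t i) \<omega>" for i \<omega>
    have ind: "indep_vars (\<lambda>_. borel) X {..<N}"
      unfolding X_def using x h by (intro indep[of t]) (auto simp: t_def divide_right_mono mult_left_mono)
    have sum: "(\<Sum>i<k. X i \<omega>) = W (x + h * (real k / 2 ^ j)) \<omega> - W x \<omega>" for k \<omega>
      using sum_lessThan_telescope[of "\<lambda>i. W (t i) \<omega>" k] by (simp add: X_def t_def)
    have tstep: "t (Suc i) = t i + real p / real (q * N)" for i
      by (simp add: t_def h_def N_def add_divide_distrib distrib_left)
    have t0: "0 \<le> t i" for i using x h by (simp add: t_def)
    have mg: "(\<integral>\<^sup>+\<omega>. ennreal (exp (\<eta> * X i \<omega>)) \<partial>M) = ennreal (exp (real p / real (q * N) * L \<eta>))" for i \<eta>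
      unfolding X_def tstep using q t0 by (intro mgf) (auto simp: N_def)
    have "exp (real p / real (q * N) * L \<eta>) ^ N = exp (real N * (real p / real (q * N) * L \<eta>))" for \<eta>
      by (rule exp_of_nat_mult[symmetric])
    also have "real N * (real p / real (q * N) * L \<eta>) = h * L \<eta>" for \<eta>
      using q by (simp add: h_def N_def)
    finally have pw: "exp (real p / real (q * N) * L \<eta>) ^ N = exp (h * L \<eta>)" for \<eta> .
    have r1: "1 \<le> exp (real p / real (q * N) * L \<eta>)" for \<eta> using L_nonneg by simp
    have up: "prob {\<omega> \<in> space M. \<exists>k\<in>{..N}. a \<le> (\<Sum>i<k. X i \<omega>)} \<le> exp (- \<theta> * a) * exp (h * L \<theta>)"
      unfolding pw[symmetric] by (rule exp_maximal_inequality[OF ind mg r1 \<theta> a])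
    have ind': "indep_vars (\<lambda>_. borel) (\<lambda>i \<omega>. - X i \<omega>) {..<N}"
      by (rule indep_vars_compose2[OF ind]) auto
    have mg': "(\<integral>\<^sup>+\<omega>. ennreal (exp (\<theta> * - X i \<omega>)) \<partial>M) = ennreal (exp (real p / real (q * N) * L (- \<theta>)))" for i
      using mg[of "- \<theta>" i] by simp
    have low: "prob {\<omega> \<in> space M. \<exists>k\<in>{..N}. a \<le> (\<Sum>i<k. - X i \<omega>)} \<le> exp (- \<theta> * a) * exp (h * L (- \<theta>))"
      unfolding pw[symmetric] by (rule exp_maximal_inequality[OF ind' mg' r1 \<theta> a])
    let ?U = "{\<omega> \<in> space M. \<exists>k\<in>{..N}. a \<le> (\<Sum>i<k. X i \<omega>)}" and ?V = "{\<omega> \<in> space M. \<exists>k\<in>{..N}. a \<le> (\<Sum>i<k. - X i \<omega>)}"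
    have sum': "(\<Sum>i<k. - X i \<omega>) = - (W (x + h * (real k / 2 ^ j)) \<omega> - W x \<omega>)" for k \<omega>
      unfolding sum_negf sum ..
    have ev: "?U \<in> events" "?V \<in> events"
      unfolding sum sum' by (rule sets.sets_Collect_finite_Ex; measurable)+
    have "D j \<subseteq> ?U \<union> ?V"
    proof
      fix \<omega> assume "\<omega> \<in> D j"
      then obtain k where k: "\<omega> \<in> space M" "k \<in> {..N}" "a < \<bar>W (x + h * (real k / 2 ^ j)) \<omega> - W x \<omega>\<bar>"
        unfolding D_def N_def by blast
      then have "a \<le> (\<Sum>i<k. X i \<omega>) \<or> a \<le> (\<Sum>i<k. - X i \<omega>)"
        unfolding sum sum' by linarith
      then show "\<omega> \<in> ?U \<union> ?V" using k(1,2) by blast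
    qed
    then have "prob (D j) \<le> prob (?U \<union> ?V)" using ev by (intro finite_measure_mono) auto
    also have "\<dots> \<le> prob ?U + prob ?V" using ev by (intro measure_Un_le)
    also have "\<dots> \<le> ?B" using up low by (simp add: h_def distrib_left)
    finally show ?thesis .
  qed
  have "(\<lambda>j. prob (D j)) \<longlonglongrightarrow> prob (\<Union>j. D j)"
    using D_meas inc by (intro finite_Lim_measure_incseq) auto
  then have "prob (\<Union>j. D j) \<le> ?B" by (rule LIMSEQ_le_const2) (use bound in auto)
  then show ?thesis by (simp add: dyadic_osc_def D_def h_def)
qed

lemma oscillation_eventually:
  assumes c: "c > 0" and \<epsilon>: "\<epsilon> > 0"
  obtains m0 where "\<And>m. m \<ge> m0 \<Longrightarrow> m > (0::nat) \<Longrightarrow> AE \<omega> in M. \<forall>\<^sub>F k in sequentially.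
     \<forall>i\<in>grid_indices m c k.
       (\<forall>s::real. 0 \<le> s \<and> s \<le> real k / m \<longrightarrow> \<bar>W (real i * (real k / m) + s) \<omega> - W (real i * (real k / m)) \<omega>\<bar> \<le> \<epsilon> * real k)"
proof -
  \<comment> \<open>The exponent \<open>1 / c + 2\<close> pays \<open>1 / c\<close> for the number
    of grid points and 1 for the moment generating function, leaving the summable factor
    \<open>exp (- k)\<close>.\<close>
  define \<theta> where "\<theta> = (1 / c + 2) / \<epsilon>"
  have \<theta>: "\<theta> \<ge> 0" "\<theta> * \<epsilon> = 1 / c + 2" using c \<epsilon> by (auto simp: \<theta>_def)
  \<comment> \<open>For \<open>m\<close> above \<open>L \<theta>\<close> and
    \<open>L (- \<theta>)\<close> the moment generating function over a piece of length
    \<open>k / m\<close> costs at most \<open>exp k\<close>.\<close>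
  define m0 where "m0 = nat \<lceil>max (L \<theta>) (L (- \<theta>))\<rceil>"
  show thesis
  proof (rule that[of m0])
    fix m :: nat assume m: "m \<ge> m0" "m > 0"
    then have Lm: "L \<theta> \<le> m" "L (- \<theta>) \<le> m" unfolding m0_def by linarith+
    define I where "I k = grid_indices m c k" for k :: nat
    have fin: "finite (I k)" for k by (simp add: I_def finite_grid_indices)
    have card: "real (card (I k)) \<le> (m * exp (1 / c) + 1) * exp (real k / c)" for k
      using card_grid_indices[OF c] by (simp add: I_def)
    define A where "A k = (\<Union>i\<in>I k. dyadic_osc (real i * (real k / m)) (real k / m) (\<epsilon> * real k))" for k
    have A: "A k \<in> events" for k unfolding A_def using fin by (auto intro!: dyadic_osc_event)
    have "prob (A k) \<le> 2 * (m * exp (1 / c) + 1) * exp (- 1) ^ k" if "k > 0" for k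
    proof -
      have each: "prob (dyadic_osc (real i * (real k / m)) (real k / m) (\<epsilon> * real k)) \<le> 2 * exp (- (1 / c + 1) * k)" for i
      proof -
        have le: "exp (real k / m * L \<eta>) \<le> exp (real k)" if "L \<eta> \<le> m" for \<eta>
          using mult_left_mono[OF that, of "real k / m"] m by simp
        have "prob (dyadic_osc (real i * (real k / m)) (real k / m) (\<epsilon> * real k)) \<le>
          exp (- \<theta> * (\<epsilon> * real k)) * (exp (real k / real m * L \<theta>) + exp (real k / real m * L (- \<theta>)))"
          using m \<theta> \<epsilon> that by (intro prob_dyadic_osc_le) auto
        also have "\<dots> \<le> exp (- \<theta> * (\<epsilon> * real k)) * (exp (real k) + exp (real k))"
          using le Lm by (intro mult_left_mono add_mono) auto
        also have "- \<theta> * (\<epsilon> * real k) = - (1 / c + 2) * k" using \<theta>(2) by (simp add: mult.assoc[symmetric])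
        also have "exp (- (1 / c + 2) * k) * (exp (real k) + exp (real k)) = 2 * exp (- (1 / c + 1) * k)"
          by (simp add: exp_add[symmetric] algebra_simps)
        finally show ?thesis .
      qed
      have "prob (A k) \<le> (\<Sum>i\<in>I k. prob (dyadic_osc (real i * (real k / m)) (real k / m) (\<epsilon> * real k)))"
        unfolding A_def using fin by (intro finite_measure_subadditive_finite) (auto intro!: dyadic_osc_event)
      also have "\<dots> \<le> (\<Sum>i\<in>I k. 2 * exp (- (1 / c + 1) * k))" using each by (intro sum_mono)
      also have "\<dots> = card (I k) * (2 * exp (- (1 / c + 1) * k))" by simp
      also have "\<dots> \<le> ((m * exp (1 / c) + 1) * exp (real k / c)) * (2 * exp (- (1 / c + 1) * k))"
        using card by (intro mult_right_mono) auto
      also have "\<dots> = 2 * (m * exp (1 / c) + 1) * (exp (real k / c) * exp (- (1 / c + 1) * k))" by simp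
      also have "exp (real k / c) * exp (- (1 / c + 1) * k) = exp (- 1) ^ k"
        by (simp add: exp_add[symmetric] exp_of_nat_mult[symmetric] algebra_simps)
      finally show ?thesis .
    qed
    then have "\<forall>\<^sub>F k in sequentially. prob (A k) \<le> 2 * (m * exp (1 / c) + 1) * exp (- 1) ^ k"
      by (intro eventually_mono[OF eventually_gt_at_top[of 0]])
    moreover have "summable (\<lambda>k. 2 * (m * exp (1 / c) + 1) * exp (- 1 :: real) ^ k)"
      by (intro summable_mult summable_geometric) simp
    ultimately have "AE \<omega> in M. \<forall>\<^sub>F k in sequentially. \<omega> \<notin> A k"
      using A by (intro AE_eventually_not_in)
    then show "AE \<omega> in M. \<forall>\<^sub>F k in sequentially.
     \<forall>i\<in>grid_indices m c k.
       (\<forall>s::real. 0 \<le> s \<and> s \<le> real k / m \<longrightarrow> \<bar>W (real i * (real k / m) + s) \<omega> - W (real i * (real k / m)) \<omega>\<bar> \<le> \<epsilon> * real k)"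
      using AE_space
    proof eventually_elim
      case (elim \<omega>)
      from elim(1) eventually_gt_at_top[of 0] show ?case
      proof eventually_elim
        case (elim k)
        then show ?case using \<open>\<omega> \<in> space M\<close> m
          by (auto simp: A_def I_def intro!: not_dyadic_osc)
      qed
    qed
  qed
qed

end

section \<open>Exponential moments of the conjugate\<close>

text \<open>A union of open sets over all parameters. It makes the event that the conjugate exceeds
  \<open>u\<close>, or is infinite, measurable without a measurable conjugate.\<close>

lemma open_exceeding: "open {a::real. \<exists>\<theta>. P \<theta> \<and> a * \<theta> - L \<theta> > u}"
proof -
  have "{a. \<exists>\<theta>. P \<theta> \<and> a * \<theta> - L \<theta> > u} = (\<Union>\<theta>\<in>{\<theta>. P \<theta>}. {a. a * \<theta> - L \<theta> > u})" by auto
  also have "open \<dots>" by (intro open_UN ballI open_Collect_less continuous_intros)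
  finally show ?thesis .
qed

lemma prod_le_ennreal:
  fixes f g :: "nat \<Rightarrow> ennreal"
  assumes "\<And>l. l < m \<Longrightarrow> f l \<le> g l"
  shows "prod f {..<m} \<le> prod g {..<m}"
  using assms by (induction m) (auto intro: mult_mono)

context prob_space
begin

text \<open>A nonempty upward closed set that is bounded below is a half-line from its infimum; if
  the infimum is missing, closed half-lines exhaust it. Thus a bound whose parameter varies with
  \<open>a\<close> passes to the whole set without a union over parameters.\<close>

lemma prob_upward_closed_le:
  fixes Y :: "'a \<Rightarrow> real" and T :: "real set"
  assumes [measurable]: "random_variable borel Y"
    and up: "\<And>a b. a \<in> T \<Longrightarrow> a \<le> b \<Longrightarrow> b \<in> T" and bdd: "bdd_below T"
    and le: "\<And>a. a \<in> T \<Longrightarrow> prob {\<omega> \<in> space M. a \<le> Y \<omega>} \<le> B" and "0 \<le> B"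
  shows "prob {\<omega> \<in> space M. Y \<omega> \<in> T} \<le> B"
proof (cases "T = {} \<or> Inf T \<in> T")
  case True
  then show ?thesis
  proof
    assume "Inf T \<in> T"
    have "{\<omega> \<in> space M. Y \<omega> \<in> T} \<subseteq> {\<omega> \<in> space M. Inf T \<le> Y \<omega>}"
      using bdd by (auto intro: cInf_lower)
    then have "prob {\<omega> \<in> space M. Y \<omega> \<in> T} \<le> prob {\<omega> \<in> space M. Inf T \<le> Y \<omega>}"
      by (intro finite_measure_mono) auto
    with le[OF \<open>Inf T \<in> T\<close>] show ?thesis by simp
  qed (use \<open>0 \<le> B\<close> in simp)
next
  case False
  then have ne: "T \<noteq> {}" and not: "Inf T \<notin> T" by auto
  define A where "A n = {\<omega> \<in> space M. Inf T + inverse (real (Suc n)) \<le> Y \<omega>}" for n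
  have A: "A n \<in> events" for n unfolding A_def by measurable
  have in_T: "Inf T + inverse (real (Suc n)) \<in> T" for n
  proof -
    have "Inf T < Inf T + inverse (real (Suc n))" by simp
    then obtain a where "a \<in> T" "a < Inf T + inverse (real (Suc n))"
      using cInf_lessD[OF ne] by blast
    then show ?thesis using up by (meson less_imp_le)
  qed
  have "incseq A"
  proof (rule incseq_SucI)
    fix n
    have "inverse (real (Suc (Suc n))) \<le> inverse (real (Suc n))" by (intro le_imp_inverse_le) auto
    then show "A n \<subseteq> A (Suc n)" unfolding A_def by (intro Collect_mono) (meson add_left_mono order_trans)
  qed
  then have lim: "(\<lambda>n. prob (A n)) \<longlonglongrightarrow> prob (\<Union>n. A n)"
    using A by (intro finite_Lim_measure_incseq) auto
  have "prob (A n) \<le> B" for n unfolding A_def by (rule le[OF in_T])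
  then have "prob (\<Union>n. A n) \<le> B" by (intro LIMSEQ_le_const2[OF lim]) auto
  moreover have "{\<omega> \<in> space M. Y \<omega> \<in> T} \<subseteq> (\<Union>n. A n)"
  proof
    fix \<omega> assume \<omega>: "\<omega> \<in> {\<omega> \<in> space M. Y \<omega> \<in> T}"
    then have "Inf T \<le> Y \<omega>" using bdd by (auto intro: cInf_lower)
    with \<omega> not have "0 < Y \<omega> - Inf T" by (cases "Y \<omega> = Inf T") auto
    then obtain n where "inverse (real (Suc n)) < Y \<omega> - Inf T" using reals_Archimedean by blast
    with \<omega> show "\<omega> \<in> (\<Union>n. A n)" by (auto simp: A_def intro!: exI[of _ n])
  qed
  then have "prob {\<omega> \<in> space M. Y \<omega> \<in> T} \<le> prob (\<Union>n. A n)"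
    using A by (intro finite_measure_mono) auto
  ultimately show ?thesis by simp
qed

text \<open>For \<theta> \<ge> 0 the exceedance set is upward closed. At each of its points the
  parameter that witnesses membership makes Chernoff's bound at most
  \<open>exp (- t * u)\<close>.\<close>

lemma conjugate_right_tail:
  assumes [measurable]: "random_variable borel S" and t: "t > 0" and u: "u > 0"
    and L: "\<And>\<theta>. 0 \<le> L \<theta>"
    and mgf: "\<And>\<theta>. (\<integral>\<^sup>+\<omega>. ennreal (exp (\<theta> * S \<omega>)) \<partial>M) = ennreal (exp (t * L \<theta>))"
  shows "prob {\<omega> \<in> space M. \<exists>\<theta>\<ge>0. S \<omega> / t * \<theta> - L \<theta> > u} \<le> exp (- t * u)"
proof -
  define T where "T = {a. \<exists>\<theta>\<ge>0. a * \<theta> - L \<theta> > u}"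
  have "prob {\<omega> \<in> space M. S \<omega> / t \<in> T} \<le> exp (- t * u)"
  proof (rule prob_upward_closed_le)
    fix a b assume "a \<in> T" "a \<le> b"
    then obtain \<theta> where \<theta>: "\<theta> \<ge> 0" "a * \<theta> - L \<theta> > u" by (auto simp: T_def)
    have "a * \<theta> \<le> b * \<theta>" using \<open>a \<le> b\<close> \<theta>(1) by (rule mult_right_mono)
    with \<theta> show "b \<in> T" unfolding T_def by (auto intro!: exI[of _ \<theta>])
  next
    show "bdd_below T"
    proof (rule bdd_belowI)
      fix a assume "a \<in> T"
      then obtain \<theta> where \<theta>: "\<theta> \<ge> 0" "a * \<theta> - L \<theta> > u" by (auto simp: T_def)
      show "0 \<le> a"
      proof (rule ccontr)
        assume "\<not> 0 \<le> a"
        then have "a * \<theta> \<le> 0" using \<theta>(1) by (simp add: mult_nonpos_nonneg)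
        with \<theta>(2) L[of \<theta>] u show False by simp
      qed
    qed
  next
    fix a assume "a \<in> T"
    then obtain \<theta> where \<theta>: "\<theta> \<ge> 0" "a * \<theta> - L \<theta> > u" by (auto simp: T_def)
    have "prob {\<omega> \<in> space M. a \<le> S \<omega> / t} = prob {\<omega> \<in> space M. a * t \<le> S \<omega>}"
      using t by (simp add: pos_le_divide_eq)
    also have "\<dots> \<le> exp (- \<theta> * (a * t)) * exp (t * L \<theta>)"
      using \<theta>(1) mgf by (intro chernoff_upper) auto
    also have "\<dots> = exp (- (t * (a * \<theta> - L \<theta>)))" by (simp add: exp_add[symmetric] algebra_simps)
    also have "\<dots> \<le> exp (- t * u)" using \<theta>(2) t by simp
    finally show "prob {\<omega> \<in> space M. a \<le> S \<omega> / t} \<le> exp (- t * u)" .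
  qed auto
  then show ?thesis by (simp add: T_def)
qed

lemma conjugate_tail:
  assumes S: "random_variable borel S" and t: "t > 0" and u: "u > 0"
    and L: "\<And>\<theta>. 0 \<le> L \<theta>"
    and mgf: "\<And>\<theta>. (\<integral>\<^sup>+\<omega>. ennreal (exp (\<theta> * S \<omega>)) \<partial>M) = ennreal (exp (t * L \<theta>))"
  shows "prob {\<omega> \<in> space M. \<exists>\<theta>. S \<omega> / t * \<theta> - L \<theta> > u} \<le> 2 * exp (- t * u)"
proof -
  note [measurable] = S
  let ?A = "{\<omega> \<in> space M. \<exists>\<theta>\<ge>0. S \<omega> / t * \<theta> - L \<theta> > u}"
  let ?B = "{\<omega> \<in> space M. \<exists>\<theta>\<ge>0. - S \<omega> / t * \<theta> - L (- \<theta>) > u}"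
  have A: "prob ?A \<le> exp (- t * u)" by (rule conjugate_right_tail[OF S t u L mgf])
  have B: "prob ?B \<le> exp (- t * u)"
  proof (rule conjugate_right_tail[where L = "\<lambda>\<theta>. L (- \<theta>)"])
    show "(\<integral>\<^sup>+\<omega>. ennreal (exp (\<theta> * - S \<omega>)) \<partial>M) = ennreal (exp (t * L (- \<theta>)))" for \<theta>
      using mgf[of "- \<theta>"] by simp
  qed (use t u L in auto)
  have op: "open {a. \<exists>\<theta>\<ge>0. a * \<theta> - L' \<theta> > u}" for L'
    using open_exceeding[where P = "\<lambda>\<theta>. \<theta> \<ge> 0" and L = L' and u = u] .
  have mA: "?A \<in> events"
  proof -
    have "?A = (\<lambda>\<omega>. S \<omega> / t) -` {a. \<exists>\<theta>\<ge>0. a * \<theta> - L \<theta> > u} \<inter> space M" by auto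
    also have "\<dots> \<in> events" using op by (intro measurable_sets[where A = borel]) auto
    finally show ?thesis .
  qed
  have mB: "?B \<in> events"
  proof -
    have "?B = (\<lambda>\<omega>. - S \<omega> / t) -` {a. \<exists>\<theta>\<ge>0. a * \<theta> - L (- \<theta>) > u} \<inter> space M" by auto
    also have "\<dots> \<in> events" using op[of "\<lambda>\<theta>. L (- \<theta>)"] by (intro measurable_sets[where A = borel]) auto
    finally show ?thesis .
  qed
  have "{\<omega> \<in> space M. \<exists>\<theta>. S \<omega> / t * \<theta> - L \<theta> > u} \<subseteq> ?A \<union> ?B"
  proof
    fix \<omega> assume "\<omega> \<in> {\<omega> \<in> space M. \<exists>\<theta>. S \<omega> / t * \<theta> - L \<theta> > u}"
    then obtain \<theta> where \<theta>: "\<omega> \<in> space M" "S \<omega> / t * \<theta> - L \<theta> > u" by blast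
    show "\<omega> \<in> ?A \<union> ?B"
    proof (cases "\<theta> \<ge> 0")
      case True then show ?thesis using \<theta> by blast
    next
      case False
      then have "0 \<le> - \<theta> \<and> - S \<omega> / t * (- \<theta>) - L (- (- \<theta>)) > u" using \<theta> by simp
      then show ?thesis using \<theta>(1) by blast
    qed
  qed
  then have "prob {\<omega> \<in> space M. \<exists>\<theta>. S \<omega> / t * \<theta> - L \<theta> > u} \<le> prob (?A \<union> ?B)"
    using mA mB by (intro finite_measure_mono) auto
  also have "\<dots> \<le> prob ?A + prob ?B" using mA mB by (rule measure_Un_le)
  finally show ?thesis using A B by simp
qed

end

text \<open>A step function above \<open>exp (\<lambda> t L\<^sup>*)\<close>, whose exponential moments follow from the tail bound alone.\<close>

definition exp_conjugate_major :: "(real \<Rightarrow> real) \<Rightarrow> real \<Rightarrow> real \<Rightarrow> real \<Rightarrow> ennreal" where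
  "exp_conjugate_major L r t a = ennreal (exp r) +
     (\<Sum>n. ennreal (exp (r * (real n + 2))) * indicator {a. \<exists>\<theta>. a * \<theta> - L \<theta> > (real n + 1) / t} a)"

lemma exp_conjugate_major_measurable[measurable]: "exp_conjugate_major L r t \<in> borel_measurable borel"
proof -
  have [measurable]: "{a. \<exists>\<theta>. a * \<theta> - L \<theta> > u} \<in> sets borel" for u
    using open_exceeding[where P = "\<lambda>_. True" and L = L and u = u] by simp
  show ?thesis unfolding exp_conjugate_major_def by measurable
qed

text \<open>Outside the domain the premise on \<open>y\<close> is empty, so the majorant dominates
  every exponential there: this is how infinite rates are handled.\<close>

lemma exp_le_exp_conjugate_major:
  assumes t: "t > 0" and r: "r \<ge> 0" and y: "a \<in> conjugate_dom L \<Longrightarrow> y \<le> t * conjugate L a"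
  shows "ennreal (exp (r * y)) \<le> exp_conjugate_major L r t a"
proof (cases "y \<le> 1")
  case True
  then have "r * y \<le> r * 1" using r by (intro mult_left_mono)
  then have "ennreal (exp (r * y)) \<le> ennreal (exp r)" by (intro ennreal_leI) simp
  also have "\<dots> \<le> exp_conjugate_major L r t a" unfolding exp_conjugate_major_def by (rule le_iff_add[THEN iffD2]) blast
  finally show ?thesis .
next
  case False
  \<comment> \<open>The integer with \<open>n + 1 < y \<le> n + 2\<close>: level
    \<open>n + 1\<close> is exceeded, and the weight of that level dominates
    \<open>exp (r * y)\<close>.\<close>
  define n where "n = nat (\<lceil>y\<rceil> - 2)"
  have n: "real n + 1 < y" "y \<le> real n + 2" using False unfolding n_def by linarith+
  have "\<exists>\<theta>. a * \<theta> - L \<theta> > (real n + 1) / t"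
  proof (rule ccontr)
    assume "\<not> ?thesis"
    then have le: "a * \<theta> - L \<theta> \<le> (real n + 1) / t" for \<theta> by (simp add: not_less)
    then have "a \<in> conjugate_dom L" by (rule conjugate_domI)
    then have "y \<le> t * conjugate L a" by (rule y)
    also have "\<dots> \<le> t * ((real n + 1) / t)" using conjugate_least[OF le] t by (intro mult_left_mono) auto
    also have "\<dots> = real n + 1" using t by simp
    finally show False using n(1) by simp
  qed
  then have ind: "indicator {a. \<exists>\<theta>. a * \<theta> - L \<theta> > (real n + 1) / t} a = (1 :: ennreal)" by (simp add: indicator_def)
  define f where "f n = ennreal (exp (r * (real n + 2))) * indicator {a. \<exists>\<theta>. a * \<theta> - L \<theta> > (real n + 1) / t} a" for n :: nat
  have "ennreal (exp (r * y)) \<le> ennreal (exp (r * (real n + 2)))"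
    using n(2) r by (intro ennreal_leI) (simp add: mult_left_mono)
  also have "\<dots> = f n" using ind by (simp add: f_def)
  also have "\<dots> = (\<Sum>k\<in>{n}. f k)" by simp
  also have "\<dots> \<le> (\<Sum>n. f n)" by (intro sum_le_suminf) auto
  also have "\<dots> \<le> exp_conjugate_major L r t a"
    unfolding exp_conjugate_major_def f_def by (rule add_increasing) auto
  finally show ?thesis .
qed

text \<open>The constant term plus the sum of
  \<open>exp (r * (n + 2)) * 2 * exp (- (n + 1))\<close>, a geometric series of ratio
  \<open>exp (r - 1)\<close>. It does not depend on the length \<open>t\<close>.\<close>

definition exp_conjugate_bound :: "real \<Rightarrow> real" where
  "exp_conjugate_bound r = exp r + 2 * exp (2 * r - 1) / (1 - exp (r - 1))"

lemma exp_conjugate_bound_ge: "r < 1 \<Longrightarrow> 0 \<le> exp_conjugate_bound r"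
  by (auto simp: exp_conjugate_bound_def intro!: add_nonneg_nonneg divide_nonneg_nonneg)

lemma (in prob_space) nn_integral_exp_conjugate_major_le:
  assumes S[measurable]: "random_variable borel S" and t: "t > 0" and r: "0 \<le> r" "r < 1"
    and L: "\<And>\<theta>. 0 \<le> L \<theta>"
    and mgf: "\<And>\<theta>. (\<integral>\<^sup>+\<omega>. ennreal (exp (\<theta> * S \<omega>)) \<partial>M) = ennreal (exp (t * L \<theta>))"
  shows "(\<integral>\<^sup>+\<omega>. exp_conjugate_major L r t (S \<omega> / t) \<partial>M) \<le> ennreal (exp_conjugate_bound r)"
proof -
  have [measurable]: "{a. \<exists>\<theta>. a * \<theta> - L \<theta> > u} \<in> sets borel" for u
    using open_exceeding[where P = "\<lambda>_. True" and L = L and u = u] by simp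
  let ?E = "\<lambda>n. {\<omega> \<in> space M. \<exists>\<theta>. S \<omega> / t * \<theta> - L \<theta> > (real n + 1) / t}"
  have E: "?E n \<in> events" for n
  proof -
    have "?E n = (\<lambda>\<omega>. S \<omega> / t) -` {a. \<exists>\<theta>. a * \<theta> - L \<theta> > (real n + 1) / t} \<inter> space M" by auto
    also have "\<dots> \<in> events" by (intro measurable_sets[where A = borel]) auto
    finally show ?thesis .
  qed
  define g where "g n = 2 * exp (2 * r - 1) * exp (r - 1) ^ n" for n :: nat
  have tail_term: "(\<integral>\<^sup>+\<omega>. ennreal (exp (r * (real n + 2))) * indicator {a. \<exists>\<theta>. a * \<theta> - L \<theta> > (real n + 1) / t} (S \<omega> / t) \<partial>M) \<le> ennreal (g n)" for n
  proof -
    have "(\<integral>\<^sup>+\<omega>. ennreal (exp (r * (real n + 2))) * indicator {a. \<exists>\<theta>. a * \<theta> - L \<theta> > (real n + 1) / t} (S \<omega> / t) \<partial>M)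
      = (\<integral>\<^sup>+\<omega>. ennreal (exp (r * (real n + 2))) * indicator (?E n) \<omega> \<partial>M)"
      by (intro nn_integral_cong) (auto simp: indicator_def)
    also have "\<dots> = ennreal (exp (r * (real n + 2))) * ennreal (prob (?E n))"
      using E by (simp add: nn_integral_cmult_indicator emeasure_eq_measure)
    also have "\<dots> = ennreal (exp (r * (real n + 2)) * prob (?E n))" by (simp add: ennreal_mult)
    also have "\<dots> \<le> ennreal (exp (r * (real n + 2)) * (2 * exp (- t * ((real n + 1) / t))))"
      using t by (intro ennreal_leI mult_left_mono conjugate_tail[OF S t _ L mgf]) auto
    also have "- t * ((real n + 1) / t) = - (real n + 1)" using t by simp
    also have "exp (r * (real n + 2)) * (2 * exp (- (real n + 1))) = g n"
      by (simp add: g_def exp_of_nat_mult[symmetric] exp_add[symmetric] algebra_simps)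
    finally show ?thesis .
  qed
  have sm: "summable g" unfolding g_def using r by (intro summable_mult summable_geometric) simp
  have "(\<integral>\<^sup>+\<omega>. exp_conjugate_major L r t (S \<omega> / t) \<partial>M) = ennreal (exp r) +
     (\<integral>\<^sup>+\<omega>. (\<Sum>n. ennreal (exp (r * (real n + 2))) * indicator {a. \<exists>\<theta>. a * \<theta> - L \<theta> > (real n + 1) / t} (S \<omega> / t)) \<partial>M)"
    unfolding exp_conjugate_major_def by (subst nn_integral_add) (auto simp: emeasure_space_1)
  also have "(\<integral>\<^sup>+\<omega>. (\<Sum>n. ennreal (exp (r * (real n + 2))) * indicator {a. \<exists>\<theta>. a * \<theta> - L \<theta> > (real n + 1) / t} (S \<omega> / t)) \<partial>M)
     = (\<Sum>n. \<integral>\<^sup>+\<omega>. ennreal (exp (r * (real n + 2))) * indicator {a. \<exists>\<theta>. a * \<theta> - L \<theta> > (real n + 1) / t} (S \<omega> / t) \<partial>M)"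
    by (rule nn_integral_suminf) measurable
  also have "\<dots> \<le> (\<Sum>n. ennreal (g n))" by (intro suminf_le tail_term) auto
  also have "\<dots> = ennreal (suminf g)" by (rule suminf_ennreal2[OF _ sm]) (simp add: g_def)
  also have "suminf g = 2 * exp (2 * r - 1) / (1 - exp (r - 1))"
    unfolding g_def using r by (subst suminf_mult) (auto simp: suminf_geometric summable_geometric)
  finally show ?thesis using r
    by (simp add: exp_conjugate_bound_def ennreal_plus[symmetric] del: ennreal_plus)
qed

context exp_moment_increments
begin

definition slope :: "nat \<Rightarrow> nat \<Rightarrow> nat \<Rightarrow> 'a \<Rightarrow> real" where
  "slope m k i \<omega> = (W (real (Suc i) * (real k / m)) \<omega> - W (real i * (real k / m)) \<omega>) / (real k / m)"

lemma indep_increments_grid: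
  "indep_vars (\<lambda>_. borel) (\<lambda>l \<omega>. W (real (Suc (i + l)) * (real k / real m)) \<omega> - W (real (i + l) * (real k / real m)) \<omega>) {..<n}"
proof -
  have "indep_vars (\<lambda>_. borel) (\<lambda>l \<omega>. W (real (i + Suc l) * (real k / real m)) \<omega> - W (real (i + l) * (real k / real m)) \<omega>) {..<n}"
  proof (rule indep[of "\<lambda>l. real (i + l) * (real k / real m)" n])
    fix l show "real (i + l) * (real k / real m) \<le> real (i + Suc l) * (real k / real m)"
      by (rule mult_right_mono) auto
  qed simp
  then show ?thesis by (simp only: add_Suc_right)
qed

lemma slope_mgf:
  assumes "m > 0"
  shows "(\<integral>\<^sup>+\<omega>. ennreal (exp (\<theta> * (W (real (Suc i) * (real k / real m)) \<omega> - W (real i * (real k / real m)) \<omega>))) \<partial>M)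
     = ennreal (exp (real k / real m * L \<theta>))"
proof -
  have eq: "real (Suc i) * (real k / real m) = real i * (real k / real m) + real k / real m"
    by (simp add: distrib_right add_divide_distrib)
  show ?thesis unfolding eq using assms by (intro mgf) auto
qed

lemma rv_grid[measurable]: "random_variable borel (W (real i * (real k / real m)))"
  by (intro rv) simp

lemma slope_measurable[measurable]: "random_variable borel (slope m k i)"
  unfolding slope_def by measurable

lemma indep_slopes: "indep_vars (\<lambda>_. borel) (\<lambda>l. slope m k (i + l)) {..<n}"
  unfolding slope_def by (rule indep_vars_compose2[OF indep_increments_grid]) auto

text \<open>The Markov event for the product of the majorants of \<open>m\<close> consecutive slopes
  at threshold \<open>exp (r * b)\<close>. Stated with the majorants it is measurable and also
  catches infinite conjugates.\<close>

definition bad_window :: "real \<Rightarrow> real \<Rightarrow> nat \<Rightarrow> nat \<Rightarrow> nat \<Rightarrow> 'a set" where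
  "bad_window r b m k i = {\<omega> \<in> space M. 1 \<le> ennreal (exp (- r * b)) *
      (\<Prod>l<m. exp_conjugate_major L r (real k / m) (slope m k (i + l) \<omega>))}"

lemma bad_window_event[measurable]: "bad_window r b m k i \<in> events"
proof -
  have "(\<lambda>\<omega>. \<Prod>l<m. exp_conjugate_major L r (real k / m) (slope m k (i + l) \<omega>)) \<in> borel_measurable M"
    by (intro borel_measurable_prod_ennreal) measurable
  then show ?thesis unfolding bad_window_def by measurable
qed

lemma prob_bad_window_le:
  assumes m: "m > 0" and k: "k > 0" and r: "0 \<le> r" "r < 1"
  shows "prob (bad_window r b m k i) \<le> exp (- r * b) * exp_conjugate_bound r ^ m"
  unfolding bad_window_def
proof (rule prob_ge_1_le)
  let ?G = "\<lambda>l \<omega>. exp_conjugate_major L r (real k / m) (slope m k (i + l) \<omega>)"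
  have meas: "(\<lambda>\<omega>. \<Prod>l<m. ?G l \<omega>) \<in> borel_measurable M"
    by (intro borel_measurable_prod_ennreal) measurable
  then show "(\<lambda>\<omega>. ennreal (exp (- r * b)) * (\<Prod>l<m. ?G l \<omega>)) \<in> borel_measurable M" by measurable
  have "indep_vars (\<lambda>_. borel) ?G {..<m}"
    by (rule indep_vars_compose2[OF indep_slopes]) auto
  then have "(\<integral>\<^sup>+\<omega>. (\<Prod>l<m. ?G l \<omega>) \<partial>M) = (\<Prod>l<m. \<integral>\<^sup>+\<omega>. ?G l \<omega> \<partial>M)"
    by (intro indep_vars_nn_integral) auto
  also have "\<dots> \<le> (\<Prod>l<m. ennreal (exp_conjugate_bound r))"
  proof (rule prod_le_ennreal)
    fix l
    show "(\<integral>\<^sup>+\<omega>. ?G l \<omega> \<partial>M) \<le> ennreal (exp_conjugate_bound r)"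
      unfolding slope_def
    proof (rule nn_integral_exp_conjugate_major_le[OF _ _ r L_nonneg slope_mgf[OF m]])
      show "random_variable borel (\<lambda>\<omega>. W (real (Suc (i + l)) * (real k / real m)) \<omega> - W (real (i + l) * (real k / real m)) \<omega>)"
        by (intro borel_measurable_diff rv_grid)
    qed (use m k in simp)
  qed
  also have "\<dots> = ennreal (exp_conjugate_bound r ^ m)"
    using exp_conjugate_bound_ge[OF r(2)] by (simp add: ennreal_power)
  finally show "(\<integral>\<^sup>+\<omega>. ennreal (exp (- r * b)) * (\<Prod>l<m. ?G l \<omega>) \<partial>M) \<le> ennreal (exp (- r * b) * exp_conjugate_bound r ^ m)"
    using exp_conjugate_bound_ge[OF r(2)] by (simp add: nn_integral_cmult[OF meas] ennreal_mult mult_left_mono)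
qed (use exp_conjugate_bound_ge[OF r(2)] in simp)

lemma not_bad_window:
  assumes m: "m > 0" and k: "k > 0" and r: "0 < r" and b: "b \<ge> 0"
    and \<omega>: "\<omega> \<in> space M" "\<omega> \<notin> bad_window r b m k i"
  shows "\<forall>l<m. slope m k (i + l) \<omega> \<in> conjugate_dom L"
    and "(\<Sum>l<m. conjugate L (slope m k (i + l) \<omega>)) \<le> m * (b / k)"
proof -
  let ?s = "\<lambda>l. slope m k (i + l) \<omega>"
  have t: "real k / m > 0" using m k by simp
  \<comment> \<open>Any numbers \<open>y l\<close> below the scaled conjugates with total at least
    \<open>b\<close> put the window into the bad event. A slope outside the domain could take the
    whole of \<open>b\<close> alone; otherwise the scaled conjugates themselves serve.\<close>
  have contr: False if y: "\<And>l. l < m \<Longrightarrow> ?s l \<in> conjugate_dom L \<Longrightarrow> y l \<le> real k / m * conjugate L (?s l)"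
    and sum: "b \<le> (\<Sum>l<m. y l)" for y
  proof -
    have "1 \<le> exp (- r * b) * exp (\<Sum>l<m. r * y l)"
      using sum r by (simp add: exp_add[symmetric] sum_distrib_left[symmetric])
    then have "1 \<le> ennreal (exp (- r * b) * exp (\<Sum>l<m. r * y l))" by simp
    also have "\<dots> = ennreal (exp (- r * b)) * (\<Prod>l<m. ennreal (exp (r * y l)))"
      by (simp add: ennreal_mult exp_sum prod_ennreal prod_nonneg)
    also have "\<dots> \<le> ennreal (exp (- r * b)) * (\<Prod>l<m. exp_conjugate_major L r (real k / m) (?s l))"
      using y t r by (intro mult_left_mono prod_le_ennreal exp_le_exp_conjugate_major) auto
    finally show False using \<omega> by (simp add: bad_window_def)
  qed
  show dom: "\<forall>l<m. ?s l \<in> conjugate_dom L"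
  proof (rule ccontr)
    assume "\<not> ?thesis"
    then obtain l0 where l0: "l0 < m" "?s l0 \<notin> conjugate_dom L" by blast
    show False
    proof (rule contr[of "\<lambda>l. if l = l0 then b else 0"])
      fix l assume "l < m" "?s l \<in> conjugate_dom L"
      then show "(if l = l0 then b else 0) \<le> real k / m * conjugate L (?s l)"
        using l0 t conjugate_nonneg[of "?s l" L, OF _ L_0] by auto
    qed (use l0 in simp)
  qed
  show "(\<Sum>l<m. conjugate L (?s l)) \<le> m * (b / k)"
  proof (rule ccontr)
    assume "\<not> ?thesis"
    then have "real k / m * (m * (b / k)) \<le> real k / m * (\<Sum>l<m. conjugate L (?s l))"
      using t by (intro mult_left_mono) auto
    then have "b \<le> (\<Sum>l<m. real k / m * conjugate L (?s l))"
      using m k by (simp add: sum_distrib_left)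
    then show False by (intro contr[of "\<lambda>l. real k / m * conjugate L (?s l)"]) auto
  qed
qed

lemma conjugate_sum_eventually:
  assumes c: "c > 0" and m: "m > 0" and \<beta>: "\<beta> > 1 / c"
  shows "AE \<omega> in M. \<forall>\<^sub>F k in sequentially. \<forall>i\<in>grid_indices m c k.
     (\<forall>l<m. slope m k (i + l) \<omega> \<in> conjugate_dom L) \<and>
     (\<Sum>l<m. conjugate L (slope m k (i + l) \<omega>)) \<le> m * \<beta>"
proof -
  have "\<beta> > 0" using c \<beta> by (meson divide_pos_pos less_trans zero_less_one)
  \<comment> \<open>The midpoint between \<open>1 / (c * \<beta>)\<close> and 1: below 1 the
    exponential moments are finite, and \<open>r * \<beta> > 1 / c\<close> outweighs the number of
    grid indices.\<close>
  define r where "r = (1 / (c * \<beta>) + 1) / 2"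
  have "1 < c * \<beta>" using \<beta> c by (simp add: field_simps)
  then have r: "0 < r" "r < 1" "1 / c < r * \<beta>" using c \<open>\<beta> > 0\<close> by (auto simp: r_def field_simps)
  define A where "A k = (\<Union>i\<in>grid_indices m c k. bad_window r (real k * \<beta>) m k i)" for k
  define C where "C = (m * exp (1 / c) + 1) * exp_conjugate_bound r ^ m"
  have "prob (A k) \<le> C * exp (1 / c - r * \<beta>) ^ k" if "k > 0" for k
  proof -
    have "prob (A k) \<le> (\<Sum>i\<in>grid_indices m c k. prob (bad_window r (real k * \<beta>) m k i))"
      unfolding A_def using finite_grid_indices by (intro finite_measure_subadditive_finite) auto
    also have "\<dots> \<le> (\<Sum>i\<in>grid_indices m c k. exp (- r * (real k * \<beta>)) * exp_conjugate_bound r ^ m)"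
      using m that r by (intro sum_mono prob_bad_window_le) auto
    also have "\<dots> = card (grid_indices m c k) * (exp (- r * (real k * \<beta>)) * exp_conjugate_bound r ^ m)" by simp
    also have "\<dots> \<le> ((m * exp (1 / c) + 1) * exp (real k / c)) * (exp (- r * (real k * \<beta>)) * exp_conjugate_bound r ^ m)"
      using card_grid_indices[OF c] exp_conjugate_bound_ge[OF r(2)] by (intro mult_right_mono) auto
    also have "\<dots> = C * (exp (real k / c) * exp (- r * (real k * \<beta>)))" by (simp add: C_def)
    also have "exp (real k / c) * exp (- r * (real k * \<beta>)) = exp (1 / c - r * \<beta>) ^ k"
      by (simp add: exp_add[symmetric] exp_of_nat_mult[symmetric] algebra_simps)
    finally show ?thesis .
  qed
  then have "\<forall>\<^sub>F k in sequentially. prob (A k) \<le> C * exp (1 / c - r * \<beta>) ^ k"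
    by (intro eventually_mono[OF eventually_gt_at_top[of 0]])
  moreover have "summable (\<lambda>k. C * exp (1 / c - r * \<beta>) ^ k)"
    using r by (intro summable_mult summable_geometric) simp
  moreover have "A k \<in> events" for k unfolding A_def using finite_grid_indices by auto
  ultimately have "AE \<omega> in M. \<forall>\<^sub>F k in sequentially. \<omega> \<notin> A k"
    by (intro AE_eventually_not_in)
  then show ?thesis using AE_space
  proof eventually_elim
    case (elim \<omega>)
    from elim(1) eventually_gt_at_top[of 0] show ?case
    proof eventually_elim
      case (elim k)
      show ?case
      proof
        fix i assume "i \<in> grid_indices m c k"
        then have "\<omega> \<notin> bad_window r (real k * \<beta>) m k i" using elim by (auto simp: A_def)
        from not_bad_window[OF m elim(2) r(1) _ \<open>\<omega> \<in> space M\<close> this] \<open>\<beta> > 0\<close> elim(2)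
        show "(\<forall>l<m. slope m k (i + l) \<omega> \<in> conjugate_dom L) \<and>
          (\<Sum>l<m. conjugate L (slope m k (i + l) \<omega>)) \<le> m * \<beta>" by simp
      qed
    qed
  qed
qed

end

section \<open>Lower bound of Cramer's theorem\<close>

text \<open>Comparison of power series: an even power \<open>n \<ge> 2\<close> carries
  \<open>r ^ n \<le> r\<^sup>2\<close>, and the constants cancel. It gives a quadratic estimate of
  second differences under the expectation without differentiating there.\<close>

lemma cosh_scale_le:
  fixes y r :: real
  assumes r: "0 \<le> r" "r \<le> 1"
  shows "exp (r * y) + exp (- (r * y)) - 2 \<le> r\<^sup>2 * (exp y + exp (- y) - 2)"
proof -
  have 1: "(\<lambda>n. r\<^sup>2 * (if even n then y ^ n /\<^sub>R fact n else 0) - (if even n then (r * y) ^ n /\<^sub>R fact n else 0))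
      sums (r\<^sup>2 * cosh y - cosh (r * y))"
    by (intro sums_diff sums_mult cosh_converges)
  have 2: "(\<lambda>n. if n = 0 then r\<^sup>2 - 1 else 0) sums (r\<^sup>2 - 1)" by (rule sums_single)
  have "r\<^sup>2 - 1 \<le> r\<^sup>2 * cosh y - cosh (r * y)"
  proof (rule sums_le[OF _ 2 1])
    fix n
    show "(if n = 0 then r\<^sup>2 - 1 else 0) \<le> r\<^sup>2 * (if even n then y ^ n /\<^sub>R fact n else 0) - (if even n then (r * y) ^ n /\<^sub>R fact n else 0)"
    proof (cases "even n \<and> n \<noteq> 0")
      case True
      then have "n \<ge> 2" by presburger
      then have "r ^ n \<le> r\<^sup>2" using r by (intro power_decreasing) auto
      moreover have "0 \<le> y ^ n" using True by (simp add: zero_le_even_power)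
      ultimately have "r ^ n * y ^ n \<le> r\<^sup>2 * y ^ n" by (intro mult_right_mono)
      then have "(r * y) ^ n / fact n \<le> r\<^sup>2 * y ^ n / fact n" by (intro divide_right_mono) (auto simp: power_mult_distrib)
      then show ?thesis using True by (simp add: divide_inverse mult.commute mult.left_commute)
    qed auto
  qed
  then show ?thesis by (simp add: cosh_field_def field_simps)
qed

context exp_moment_increments
begin

definition X1 :: "'a \<Rightarrow> real" where "X1 \<omega> = W 1 \<omega> - W 0 \<omega>"

lemma X1_measurable[measurable]: "random_variable borel X1"
proof -
  have [measurable]: "random_variable borel (W 1)" "random_variable borel (W 0)" by (auto intro: rv)
  show ?thesis unfolding X1_def by measurable
qed

lemma exp_X1: "integrable M (\<lambda>\<omega>. exp (\<theta> * X1 \<omega>))" "expectation (\<lambda>\<omega>. exp (\<theta> * X1 \<omega>)) = exp (L \<theta>)"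
proof -
  have nn: "(\<integral>\<^sup>+\<omega>. ennreal (exp (\<theta> * X1 \<omega>)) \<partial>M) = ennreal (exp (L \<theta>))"
    using mgf[of 0 1 \<theta> 1] by (simp add: X1_def)
  show "integrable M (\<lambda>\<omega>. exp (\<theta> * X1 \<omega>))" using nn by (intro integrableI_nonneg) auto
  show "expectation (\<lambda>\<omega>. exp (\<theta> * X1 \<omega>)) = exp (L \<theta>)"
    using nn by (subst integral_eq_nn_integral) auto
qed

text \<open>The function \<open>exp (L \<theta>)\<close> is an expectation of convex functions of
  \<theta>, hence convex and finite on the line, hence continuous.\<close>

lemma L_continuous: "continuous_on UNIV L"
proof -
  have "convex_on UNIV (\<lambda>\<theta>. exp (L \<theta>))"
  proof (rule convex_onI)
    fix t x y :: real assume t: "0 < t" "t < 1"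
    have "exp (((1 - t) * x + t * y) * X1 \<omega>) \<le> (1 - t) * exp (x * X1 \<omega>) + t * exp (y * X1 \<omega>)" for \<omega>
    proof -
      have "convex_on UNIV (exp :: real \<Rightarrow> real)" by (rule exp_convex)
      from convex_onD[OF this, of t "x * X1 \<omega>" "y * X1 \<omega>"] t show ?thesis by (simp add: algebra_simps)
    qed
    then have "expectation (\<lambda>\<omega>. exp (((1 - t) * x + t * y) * X1 \<omega>)) \<le> expectation (\<lambda>\<omega>. (1 - t) * exp (x * X1 \<omega>) + t * exp (y * X1 \<omega>))"
      by (intro integral_mono) (auto intro!: exp_X1 integrable_add integrable_mult_right)
    also have "\<dots> = (1 - t) * exp (L x) + t * exp (L y)" using exp_X1 by simp
    finally show "exp (L ((1 - t) *\<^sub>R x + t *\<^sub>R y)) \<le> (1 - t) * exp (L x) + t * exp (L y)"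
      by (simp add: exp_X1(2))
  qed simp
  then have "continuous_on UNIV (\<lambda>\<theta>. exp (L \<theta>))" by (rule convex_on_continuous[OF open_UNIV])
  then have "continuous_on UNIV (\<lambda>\<theta>. ln (exp (L \<theta>)))" by (intro continuous_on_ln) auto
  then show ?thesis by simp
qed

lemma exp_tilt: "integrable M (\<lambda>\<omega>. exp (\<theta> * (X1 \<omega> - a)))"
  "expectation (\<lambda>\<omega>. exp (\<theta> * (X1 \<omega> - a))) = exp (L \<theta> - a * \<theta>)"
proof -
  have eq: "exp (\<theta> * (X1 \<omega> - a)) = exp (\<theta> * X1 \<omega>) * exp (- a * \<theta>)" for \<omega>
    by (simp add: exp_add[symmetric] algebra_simps)
  show "integrable M (\<lambda>\<omega>. exp (\<theta> * (X1 \<omega> - a)))" unfolding eq by (intro integrable_mult_left exp_X1)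
  show "expectation (\<lambda>\<omega>. exp (\<theta> * (X1 \<omega> - a))) = exp (L \<theta> - a * \<theta>)"
  proof -
    have "expectation (\<lambda>\<omega>. exp (\<theta> * X1 \<omega>) * exp (- a * \<theta>)) = exp (L \<theta>) * exp (- a * \<theta>)"
      using exp_X1 by simp
    then show ?thesis unfolding eq by (simp add: exp_add[symmetric])
  qed
qed

text \<open>A second-order bound at a minimiser; it replaces differentiability of \<open>L\<close>.\<close>

lemma L_flat_at_minimiser:
  assumes min: "\<And>\<eta>. L \<theta> - a * \<theta> \<le> L \<eta> - a * \<eta>" and \<epsilon>: "\<epsilon> > 0"
  obtains r where "r > 0" "L (\<theta> + r) - a * (\<theta> + r) \<le> L \<theta> - a * \<theta> + r * \<epsilon>"
    "L (\<theta> - r) - a * (\<theta> - r) \<le> L \<theta> - a * \<theta> + r * \<epsilon>"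
proof -
  \<comment> \<open>The moment generating function of \<open>X1 - a\<close>, minimal at \<theta>.
    Both one-sided differences there are nonnegative, so a bound on the second difference bounds
    each of them.\<close>
  define N where "N \<eta> = exp (L \<eta> - a * \<eta>)" for \<eta>
  define D where "D = N (\<theta> + 1) + N (\<theta> - 1) - 2 * N \<theta>"
  have Nmin: "N \<theta> \<le> N \<eta>" for \<eta> using min by (simp add: N_def)
  have N0: "N \<theta> > 0" by (simp add: N_def)
  have D: "D \<ge> 0" using Nmin[of "\<theta> + 1"] Nmin[of "\<theta> - 1"] by (simp add: D_def)
  have bound: "N (\<theta> + r) + N (\<theta> - r) - 2 * N \<theta> \<le> r\<^sup>2 * D" if r: "0 \<le> r" "r \<le> 1" for r
  proof -
    let ?e = "\<lambda>\<eta> \<omega>. exp (\<eta> * (X1 \<omega> - a))"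
    have "?e (\<theta> + r) \<omega> + ?e (\<theta> - r) \<omega> - 2 * ?e \<theta> \<omega> \<le> r\<^sup>2 * (?e (\<theta> + 1) \<omega> + ?e (\<theta> - 1) \<omega> - 2 * ?e \<theta> \<omega>)" for \<omega>
    proof -
      let ?y = "X1 \<omega> - a"
      have "?e \<theta> \<omega> * (exp (r * ?y) + exp (- (r * ?y)) - 2) \<le> ?e \<theta> \<omega> * (r\<^sup>2 * (exp ?y + exp (- ?y) - 2))"
        by (intro mult_left_mono cosh_scale_le r) simp
      moreover have "?e (\<theta> + s) \<omega> = ?e \<theta> \<omega> * exp (s * ?y)" "?e (\<theta> - s) \<omega> = ?e \<theta> \<omega> * exp (- (s * ?y))" for s
        by (simp_all add: exp_add[symmetric] algebra_simps)
      note this[of r] this[of 1]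
      ultimately show ?thesis by (simp add: algebra_simps)
    qed
    then have "expectation (\<lambda>\<omega>. ?e (\<theta> + r) \<omega> + ?e (\<theta> - r) \<omega> - 2 * ?e \<theta> \<omega>) \<le>
       expectation (\<lambda>\<omega>. r\<^sup>2 * (?e (\<theta> + 1) \<omega> + ?e (\<theta> - 1) \<omega> - 2 * ?e \<theta> \<omega>))"
      by (intro integral_mono)
         (auto intro!: exp_tilt Bochner_Integration.integrable_diff Bochner_Integration.integrable_add integrable_mult_right)
    then show ?thesis using exp_tilt[of _ a] by (simp add: N_def D_def)
  qed
  \<comment> \<open>Small enough for the quadratic term \<open>r\<^sup>2 * D\<close> to fall below
    the linear \<open>r * \<epsilon> * N \<theta>\<close>, and at most 1 for the comparison of
    second differences.\<close>
  define r where "r = min 1 (\<epsilon> * N \<theta> / (D + 1))"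
  have r: "r > 0" "r \<le> 1" using \<epsilon> N0 D by (auto simp: r_def)
  have "r * D \<le> \<epsilon> * N \<theta>"
  proof -
    have "r * D \<le> (\<epsilon> * N \<theta> / (D + 1)) * (D + 1)" using r D by (intro mult_mono) (auto simp: r_def)
    also have "\<dots> = \<epsilon> * N \<theta>" using D by simp
    finally show ?thesis .
  qed
  then have rD: "r\<^sup>2 * D \<le> r * \<epsilon> * N \<theta>"
    using mult_left_mono[of "r * D" "\<epsilon> * N \<theta>" r] r by (simp add: power2_eq_square mult.assoc)
  have ub: "L \<eta> - a * \<eta> \<le> L \<theta> - a * \<theta> + r * \<epsilon>" if "N \<eta> \<le> N \<theta> + r\<^sup>2 * D" for \<eta>
  proof -
    have "N \<eta> \<le> N \<theta> * (1 + r * \<epsilon>)" using that rD by (simp add: algebra_simps)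
    also have "\<dots> \<le> N \<theta> * exp (r * \<epsilon>)" using N0 by (intro mult_left_mono exp_ge_add_one_self) auto
    also have "\<dots> = exp (L \<theta> - a * \<theta> + r * \<epsilon>)" by (simp add: N_def exp_add)
    finally show ?thesis by (simp add: N_def)
  qed
  show thesis
    by (rule that[of r]) (use r bound[of r] Nmin[of "\<theta> + r"] Nmin[of "\<theta> - r"] in \<open>auto intro!: ub\<close>)
qed

text \<open>Contraction makes the objective coercive:
  \<open>L \<eta> \<ge> a0 * \<eta> - conjugate L a0\<close> leaves a surplus
  \<open>\<delta> * a0 * \<eta>\<close> in the direction of \<open>a0\<close>, and in the other
  direction the linear term already helps. At \<open>a0\<close> itself the infimum may fail to be
  attained.\<close>

lemma L_minimiser_exists:
  assumes a0: "a0 \<in> conjugate_dom L" and \<delta>: "0 < \<delta>" "\<delta> < 1"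
  obtains \<theta> where "\<And>\<eta>. L \<theta> - (1 - \<delta>) * a0 * \<theta> \<le> L \<eta> - (1 - \<delta>) * a0 * \<eta>"
proof (cases "a0 = 0")
  case True
  then show thesis using L_0 L_nonneg by (intro that[of 0]) simp
next
  case False
  define h where "h \<eta> = L \<eta> - (1 - \<delta>) * a0 * \<eta>" for \<eta>
  \<comment> \<open>At distance \<open>R\<close> the surplus
    \<open>\<delta> * \<bar>a0\<bar> * R\<close> equals the conjugate at \<open>a0\<close>, so
    outside \<open>[- R, R]\<close> the objective is at least its value at 0.\<close>
  define R where "R = conjugate L a0 / (\<delta> * \<bar>a0\<bar>)"
  have R: "R \<ge> 0" using conjugate_nonneg[OF a0 L_0] \<delta> by (simp add: R_def)
  have out: "h 0 \<le> h \<eta>" if "\<eta> \<notin> {-R..R}" for \<eta>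
  proof (cases "a0 * \<eta> \<le> 0")
    case True
    have "(1 - \<delta>) * (a0 * \<eta>) \<le> 0" by (rule mult_nonneg_nonpos[OF _ True]) (use \<delta> in simp)
    then show ?thesis using L_nonneg[of \<eta>] L_0 by (simp add: h_def mult.assoc)
  next
    case False
    then have "a0 * \<eta> = \<bar>a0\<bar> * \<bar>\<eta>\<bar>" by (simp add: abs_mult[symmetric])
    moreover have "\<bar>\<eta>\<bar> \<ge> R" using that by auto
    ultimately have "\<delta> * (a0 * \<eta>) \<ge> \<delta> * (\<bar>a0\<bar> * R)" using \<delta> by (simp add: mult_left_mono)
    moreover have "\<delta> * (\<bar>a0\<bar> * R) = conjugate L a0" using \<delta> \<open>a0 \<noteq> 0\<close> by (simp add: R_def)
    moreover have "a0 * \<eta> - L \<eta> \<le> conjugate L a0" by (rule conjugate_upper[OF a0])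
    ultimately show ?thesis using L_0 by (simp add: h_def algebra_simps)
  qed
  have "continuous_on {-R..R} h"
    unfolding h_def by (intro continuous_intros continuous_on_subset[OF L_continuous]) auto
  moreover have "compact {-R..R}" "{-R..R} \<noteq> {}" using R by auto
  ultimately obtain \<theta> where \<theta>: "\<theta> \<in> {-R..R}" "\<And>\<eta>. \<eta> \<in> {-R..R} \<Longrightarrow> h \<theta> \<le> h \<eta>"
    using continuous_attains_inf[of "{-R..R}" h] by blast
  have "h \<theta> \<le> h \<eta>" for \<eta>
  proof (cases "\<eta> \<in> {-R..R}")
    case False
    have "h \<theta> \<le> h 0" using R by (intro \<theta>(2)) auto
    with out[OF False] show ?thesis by simp
  qed (rule \<theta>(2))
  then show thesis by (intro that[of \<theta>]) (simp add: h_def)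
qed

text \<open>Exponential tilting without changing the measure. Of the tilted mass
  \<open>exp (t * h)\<close>, the parts where the slope is too large or too small each carry at most
  a quarter, by flatness at the minimiser. Half of the mass lies on the good event, where the tilt
  is at most \<open>exp (\<bar>\<theta>\<bar> * t * \<epsilon>')\<close>. The threshold does not
  depend on \<open>S\<close>.\<close>

lemma cramer_lower_bound:
  assumes a0: "a0 \<in> conjugate_dom L" and \<delta>: "0 < \<delta>" "\<delta> < 1" and \<epsilon>: "\<epsilon> > 0" and \<gamma>: "\<gamma> > 0"
  obtains t0 where "\<And>t S. t \<ge> t0 \<Longrightarrow> t > 0 \<Longrightarrow> random_variable borel S \<Longrightarrow>
     (\<And>\<theta>. (\<integral>\<^sup>+\<omega>. ennreal (exp (\<theta> * S \<omega>)) \<partial>M) = ennreal (exp (t * L \<theta>))) \<Longrightarrow>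
     exp (- t * (conjugate L ((1 - \<delta>) * a0) + \<gamma>)) \<le> prob {\<omega> \<in> space M. \<bar>S \<omega> / t - (1 - \<delta>) * a0\<bar> < \<epsilon>}"
proof -
  define a where "a = (1 - \<delta>) * a0"
  obtain \<theta> where min: "\<And>\<eta>. L \<theta> - a * \<theta> \<le> L \<eta> - a * \<eta>"
    using L_minimiser_exists[OF a0 \<delta>] unfolding a_def by blast
  have a: "a \<in> conjugate_dom L" unfolding a_def using \<delta> L_nonneg by (intro conjugate_scale a0) auto
  \<comment> \<open>Narrowed so that undoing the tilt on the good event costs at most \<gamma>/2 in
    the exponent.\<close>
  define \<epsilon>' where "\<epsilon>' = min \<epsilon> (\<gamma> / (2 * (\<bar>\<theta>\<bar> + 1)))"
  have e': "\<epsilon>' > 0" "\<epsilon>' \<le> \<epsilon>" using \<epsilon> \<gamma> by (auto simp: \<epsilon>'_def)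
  have e\<theta>: "\<bar>\<theta>\<bar> * \<epsilon>' \<le> \<gamma> / 2"
  proof -
    have "\<bar>\<theta>\<bar> * \<epsilon>' \<le> (\<bar>\<theta>\<bar> + 1) * (\<gamma> / (2 * (\<bar>\<theta>\<bar> + 1)))" using e' \<gamma> by (intro mult_mono) (auto simp: \<epsilon>'_def)
    also have "\<bar>\<theta>\<bar> + 1 > 0" by simp
    then have "(\<bar>\<theta>\<bar> + 1) * (\<gamma> / (2 * (\<bar>\<theta>\<bar> + 1))) = \<gamma> / 2" by (simp add: field_simps)
    finally show ?thesis .
  qed
  \<comment> \<open>Flatness with half of \<epsilon>': shifting the parameter by \<open>r\<close>
    gains \<open>r * \<epsilon>'\<close> on the bad parts and loses half of it, so they decay at
    rate \<open>r * \<epsilon>' / 2\<close>.\<close>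
  obtain r where r: "r > 0" "L (\<theta> + r) - a * (\<theta> + r) \<le> L \<theta> - a * \<theta> + r * (\<epsilon>' / 2)"
    "L (\<theta> - r) - a * (\<theta> - r) \<le> L \<theta> - a * \<theta> + r * (\<epsilon>' / 2)"
    using L_flat_at_minimiser[OF min, of "\<epsilon>' / 2"] e' by auto
  define h where "h = L \<theta> - a * \<theta>"
  have h: "- conjugate L a \<le> h" using conjugate_upper[OF a, of \<theta>] by (simp add: h_def)
  \<comment> \<open>The first term makes each bad part at most a quarter; the second lets the
    remaining \<gamma>/2 absorb the factor one half.\<close>
  define t0 where "t0 = max (ln 4 / (r * \<epsilon>' / 2)) (ln 2 / (\<gamma> / 2))"
  show thesis
  proof (rule that[of t0])
    fix t S assume t: "t \<ge> t0" "t > 0" and S[measurable]: "random_variable borel S"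
      and mgfS: "\<And>\<theta>. (\<integral>\<^sup>+\<omega>. ennreal (exp (\<theta> * S \<omega>)) \<partial>M) = ennreal (exp (t * L \<theta>))"
    define Y where "Y \<omega> = S \<omega> - t * a" for \<omega>
    have [measurable]: "random_variable borel Y" unfolding Y_def by measurable
    have Y: "integrable M (\<lambda>\<omega>. exp (\<eta> * Y \<omega>))" "expectation (\<lambda>\<omega>. exp (\<eta> * Y \<omega>)) = exp (t * (L \<eta> - a * \<eta>))" for \<eta>
    proof -
      have eq: "exp (\<eta> * Y \<omega>) = exp (\<eta> * S \<omega>) * exp (- t * a * \<eta>)" for \<omega>
        by (simp add: Y_def exp_add[symmetric] algebra_simps)
      have i: "integrable M (\<lambda>\<omega>. exp (\<eta> * S \<omega>))" using mgfS by (intro integrableI_nonneg) auto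
      have e: "expectation (\<lambda>\<omega>. exp (\<eta> * S \<omega>)) = exp (t * L \<eta>)"
        using mgfS by (subst integral_eq_nn_integral) auto
      show "integrable M (\<lambda>\<omega>. exp (\<eta> * Y \<omega>))" unfolding eq using i by simp
      show "expectation (\<lambda>\<omega>. exp (\<eta> * Y \<omega>)) = exp (t * (L \<eta> - a * \<eta>))"
      proof -
        have "expectation (\<lambda>\<omega>. exp (\<eta> * S \<omega>) * exp (- t * a * \<eta>)) = exp (t * L \<eta>) * exp (- t * a * \<eta>)"
          using i e by simp
        then show ?thesis unfolding eq by (simp add: exp_add[symmetric] algebra_simps)
      qed
    qed
    define G where "G = {\<omega> \<in> space M. \<bar>Y \<omega>\<bar> < t * \<epsilon>'}"
    have [measurable]: "G \<in> events" unfolding G_def by measurable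
    have pw: "exp (\<theta> * Y \<omega>) \<le> exp (\<bar>\<theta>\<bar> * (t * \<epsilon>')) * indicator G \<omega> +
       (exp (- r * (t * \<epsilon>')) * exp ((\<theta> + r) * Y \<omega>) + exp (- r * (t * \<epsilon>')) * exp ((\<theta> - r) * Y \<omega>))" if sp: "\<omega> \<in> space M" for \<omega>
    proof -
      have pos: "0 \<le> exp (- r * (t * \<epsilon>')) * exp ((\<theta> + r) * Y \<omega>)" "0 \<le> exp (- r * (t * \<epsilon>')) * exp ((\<theta> - r) * Y \<omega>)"
        "0 \<le> exp (\<bar>\<theta>\<bar> * (t * \<epsilon>')) * indicator G \<omega>" by auto
      consider "\<omega> \<in> G" | "t * \<epsilon>' \<le> Y \<omega>" | "Y \<omega> \<le> - (t * \<epsilon>')" using sp unfolding G_def by force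
      then show ?thesis
      proof cases
        case 1
        have "\<theta> * Y \<omega> \<le> \<bar>\<theta>\<bar> * \<bar>Y \<omega>\<bar>" by (simp add: abs_mult[symmetric])
        also have "\<dots> \<le> \<bar>\<theta>\<bar> * (t * \<epsilon>')" using 1 by (intro mult_left_mono) (auto simp: G_def)
        finally have "\<theta> * Y \<omega> \<le> \<bar>\<theta>\<bar> * (t * \<epsilon>')" .
        then have "exp (\<theta> * Y \<omega>) \<le> exp (\<bar>\<theta>\<bar> * (t * \<epsilon>')) * indicator G \<omega>" using 1 by simp
        with pos show ?thesis by linarith
      next
        case 2
        then have "r * (t * \<epsilon>') \<le> r * Y \<omega>" using r by (intro mult_left_mono) auto
        then have "exp (\<theta> * Y \<omega>) \<le> exp (- r * (t * \<epsilon>')) * exp ((\<theta> + r) * Y \<omega>)"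
          unfolding exp_add[symmetric] by (simp add: algebra_simps)
        with pos show ?thesis by linarith
      next
        case 3
        then have "r * Y \<omega> \<le> r * - (t * \<epsilon>')" using r by (intro mult_left_mono) auto
        then have "exp (\<theta> * Y \<omega>) \<le> exp (- r * (t * \<epsilon>')) * exp ((\<theta> - r) * Y \<omega>)"
          unfolding exp_add[symmetric] by (simp add: algebra_simps)
        with pos show ?thesis by linarith
      qed
    qed
    have iG: "integrable M (\<lambda>\<omega>. indicator G \<omega> :: real)" by (simp add: emeasure_eq_measure)
    have "expectation (\<lambda>\<omega>. exp (\<theta> * Y \<omega>)) \<le> expectation (\<lambda>\<omega>. exp (\<bar>\<theta>\<bar> * (t * \<epsilon>')) * indicator G \<omega> +
       (exp (- r * (t * \<epsilon>')) * exp ((\<theta> + r) * Y \<omega>) + exp (- r * (t * \<epsilon>')) * exp ((\<theta> - r) * Y \<omega>)))"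
      using pw iG by (intro integral_mono) (auto intro!: Y Bochner_Integration.integrable_add integrable_mult_right)
    also have "\<dots> = exp (\<bar>\<theta>\<bar> * (t * \<epsilon>')) * prob G +
       (exp (- r * (t * \<epsilon>')) * exp (t * (L (\<theta> + r) - a * (\<theta> + r))) + exp (- r * (t * \<epsilon>')) * exp (t * (L (\<theta> - r) - a * (\<theta> - r))))"
      using Y iG by simp
    also have "\<dots> \<le> exp (\<bar>\<theta>\<bar> * (t * \<epsilon>')) * prob G +
       (exp (- r * (t * \<epsilon>')) * exp (t * (h + r * (\<epsilon>' / 2))) + exp (- r * (t * \<epsilon>')) * exp (t * (h + r * (\<epsilon>' / 2))))"
      using r t(2) unfolding h_def by (intro add_left_mono add_mono mult_left_mono) auto
    also have "exp (- r * (t * \<epsilon>')) * exp (t * (h + r * (\<epsilon>' / 2))) = exp (t * h) * exp (- (t * (r * \<epsilon>' / 2)))"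
      by (simp add: exp_add[symmetric] algebra_simps)
    also have "exp (- (t * (r * \<epsilon>' / 2))) \<le> 1 / 4"
    proof -
      have "ln 4 \<le> t * (r * \<epsilon>' / 2)" using t r e' unfolding t0_def by (simp add: pos_divide_le_eq)
      then have "exp (ln 4) \<le> exp (t * (r * \<epsilon>' / 2))" by (simp only: exp_le_cancel_iff)
      then have "inverse (exp (t * (r * \<epsilon>' / 2))) \<le> inverse 4" by (intro le_imp_inverse_le) auto
      then show ?thesis by (simp add: exp_minus)
    qed
    finally have "exp (t * h) \<le> exp (\<bar>\<theta>\<bar> * (t * \<epsilon>')) * prob G + (exp (t * h) * (1 / 4) + exp (t * h) * (1 / 4))"
      using Y(2)[of \<theta>] by (simp add: h_def)
    then have half: "exp (t * h) / 2 \<le> exp (\<bar>\<theta>\<bar> * (t * \<epsilon>')) * prob G" by simp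
    have "exp (- t * (conjugate L a + \<gamma>)) = exp (- (t * \<gamma> / 2)) * (exp (- (t * conjugate L a)) * exp (- (t * \<gamma> / 2)))"
      by (simp add: exp_add[symmetric] algebra_simps)
    also have "\<dots> \<le> exp (- (t * \<gamma> / 2)) * (exp (t * h) * (1 / 2))"
    proof (intro mult_left_mono mult_mono)
      have "- conjugate L a * t \<le> h * t" using h t by (intro mult_right_mono) auto
      then show "exp (- (t * conjugate L a)) \<le> exp (t * h)" by (simp add: mult.commute)
      have "ln 2 \<le> t * \<gamma> / 2" using t \<gamma> unfolding t0_def by (simp add: pos_divide_le_eq)
      then have "exp (ln 2) \<le> exp (t * \<gamma> / 2)" by (simp only: exp_le_cancel_iff)
      then have "inverse (exp (t * \<gamma> / 2)) \<le> inverse 2" by (intro le_imp_inverse_le) auto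
      then show "exp (- (t * \<gamma> / 2)) \<le> 1 / 2" by (simp add: exp_minus)
    qed auto
    also have "\<dots> \<le> exp (- (t * \<gamma> / 2)) * (exp (\<bar>\<theta>\<bar> * (t * \<epsilon>')) * prob G)"
      using half by (intro mult_left_mono) auto
    also have "\<dots> = exp (t * (\<bar>\<theta>\<bar> * \<epsilon>' - \<gamma> / 2)) * prob G" by (simp add: exp_add[symmetric] algebra_simps)
    also have "\<dots> \<le> 1 * prob G"
      using e\<theta> t by (intro mult_right_mono) (auto simp: mult_nonneg_nonpos)
    also have "\<dots> \<le> prob {\<omega> \<in> space M. \<bar>S \<omega> / t - a\<bar> < \<epsilon>}"
    proof (simp, rule finite_measure_mono)
      show "G \<subseteq> {\<omega> \<in> space M. \<bar>S \<omega> / t - a\<bar> < \<epsilon>}"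
      proof
        fix \<omega> assume "\<omega> \<in> G"
        then have \<omega>: "\<omega> \<in> space M" "\<bar>Y \<omega>\<bar> < t * \<epsilon>'" by (auto simp: G_def)
        have "S \<omega> / t - a = Y \<omega> / t" using t by (simp add: Y_def field_simps)
        then have "\<bar>S \<omega> / t - a\<bar> = \<bar>Y \<omega>\<bar> / t" using t by simp
        also have "\<dots> < \<epsilon>'" using \<omega> t by (simp add: pos_divide_less_eq mult.commute)
        finally show "\<omega> \<in> {\<omega> \<in> space M. \<bar>S \<omega> / t - a\<bar> < \<epsilon>}" using \<omega> e' by simp
      qed
    qed measurable
    finally show "exp (- t * (conjugate L ((1 - \<delta>) * a0) + \<gamma>)) \<le> prob {\<omega> \<in> space M. \<bar>S \<omega> / t - (1 - \<delta>) * a0\<bar> < \<epsilon>}"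
      unfolding a_def .
  qed
qed

section \<open>Good blocks among independent ones\<close>

text \<open>A block of \<open>m\<close> slopes is good with probability at least
  \<open>exp (- k * \<beta>)\<close> for some \<beta> < 1/c, while about
  \<open>exp (k / c) / k\<close> disjoint blocks are available. All of them fail with a probability
  at most \<open>exp (- k)\<close> for large \<open>k\<close>.\<close>

lemma near_slopes_block_eventually:
  assumes c: "c > 0" and m: "m > 0" and dom: "\<And>l. l < m \<Longrightarrow> a l \<in> conjugate_dom L"
    and sum: "(\<Sum>l<m. conjugate L (a l)) \<le> m * (1 / c)" and \<delta>: "0 < \<delta>" "\<delta> < 1" and \<epsilon>: "\<epsilon> > 0"
  shows "AE \<omega> in M. \<forall>\<^sub>F k in sequentially. \<exists>j. (real j + 1) * real k \<le> exp (real k / c) \<and>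
     (\<forall>l<m. \<bar>slope m k (j * m + l) \<omega> - (1 - \<delta>) * a l\<bar> < \<epsilon>)"
proof -
  \<comment> \<open>Contraction lowers the rate by \<delta>/c. Half of this is spent on the error of
    the lower bound, and the other half remains as the margin
    \<open>1 / c - \<beta> = \<gamma>\<close>.\<close>
  define \<gamma> where "\<gamma> = \<delta> / (2 * c)"
  define \<beta> where "\<beta> = (1 - \<delta>) / c + \<gamma>"
  have \<gamma>: "\<gamma> > 0" using \<delta> c by (simp add: \<gamma>_def)
  have \<beta>: "\<beta> > 0" using \<delta> c \<gamma> by (auto simp: \<beta>_def intro!: add_nonneg_pos divide_nonneg_pos)
  have \<beta>\<gamma>: "1 / c - \<beta> = \<gamma>" using c by (simp add: \<beta>_def \<gamma>_def field_simps)
  define Q where "Q l t0 \<longleftrightarrow> (\<forall>t S. t \<ge> t0 \<longrightarrow> t > 0 \<longrightarrow> random_variable borel S \<longrightarrow>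
     (\<forall>\<theta>. (\<integral>\<^sup>+\<omega>. ennreal (exp (\<theta> * S \<omega>)) \<partial>M) = ennreal (exp (t * L \<theta>))) \<longrightarrow>
     exp (- t * (conjugate L ((1 - \<delta>) * a l) + \<gamma>)) \<le> prob {\<omega> \<in> space M. \<bar>S \<omega> / t - (1 - \<delta>) * a l\<bar> < \<epsilon>})" for l t0
  have "\<exists>t0. Q l t0" if lm: "l < m" for l
  proof -
    obtain t0 where "\<And>t S. t \<ge> t0 \<Longrightarrow> t > 0 \<Longrightarrow> random_variable borel S \<Longrightarrow>
     (\<And>\<theta>. (\<integral>\<^sup>+\<omega>. ennreal (exp (\<theta> * S \<omega>)) \<partial>M) = ennreal (exp (t * L \<theta>))) \<Longrightarrow>
     exp (- t * (conjugate L ((1 - \<delta>) * a l) + \<gamma>)) \<le> prob {\<omega> \<in> space M. \<bar>S \<omega> / t - (1 - \<delta>) * a l\<bar> < \<epsilon>}"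
      using cramer_lower_bound[OF dom[OF lm] \<delta> \<epsilon> \<gamma>] by blast
    then have "Q l t0" unfolding Q_def by blast
    then show ?thesis ..
  qed
  then obtain t0 where Q: "\<And>l. l < m \<Longrightarrow> Q l (t0 l)" by metis
  have t0: "exp (- t * (conjugate L ((1 - \<delta>) * a l) + \<gamma>)) \<le> prob {\<omega> \<in> space M. \<bar>S \<omega> / t - (1 - \<delta>) * a l\<bar> < \<epsilon>}"
    if "l < m" "t \<ge> t0 l" "t > 0" "random_variable borel S"
      "\<And>\<theta>. (\<integral>\<^sup>+\<omega>. ennreal (exp (\<theta> * S \<omega>)) \<partial>M) = ennreal (exp (t * L \<theta>))" for l t S
    using Q[OF that(1)] that(2-5) unfolding Q_def by blast
  define Good where "Good k j = {\<omega> \<in> space M. \<forall>l\<in>{..<m}. \<bar>slope m k (j * m + l) \<omega> - (1 - \<delta>) * a l\<bar> < \<epsilon>}" for k j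
  have Good_ev: "Good k j \<in> events" for k j
    unfolding Good_def
  proof (rule sets.sets_Collect_finite_All)
    fix l show "{\<omega> \<in> space M. \<bar>slope m k (j * m + l) \<omega> - (1 - \<delta>) * a l\<bar> < \<epsilon>} \<in> events" by measurable
  qed simp
  have Good_prob: "exp (- (real k * \<beta>)) \<le> prob (Good k j)" if k: "k > 0" "\<And>l. l < m \<Longrightarrow> t0 l \<le> real k / m" for k j
  proof -
    define t where "t = real k / m"
    have t: "t > 0" using k m by (simp add: t_def)
    define B where "B l = {x. \<bar>x - (1 - \<delta>) * a l\<bar> < \<epsilon>}" for l
    have B: "B l \<in> sets borel" for l unfolding B_def by measurable
    have Geq: "Good k j = (\<Inter>l\<in>{..<m}. slope m k (j * m + l) -` B l \<inter> space M)"
      using m by (auto simp: Good_def B_def)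
    have each: "exp (- t * (conjugate L ((1 - \<delta>) * a l) + \<gamma>)) \<le> prob (slope m k (j * m + l) -` B l \<inter> space M)" if l: "l < m" for l
    proof -
      let ?S = "\<lambda>\<omega>. W (real (Suc (j * m + l)) * (real k / m)) \<omega> - W (real (j * m + l) * (real k / m)) \<omega>"
      have "exp (- t * (conjugate L ((1 - \<delta>) * a l) + \<gamma>)) \<le> prob {\<omega> \<in> space M. \<bar>?S \<omega> / t - (1 - \<delta>) * a l\<bar> < \<epsilon>}"
      proof (rule t0[OF l])
        show "random_variable borel ?S" by (intro borel_measurable_diff rv_grid)
        show "(\<integral>\<^sup>+\<omega>. ennreal (exp (\<theta> * ?S \<omega>)) \<partial>M) = ennreal (exp (t * L \<theta>))" for \<theta>
          unfolding t_def by (rule slope_mgf[OF m])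
      qed (use t k(2)[OF l] in \<open>auto simp: t_def\<close>)
      also have "{\<omega> \<in> space M. \<bar>?S \<omega> / t - (1 - \<delta>) * a l\<bar> < \<epsilon>} = slope m k (j * m + l) -` B l \<inter> space M"
        unfolding slope_def B_def t_def by auto
      finally show ?thesis .
    qed
    have "(\<Sum>l<m. conjugate L ((1 - \<delta>) * a l)) \<le> (\<Sum>l<m. (1 - \<delta>) * conjugate L (a l))"
      using \<delta> dom L_nonneg by (intro sum_mono conjugate_scale) auto
    also have "\<dots> \<le> (1 - \<delta>) * (m * (1 / c))"
      unfolding sum_distrib_left[symmetric] using sum \<delta> by (intro mult_left_mono) auto
    finally have "(\<Sum>l<m. conjugate L ((1 - \<delta>) * a l) + \<gamma>) \<le> m * \<beta>"
      by (simp add: sum.distrib \<beta>_def algebra_simps)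
    then have "t * (\<Sum>l<m. conjugate L ((1 - \<delta>) * a l) + \<gamma>) \<le> t * (m * \<beta>)" using t by (intro mult_left_mono) auto
    also have "t * (m * \<beta>) = real k * \<beta>" using m by (simp add: t_def)
    finally have "exp (- (real k * \<beta>)) \<le> exp (\<Sum>l<m. - t * (conjugate L ((1 - \<delta>) * a l) + \<gamma>))"
      by (simp add: sum_distrib_left[symmetric] sum_negf)
    also have "\<dots> = (\<Prod>l<m. exp (- t * (conjugate L ((1 - \<delta>) * a l) + \<gamma>)))" by (simp add: exp_sum)
    also have "\<dots> \<le> (\<Prod>l<m. prob (slope m k (j * m + l) -` B l \<inter> space M))"
      using each by (intro prod_mono) auto
    also have "\<dots> = prob (Good k j)"
      unfolding Geq using m B by (intro indep_varsD_finite[OF indep_slopes, symmetric]) auto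
    finally show ?thesis .
  qed
  \<comment> \<open>Block \<open>j\<close> covers times from \<open>j * k\<close> to
    \<open>(j + 1) * k\<close>; all \<open>J k\<close> blocks end by \<open>exp (k / c)\<close>,
    which is at most \<open>n\<close>.\<close>
  define J where "J k = nat \<lfloor>exp (real k / c) / real k\<rfloor>" for k :: nat
  \<comment> \<open>Intersecting with \<open>space M\<close> keeps this an event when
    \<open>J k = 0\<close>, where the inner intersection is the universe.\<close>
  define Bad where "Bad k = (\<Inter>j\<in>{..<J k}. space M - Good k j) \<inter> space M" for k
  have Bad_ev: "Bad k \<in> events" for k
  proof (cases "J k = 0")
    case False
    then show ?thesis unfolding Bad_def using Good_ev by (intro sets.Int sets.finite_INT) auto
  qed (simp add: Bad_def)
  have Bad_prob: "prob (Bad k) \<le> exp (- (real (J k) * exp (- (real k * \<beta>))))"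
    if k: "k > 0" "\<And>l. l < m \<Longrightarrow> t0 l \<le> real k / m" "J k > 0" for k
  proof -
    \<comment> \<open>The slopes are grouped into vectors over disjoint index blocks, and
      independence passes to these vectors.\<close>
    define Kj where "Kj j = {j * m..<j * m + m}" for j
    define Y where "Y j \<omega> = restrict (\<lambda>i. slope m k i \<omega>) (Kj j)" for j \<omega>
    have ind: "indep_vars (\<lambda>j. PiM (Kj j) (\<lambda>_. borel)) Y {..<J k}"
      unfolding Y_def
    proof (rule indep_vars_restrict)
      show "indep_vars (\<lambda>_. borel) (slope m k) {..<J k * m}" using indep_slopes[of m k 0 "J k * m"] by simp
      fix j assume "j \<in> {..<J k}"
      then have "(j + 1) * m \<le> J k * m" by (intro mult_right_mono) auto
      then show "Kj j \<subseteq> {..<J k * m}" by (auto simp: Kj_def)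
    next
      show "disjoint_family_on Kj {..<J k}"
        unfolding disjoint_family_on_def
      proof (intro ballI impI)
        fix i j :: nat assume "i \<noteq> j"
        have "x div m = i" if "x \<in> Kj i" for x i
          using that m by (auto simp: Kj_def intro!: div_nat_eqI simp: mult.commute)
        with \<open>i \<noteq> j\<close> show "Kj i \<inter> Kj j = {}" by blast
      qed
    qed
    define C where "C j = {x \<in> space (PiM (Kj j) (\<lambda>_. borel)). \<exists>l\<in>{..<m}. \<not> \<bar>x (j * m + l) - (1 - \<delta>) * a l\<bar> < \<epsilon>}" for j
    have C: "C j \<in> sets (PiM (Kj j) (\<lambda>_. borel))" for j
      unfolding C_def
    proof (rule sets.sets_Collect_finite_Ex)
      fix l assume "l \<in> {..<m}"
      then have [measurable]: "(\<lambda>x. x (j * m + l)) \<in> borel_measurable (PiM (Kj j) (\<lambda>_. borel :: real measure))"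
        by (intro measurable_component_singleton) (auto simp: Kj_def)
      show "{x \<in> space (PiM (Kj j) (\<lambda>_. borel)). \<not> \<bar>x (j * m + l) - (1 - \<delta>) * a l\<bar> < \<epsilon>} \<in> sets (PiM (Kj j) (\<lambda>_. borel))"
        by measurable
    qed simp
    have YC: "Y j -` C j \<inter> space M = space M - Good k j" for j
      by (auto simp: C_def Y_def Good_def Kj_def space_PiM)
    have "Bad k = (\<Inter>j\<in>{..<J k}. Y j -` C j \<inter> space M)"
      unfolding YC Bad_def using k(3) by auto
    then have "prob (Bad k) = (\<Prod>j<J k. prob (Y j -` C j \<inter> space M))"
      using k(3) C by (simp only:) (intro indep_varsD_finite[OF ind]; auto)
    also have "\<dots> \<le> (\<Prod>j<J k. exp (- exp (- (real k * \<beta>))))"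
    proof (intro prod_mono conjI)
      fix j
      have "prob (Y j -` C j \<inter> space M) = 1 - prob (Good k j)" unfolding YC using Good_ev by (rule prob_compl)
      also have "\<dots> \<le> 1 + - exp (- (real k * \<beta>))" using Good_prob[OF k(1,2)] by simp
      also have "\<dots> \<le> exp (- exp (- (real k * \<beta>)))" by (rule exp_ge_add_one_self)
      finally show "prob (Y j -` C j \<inter> space M) \<le> exp (- exp (- (real k * \<beta>)))" .
    qed simp
    also have "\<dots> = exp (- (real (J k) * exp (- (real k * \<beta>))))" by (simp add: exp_of_nat_mult[symmetric])
    finally show ?thesis .
  qed
  \<comment> \<open>The margin \<gamma> makes the expected number of good blocks at least
    \<open>k\<close>, even after division by \<open>k\<close> and rounding down in
    \<open>J\<close>.\<close>
  have ev1: "\<forall>\<^sub>F k in sequentially. real k \<le> exp (\<gamma> * real k) / real k - exp (- (\<beta> * real k))"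
  proof -
    have "\<forall>\<^sub>F k in sequentially. real k * (real k + 1) \<le> exp (\<gamma> * real k)"
      using \<gamma> by real_asymp
    then show ?thesis using eventually_gt_at_top[of 0]
    proof eventually_elim
      case (elim k)
      then have "real k + 1 \<le> exp (\<gamma> * real k) / real k" by (simp add: pos_le_divide_eq mult.commute)
      moreover have "exp (- (\<beta> * real k)) \<le> 1" using \<beta> by simp
      ultimately show ?case by linarith
    qed
  qed
  have ev2: "\<forall>\<^sub>F k in sequentially. \<forall>l\<in>{..<m}. t0 l \<le> real k / m"
  proof (intro eventually_ball_finite ballI)
    fix l
    have "filterlim (\<lambda>k. real k / m) at_top sequentially" using m by real_asymp
    then show "\<forall>\<^sub>F k in sequentially. t0 l \<le> real k / m" by (simp add: filterlim_at_top)
  qed simp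
  have "\<forall>\<^sub>F k in sequentially. prob (Bad k) \<le> exp (- 1) ^ k"
    using ev1 ev2 eventually_gt_at_top[of 0]
  proof eventually_elim
    case (elim k)
    have "exp (real k / c) / real k - 1 \<le> real (J k)" unfolding J_def by linarith
    then have "(exp (real k / c) / real k - 1) * exp (- (real k * \<beta>)) \<le> real (J k) * exp (- (real k * \<beta>))"
      by (intro mult_right_mono) auto
    moreover have "(exp (real k / c) / real k - 1) * exp (- (real k * \<beta>)) = exp (\<gamma> * real k) / real k - exp (- (\<beta> * real k))"
      unfolding \<beta>\<gamma>[symmetric] by (simp add: left_diff_distrib exp_diff exp_minus mult.commute field_simps)
    ultimately have le: "real k \<le> real (J k) * exp (- (real k * \<beta>))" using elim(1) by simp
    then have "J k > 0" using elim(3) by (cases "J k") auto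
    then have "prob (Bad k) \<le> exp (- (real (J k) * exp (- (real k * \<beta>))))" using elim by (intro Bad_prob) auto
    also have "\<dots> \<le> exp (- real k)" using le by simp
    also have "\<dots> = exp (- 1) ^ k" by (simp add: exp_of_nat_mult[symmetric])
    finally show ?case .
  qed
  moreover have "summable (\<lambda>k. exp (- 1 :: real) ^ k)" by (intro summable_geometric) simp
  ultimately have "AE \<omega> in M. \<forall>\<^sub>F k in sequentially. \<omega> \<notin> Bad k"
    using Bad_ev by (intro AE_eventually_not_in)
  then show ?thesis using AE_space
  proof eventually_elim
    case (elim \<omega>)
    from elim(1) eventually_gt_at_top[of 0] show ?case
    proof eventually_elim
      case (elim k)
      then obtain j where j: "j < J k" "\<omega> \<in> Good k j" using \<open>\<omega> \<in> space M\<close> unfolding Bad_def by blast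
      have "real j + 1 \<le> real (J k)" using j(1) by linarith
      also have "\<dots> \<le> exp (real k / c) / real k" unfolding J_def by simp
      finally have "(real j + 1) * real k \<le> exp (real k / c)" using elim(2) by (simp add: pos_le_divide_eq)
      with j(2) show ?case by (auto simp: Good_def)
    qed
  qed
qed

end

section \<open>Approximation by the sublevel set\<close>

lemma cell_nat:
  assumes "0 \<le> x" "h > (0::real)"
  obtains i :: nat where "real i * h \<le> x" "x \<le> real (Suc i) * h"
proof -
  define i where "i = nat \<lfloor>x / h\<rfloor>"
  have "0 \<le> x / h" using assms by simp
  then have "real i = \<lfloor>x / h\<rfloor>" by (simp add: i_def)
  then have "real i \<le> x / h" "x / h \<le> real i + 1" by linarith+
  then show thesis using assms by (intro that[of i]) (auto simp: pos_le_divide_eq pos_divide_le_eq add.commute)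
qed

text \<open>The 4 splits as follows: 2 for the end point, which may lie one cell further than the
  cell of \<open>s\<close> because \<open>x\<close> is not a grid point; 1 for moving
  \<open>x\<close> to its grid point; 1 for interpolation inside the cell. That extra cell is why
  the oscillation is assumed up to index \<open>i + m\<close> inclusive.\<close>

lemma increment_near_polygon:
  fixes w :: "real \<Rightarrow> real" and m k i :: nat and s x \<epsilon> :: real
  assumes m: "m > 0" and k: "k > 0" and s: "0 \<le> s" "s \<le> 1"
    and x: "real i * (real k / m) \<le> x" "x \<le> real (Suc i) * (real k / m)"
    and osc: "\<And>i' u. i \<le> i' \<Longrightarrow> i' \<le> i + m \<Longrightarrow> 0 \<le> u \<Longrightarrow> u \<le> real k / m \<Longrightarrow>
      \<bar>w (real i' * (real k / m) + u) - w (real i' * (real k / m))\<bar> \<le> \<epsilon> * k"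
  shows "\<bar>(w (x + s * k) - w x) / k -
    polygon m (\<lambda>l. (w (real (Suc (i + l)) * (real k / m)) - w (real (i + l) * (real k / m))) / (real k / m)) s\<bar> \<le> 4 * \<epsilon>"
proof -
  define h where "h = real k / m"
  define \<tau> where "\<tau> l = w (real (i + l) * h)" for l
  have h: "h > 0" "h * m = k" using m k by (auto simp: h_def)
  have osc': "\<bar>w y - \<tau> l\<bar> \<le> \<epsilon> * k" if "l \<le> m" "real (i + l) * h \<le> y" "y \<le> real (Suc (i + l)) * h" for l y
    using osc[of "i + l" "y - real (i + l) * h"] that by (auto simp: h_def[symmetric] \<tau>_def distrib_right)
  have step: "\<bar>\<tau> (Suc l) - \<tau> l\<bar> \<le> \<epsilon> * k" if "l < m" for l
    using osc'[of l "real (Suc (i + l)) * h"] that h by (simp add: \<tau>_def distrib_right)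
  obtain j where j: "j < m" "real j / m \<le> s" "s \<le> (real j + 1) / m" using grid_cell[OF s m] .
  have sk: "real j * h \<le> s * k" "s * k \<le> (real j + 1) * h"
  proof -
    have "real j / m * k \<le> s * k" "s * k \<le> (real j + 1) / m * k" by (rule mult_right_mono[OF j(2)], simp) (rule mult_right_mono[OF j(3)], simp)
    then show "real j * h \<le> s * k" "s * k \<le> (real j + 1) * h" by (auto simp: h_def)
  qed
  have lo: "real (i + j) * h \<le> x + s * k" and hi: "x + s * k \<le> real (i + j + 2) * h"
    using x sk by (auto simp: h_def[symmetric] algebra_simps)
  have "\<bar>w (x + s * k) - \<tau> j\<bar> \<le> 2 * (\<epsilon> * k)"
  proof (cases "x + s * k \<le> real (Suc (i + j)) * h")
    case True
    then have "\<bar>w (x + s * k) - \<tau> j\<bar> \<le> \<epsilon> * k" using lo j by (intro osc') auto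
    then show ?thesis by linarith
  next
    case False
    then have "\<bar>w (x + s * k) - \<tau> (Suc j)\<bar> \<le> \<epsilon> * k" using hi j by (intro osc') auto
    with step[OF j(1)] show ?thesis by linarith
  qed
  moreover have "\<bar>w x - \<tau> 0\<bar> \<le> \<epsilon> * k" using x by (intro osc') (auto simp: h_def)
  moreover have "\<bar>(\<tau> (Suc j) - \<tau> j) * (m * (s - j / m))\<bar> \<le> \<epsilon> * k"
  proof -
    have "0 \<le> m * (s - j / m)" "m * (s - j / m) \<le> 1"
      using j m by (auto simp: right_diff_distrib pos_le_divide_eq pos_divide_le_eq mult.commute)
    then have "\<bar>(\<tau> (Suc j) - \<tau> j) * (m * (s - j / m))\<bar> \<le> \<bar>\<tau> (Suc j) - \<tau> j\<bar> * 1"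
      unfolding abs_mult by (intro mult_left_mono) auto
    with step[OF j(1)] show ?thesis by simp
  qed
  ultimately have "\<bar>(w (x + s * k) - w x) - (\<tau> j - \<tau> 0 + (\<tau> (Suc j) - \<tau> j) * (m * (s - j / m)))\<bar> \<le> 4 * \<epsilon> * k"
    by linarith
  then have "\<bar>(w (x + s * k) - w x) - (\<tau> j - \<tau> 0 + (\<tau> (Suc j) - \<tau> j) * (m * (s - j / m)))\<bar> / k \<le> 4 * \<epsilon>"
    using k by (simp add: pos_divide_le_eq)
  moreover have "polygon m (\<lambda>l. (\<tau> (Suc l) - \<tau> l) / h) s = (\<tau> j - \<tau> 0 + (\<tau> (Suc j) - \<tau> j) * (m * (s - j / m))) / k"
  proof -
    have "(\<Sum>l<j. (\<tau> (Suc l) - \<tau> l) / h) = (\<tau> j - \<tau> 0) / h"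
      by (simp add: sum_divide_distrib[symmetric] sum_lessThan_telescope)
    moreover have "(\<tau> j - \<tau> 0) / h / m = (\<tau> j - \<tau> 0) / k" using h(2) by simp
    moreover have "(\<tau> (Suc j) - \<tau> j) / h * (s - j / m) = (\<tau> (Suc j) - \<tau> j) * (m * (s - j / m)) / k"
      using m k by (simp add: h_def)
    ultimately show ?thesis unfolding polygon_eq[OF j] by (simp only: add_divide_distrib)
  qed
  ultimately have "\<bar>(w (x + s * k) - w x) / k - polygon m (\<lambda>l. (\<tau> (Suc l) - \<tau> l) / h) s\<bar> \<le> 4 * \<epsilon>"
    using k by (simp add: diff_divide_distrib[symmetric] abs_divide)
  then show ?thesis by (simp add: \<tau>_def h_def)
qed

text \<open>Coordinates are rounded to multiples of \<open>e\<close>, and one member of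
  \<open>A\<close> is kept for each of the finitely many rounded vectors. Taking the net inside
  \<open>A\<close> preserves the rate bound for its members.\<close>

lemma finite_slope_net:
  fixes A :: "(nat \<Rightarrow> real) set" and m :: nat
  assumes e: "e > (0::real)" and bdd: "\<And>a l. a \<in> A \<Longrightarrow> l < m \<Longrightarrow> \<bar>a l\<bar> \<le> B"
  obtains R where "finite R" "R \<subseteq> A" "\<And>a. a \<in> A \<Longrightarrow> \<exists>r\<in>R. \<forall>l<m. \<bar>a l - r l\<bar> \<le> e"
proof -
  define q where "q a = restrict (\<lambda>l. \<lfloor>a l / e\<rfloor>) {..<m}" for a :: "nat \<Rightarrow> real"
  have "q ` A \<subseteq> PiE {..<m} (\<lambda>_. {\<lfloor>- B / e\<rfloor>..\<lfloor>B / e\<rfloor>})"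
  proof
    fix z assume "z \<in> q ` A"
    then obtain a where a: "a \<in> A" "z = q a" by blast
    have "\<lfloor>a l / e\<rfloor> \<in> {\<lfloor>- B / e\<rfloor>..\<lfloor>B / e\<rfloor>}" if "l < m" for l
    proof -
      have B: "- B \<le> a l" "a l \<le> B" using bdd[OF a(1) that] by auto
      have "- B / e \<le> a l / e" "a l / e \<le> B / e"
        using divide_right_mono[OF B(1), of e] divide_right_mono[OF B(2), of e] e by auto
      then show ?thesis by (auto intro!: floor_mono)
    qed
    then show "z \<in> PiE {..<m} (\<lambda>_. {\<lfloor>- B / e\<rfloor>..\<lfloor>B / e\<rfloor>})" unfolding a(2) q_def by auto
  qed
  then have fin: "finite (q ` A)" by (rule finite_subset) (intro finite_PiE; simp)
  show thesis
  proof (rule that[of "inv_into A q ` (q ` A)"])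
    show "finite (inv_into A q ` (q ` A))" using fin by simp
    show "inv_into A q ` (q ` A) \<subseteq> A" by (auto intro: inv_into_into)
    fix a assume a: "a \<in> A"
    define r where "r = inv_into A q (q a)"
    have "q r = q a" unfolding r_def by (rule f_inv_into_f[OF imageI[OF a]])
    have "\<bar>a l - r l\<bar> \<le> e" if "l < m" for l
    proof -
      have "\<lfloor>r l / e\<rfloor> = \<lfloor>a l / e\<rfloor>" using fun_cong[OF \<open>q r = q a\<close>, of l] that by (simp add: q_def)
      then have "\<bar>a l / e - r l / e\<bar> \<le> 1" by linarith
      then have "\<bar>a l - r l\<bar> / e \<le> 1" using e by (simp add: diff_divide_distrib[symmetric] abs_divide)
      then show ?thesis using e by (simp add: pos_divide_le_eq)
    qed
    then show "\<exists>r\<in>inv_into A q ` (q ` A). \<forall>l<m. \<bar>a l - r l\<bar> \<le> e"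
      using a by (intro bexI[of _ r]) (auto simp: r_def)
  qed
qed

lemma dist_U_le:
  assumes "\<And>s. 0 \<le> s \<Longrightarrow> s \<le> 1 \<Longrightarrow> \<bar>f s - g s\<bar> \<le> e"
  shows "dist_U f g \<le> e"
  unfolding dist_U_def using assms by (intro cSUP_least) auto

lemma sum_abs_slopes_le:
  assumes "\<And>l. l < m \<Longrightarrow> a l \<in> conjugate_dom L" "(\<Sum>l<m. conjugate L (a l)) \<le> real m * \<alpha>" "m > 0"
  shows "(\<Sum>l<m. \<bar>a l\<bar>) / m \<le> \<alpha> + max (L 1) (L (- 1))"
proof -
  have "(\<Sum>l<m. \<bar>a l\<bar>) \<le> (\<Sum>l<m. conjugate L (a l) + max (L 1) (L (- 1)))"
    using assms(1) by (intro sum_mono abs_le_conjugate) auto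
  also have "\<dots> \<le> real m * (\<alpha> + max (L 1) (L (- 1)))"
    using assms(2) by (simp add: sum.distrib distrib_left)
  finally show ?thesis using assms(3) by (simp add: pos_divide_le_eq mult.commute)
qed

context exp_moment_increments
begin

text \<open>The increment of \<open>W\<close> over a window of length \<open>k\<close> is close to the polygon through its values on the
  grid; contracting that polygon by a factor \<open>1 - \<delta>\<close> moves it into the sublevel set.\<close>

lemma increments_near_sublevel:
  assumes c: "c > 0" and \<epsilon>: "\<epsilon> > 0" and fin: "\<And>\<theta>. \<Phi> \<theta> < \<infinity>" and L: "L = log_mgf \<Phi>"
  shows "AE \<omega> in M. \<forall>\<^sub>F k in sequentially. \<forall>(x::real) (n::real). 0 \<le> x \<longrightarrow> x \<le> n - real k \<longrightarrow> n \<le> exp ((real k + 1) / c) \<longrightarrow>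
     (\<exists>g\<in>sublevel \<Phi> (1 / c). \<forall>s::real. 0 \<le> s \<longrightarrow> s \<le> 1 \<longrightarrow> \<bar>(W (x + s * k) \<omega> - W x \<omega>) / k - g s\<bar> \<le> \<epsilon>)"
proof -
  \<comment> \<open>A bound for the mean absolute slope of vectors of rate at most
    \<open>2 / c\<close>; contraction by \<open>1 - \<delta>\<close> then moves the polygon by at
    most \<open>\<delta> * Cc\<close>.\<close>
  define Cc where "Cc = 2 / c + max (L 1) (L (- 1))"
  have Cc: "Cc > 0" using c L_nonneg[of 1] unfolding Cc_def by (intro add_pos_nonneg) auto
  define \<delta> where "\<delta> = min (1 / 2) (\<epsilon> / (2 * Cc))"
  have \<delta>: "0 < \<delta>" "\<delta> \<le> 1 / 2" using \<epsilon> Cc by (auto simp: \<delta>_def)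
  \<comment> \<open>Chosen so that contraction brings the rate back to exactly \<open>1 / c\<close>;
    \<delta> \<le> 1/2 ensures \<beta> \<le> 2/c.\<close>
  define \<beta> where "\<beta> = 1 / (c * (1 - \<delta>))"
  have \<beta>: "1 / c < \<beta>" "\<beta> \<le> 2 / c" "(1 - \<delta>) * \<beta> = 1 / c"
  proof -
    show "1 / c < \<beta>" using c \<delta> unfolding \<beta>_def by (intro divide_strict_left_mono) auto
    have "1 / (c * (1 - \<delta>)) \<le> 1 / (c * (1 / 2))" using c \<delta> by (intro divide_left_mono mult_left_mono) auto
    then show "\<beta> \<le> 2 / c" by (simp add: \<beta>_def)
    show "(1 - \<delta>) * \<beta> = 1 / c" using c \<delta> by (simp add: \<beta>_def)
  qed
  obtain m0 where m0: "\<And>m. m \<ge> m0 \<Longrightarrow> m > (0::nat) \<Longrightarrow> AE \<omega> in M. \<forall>\<^sub>F k in sequentially.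
     \<forall>i\<in>grid_indices m c k.
       (\<forall>s::real. 0 \<le> s \<and> s \<le> real k / m \<longrightarrow> \<bar>W (real i * (real k / m) + s) \<omega> - W (real i * (real k / m)) \<omega>\<bar> \<le> (\<epsilon> / 8) * real k)"
    using oscillation_eventually[OF c, of "\<epsilon> / 8"] \<epsilon> by auto
  define m where "m = Suc m0"
  have m: "m > 0" "m \<ge> m0" by (auto simp: m_def)
  from m0[OF m(2,1)] conjugate_sum_eventually[OF c m(1) \<beta>(1)] show ?thesis
  proof eventually_elim
    case (elim \<omega>)
    from elim(1) elim(2) eventually_gt_at_top[of 0] show ?case
    proof eventually_elim
      case (elim k)
      show ?case
      proof (intro allI impI)
        fix x n :: real assume x: "0 \<le> x" "x \<le> n - real k" and n: "n \<le> exp ((real k + 1) / c)"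
        have hpos: "real k / m > 0" using elim(3) m by simp
        obtain i where i: "real i * (real k / m) \<le> x" "x \<le> real (Suc i) * (real k / m)"
          using cell_nat[OF x(1) hpos] .
        have grid: "i' \<in> grid_indices m c k" if "i' \<le> i + m" for i'
        proof -
          have "real i' * (real k / m) \<le> real (i + m) * (real k / m)" using that hpos by (intro mult_right_mono) auto
          also have "\<dots> = real i * (real k / m) + k" using m by (simp add: distrib_right add_divide_distrib)
          also have "\<dots> \<le> n" using i x by simp
          finally have "real i' * real k \<le> n * m" using m by (simp add: pos_divide_le_eq)
          moreover have "real i' * 1 \<le> real i' * real k" using elim(3) by (intro mult_left_mono) auto
          moreover have "n * m \<le> exp ((real k + 1) / c) * m" using n by (intro mult_right_mono) auto
          ultimately show ?thesis by (simp add: grid_indices_def mult.commute)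
        qed
        define a where "a l = slope m k (i + l) \<omega>" for l
        have a: "\<And>l. l < m \<Longrightarrow> a l \<in> conjugate_dom L" "(\<Sum>l<m. conjugate L (a l)) \<le> m * \<beta>"
          using elim(2) grid[of i] by (auto simp: a_def)
        define g where "g = polygon m (\<lambda>l. (1 - \<delta>) * a l)"
        have "(\<Sum>l<m. conjugate L ((1 - \<delta>) * a l)) \<le> (\<Sum>l<m. (1 - \<delta>) * conjugate L (a l))"
          using \<delta> a(1) L_nonneg by (intro sum_mono conjugate_scale) auto
        also have "\<dots> \<le> (1 - \<delta>) * (m * \<beta>)"
          unfolding sum_distrib_left[symmetric] using a(2) \<delta> by (intro mult_left_mono) auto
        also have "\<dots> = m * (1 / c)" using \<beta>(3) by (metis mult.left_commute)
        finally have sum: "(\<Sum>l<m. conjugate L ((1 - \<delta>) * a l)) \<le> m * (1 / c)" .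
        have g: "g \<in> sublevel \<Phi> (1 / c)"
          unfolding g_def
        proof (rule polygon_in_sublevel[OF fin m(1)])
          show "(1 - \<delta>) * a l \<in> conjugate_dom (log_mgf \<Phi>)" if "l < m" for l
            using conjugate_scale(1)[OF a(1)[OF that] L_nonneg, of "1 - \<delta>"] \<delta> unfolding L by simp
        qed (use sum L_0 in \<open>auto simp: L\<close>)
        show "\<exists>g\<in>sublevel \<Phi> (1 / c). \<forall>s::real. 0 \<le> s \<longrightarrow> s \<le> 1 \<longrightarrow> \<bar>(W (x + s * k) \<omega> - W x \<omega>) / k - g s\<bar> \<le> \<epsilon>"
        proof (intro bexI[OF _ g] allI impI)
          fix s :: real assume s: "0 \<le> s" "s \<le> 1"
          have "\<bar>(W (x + s * k) \<omega> - W x \<omega>) / k - polygon m a s\<bar> \<le> 4 * (\<epsilon> / 8)"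
            unfolding a_def slope_def
            by (rule increment_near_polygon[where w = "\<lambda>t. W t \<omega>", OF m(1) elim(3) s i]) (use elim(1) grid in auto)
          moreover have "\<bar>polygon m a s - g s\<bar> \<le> \<epsilon> / 2"
          proof -
            have "\<bar>polygon m a s - g s\<bar> \<le> (\<Sum>l<m. \<bar>a l - (1 - \<delta>) * a l\<bar>) / m"
              unfolding g_def by (rule polygon_diff_le)
            also have "(\<Sum>l<m. \<bar>a l - (1 - \<delta>) * a l\<bar>) = \<delta> * (\<Sum>l<m. \<bar>a l\<bar>)"
              using \<delta> by (simp add: left_diff_distrib abs_mult sum_distrib_left)
            also have "\<delta> * (\<Sum>l<m. \<bar>a l\<bar>) / m = \<delta> * ((\<Sum>l<m. \<bar>a l\<bar>) / m)" by simp
            also have "\<dots> \<le> (\<epsilon> / (2 * Cc)) * Cc"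
            proof (rule mult_mono)
              show "(\<Sum>l<m. \<bar>a l\<bar>) / m \<le> Cc"
                using sum_abs_slopes_le[OF a m(1)] \<beta>(2) by (simp add: Cc_def)
            qed (use \<delta> \<epsilon> Cc in \<open>auto simp: \<delta>_def intro!: divide_nonneg_nonneg sum_nonneg\<close>)
            also have "\<dots> = \<epsilon> / 2" using Cc by simp
            finally show ?thesis .
          qed
          ultimately show "\<bar>(W (x + s * k) \<omega> - W x \<omega>) / k - g s\<bar> \<le> \<epsilon>" by linarith
        qed
      qed
    qed
  qed
qed

lemma sublevel_near_increments:
  assumes c: "c > 0" and \<epsilon>: "\<epsilon> > 0" and fin: "\<And>\<theta>. \<Phi> \<theta> < \<infinity>" and L: "L = log_mgf \<Phi>"
  shows "AE \<omega> in M. \<forall>\<^sub>F k in sequentially. \<forall>f\<in>sublevel \<Phi> (1 / c).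
     \<exists>x::real. 0 \<le> x \<and> x \<le> exp (real k / c) - real k \<and>
       (\<forall>s::real. 0 \<le> s \<longrightarrow> s \<le> 1 \<longrightarrow> \<bar>(W (x + s * k) \<omega> - W x \<omega>) / k - f s\<bar> \<le> \<epsilon>)"
proof -
  \<comment> \<open>The budget: 4e for passing from the increment to its polygon, 3e for the slopes
    (net, lower bound and contraction, one each), 2e for passing from \<open>f\<close> to its
    polygon.\<close>
  define e where "e = \<epsilon> / 10"
  have e: "e > 0" and \<epsilon>_eq: "\<epsilon> = 10 * e" using \<epsilon> by (auto simp: e_def)
  define Cc where "Cc = 1 / c + max (L 1) (L (- 1))"
  have Cc: "Cc > 0" using c L_nonneg[of 1] unfolding Cc_def by (intro add_pos_nonneg) auto
  define \<delta> where "\<delta> = min (1 / 2) (e / Cc)"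
  have \<delta>: "0 < \<delta>" "\<delta> < 1" "\<delta> * Cc \<le> e"
  proof -
    show "0 < \<delta>" "\<delta> < 1" using e Cc by (auto simp: \<delta>_def)
    have "\<delta> * Cc \<le> e / Cc * Cc" using Cc by (intro mult_right_mono) (auto simp: \<delta>_def)
    then show "\<delta> * Cc \<le> e" using Cc by simp
  qed
  obtain m0 where m0: "\<And>m. m \<ge> m0 \<Longrightarrow> m > (0::nat) \<Longrightarrow> AE \<omega> in M. \<forall>\<^sub>F k in sequentially.
     \<forall>i\<in>grid_indices m c k.
       (\<forall>s::real. 0 \<le> s \<and> s \<le> real k / m \<longrightarrow> \<bar>W (real i * (real k / m) + s) \<omega> - W (real i * (real k / m)) \<omega>\<bar> \<le> e * real k)"
    using oscillation_eventually[OF c e] by auto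
  \<comment> \<open>With \<open>m\<close> above \<open>L (\<plusminus> \<theta>)\<close>, the
    increment bound on a cell of length \<open>1 / m\<close> reads \<open>1 / c + 1\<close>, that is
    \<open>e * \<theta>\<close>; so members of the sublevel set oscillate by at most
    \<open>e\<close> on a cell.\<close>
  define \<theta> where "\<theta> = (1 / c + 1) / e"
  have \<theta>: "\<theta> > 0" "e * \<theta> = 1 / c + 1" using c e by (auto simp: \<theta>_def intro!: divide_pos_pos add_pos_pos)
  define m where "m = Suc (max m0 (nat \<lceil>max (L \<theta>) (L (- \<theta>))\<rceil>))"
  have m: "m > 0" "m \<ge> m0" "max (L \<theta>) (L (- \<theta>)) \<le> m" unfolding m_def by (auto; linarith)+
  define A where "A = {a. (\<forall>l<m. a l \<in> conjugate_dom L) \<and> (\<Sum>l<m. conjugate L (a l)) \<le> m * (1 / c)}"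
  have bdd: "\<bar>a l\<bar> \<le> m * Cc" if "a \<in> A" "l < m" for a l
  proof -
    have "\<bar>a l\<bar> \<le> (\<Sum>l<m. \<bar>a l\<bar>)" using that by (intro member_le_sum) auto
    also have "(\<Sum>l<m. \<bar>a l\<bar>) / m \<le> Cc"
      using sum_abs_slopes_le[of m a L "1 / c"] that(1) m(1) by (simp add: A_def Cc_def)
    then have "(\<Sum>l<m. \<bar>a l\<bar>) \<le> m * Cc" using m(1) by (simp add: pos_divide_le_eq mult.commute)
    finally show ?thesis .
  qed
  obtain R where R: "finite R" "R \<subseteq> A" "\<And>a. a \<in> A \<Longrightarrow> \<exists>r\<in>R. \<forall>l<m. \<bar>a l - r l\<bar> \<le> e"
    using finite_slope_net[OF e, of A m "m * Cc"] bdd by blast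
  have "AE \<omega> in M. \<forall>r\<in>R. \<forall>\<^sub>F k in sequentially. \<exists>j. (real j + 1) * real k \<le> exp (real k / c) \<and>
     (\<forall>l<m. \<bar>slope m k (j * m + l) \<omega> - (1 - \<delta>) * r l\<bar> < e)"
    using R(2) by (intro AE_finite_allI[OF R(1)] near_slopes_block_eventually[OF c m(1) _ _ \<delta>(1,2) e]) (auto simp: A_def)
  with m0[OF m(2,1)] show ?thesis
  proof eventually_elim
    case (elim \<omega>)
    have "\<forall>\<^sub>F k in sequentially. \<forall>r\<in>R. \<exists>j. (real j + 1) * real k \<le> exp (real k / c) \<and>
     (\<forall>l<m. \<bar>slope m k (j * m + l) \<omega> - (1 - \<delta>) * r l\<bar> < e)"
      using elim(2) R(1) by (intro eventually_ball_finite) auto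
    with elim(1) eventually_gt_at_top[of 0] show ?case
    proof eventually_elim
      case (elim k)
      show ?case
      proof
        fix f assume f: "f \<in> sublevel \<Phi> (1 / c)"
        have "slopes m f \<in> A"
          using sublevel_slopes[OF fin f _ m(1)] c L_0 by (auto simp: A_def L)
        then obtain r where r: "r \<in> R" "\<forall>l<m. \<bar>slopes m f l - r l\<bar> \<le> e" using R(3) by blast
        with elim(3) obtain j where j: "(real j + 1) * real k \<le> exp (real k / c)"
          "\<forall>l<m. \<bar>slope m k (j * m + l) \<omega> - (1 - \<delta>) * r l\<bar> < e" by blast
        \<comment> \<open>The start of block \<open>j\<close>, which is the grid point of index
          \<open>j * m\<close>.\<close>
        define x where "x = real j * real k"
        define i where "i = j * m"
        have xi: "real i * (real k / m) = x" using m by (simp add: i_def x_def)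
        have i: "real i * (real k / m) \<le> x" "x \<le> real (Suc i) * (real k / m)"
          using xi mult_right_mono[of "real i" "real (Suc i)" "real k / m"] by auto
        have grid: "i' \<in> grid_indices m c k" if "i' \<le> i + m" for i'
        proof -
          have "real i' \<le> real (i + m)" using that by simp
          also have "\<dots> = m * ((real j + 1) * 1)" by (simp add: i_def distrib_left)
          also have "\<dots> \<le> m * ((real j + 1) * real k)" using elim(2) by (intro mult_left_mono) auto
          also have "\<dots> \<le> m * exp (real k / c)" using j(1) by (intro mult_left_mono) auto
          also have "\<dots> \<le> m * exp ((real k + 1) / c)" using c by (intro mult_left_mono) (auto simp: divide_right_mono)
          finally show ?thesis by (simp add: grid_indices_def)
        qed
        define a where "a l = slope m k (i + l) \<omega>" for l
        have ra: "(\<Sum>l<m. \<bar>a l - slopes m f l\<bar>) / m \<le> 3 * e"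
        proof -
          have "r \<in> A" using r(1) R(2) by blast
          then have rs: "(\<Sum>l<m. \<bar>r l\<bar>) / m \<le> Cc"
            using sum_abs_slopes_le[of m r L "1 / c"] m(1) by (simp add: A_def Cc_def)
          have "(\<Sum>l<m. \<bar>a l - slopes m f l\<bar>) \<le> (\<Sum>l<m. 2 * e + \<delta> * \<bar>r l\<bar>)"
          proof (rule sum_mono)
            fix l assume "l \<in> {..<m}"
            then have "\<bar>a l - (1 - \<delta>) * r l\<bar> < e" "\<bar>slopes m f l - r l\<bar> \<le> e"
              using j(2) r(2) by (auto simp: a_def i_def)
            moreover have "\<bar>\<delta> * r l\<bar> = \<delta> * \<bar>r l\<bar>" using \<delta> by (simp add: abs_mult)
            ultimately show "\<bar>a l - slopes m f l\<bar> \<le> 2 * e + \<delta> * \<bar>r l\<bar>"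
              unfolding left_diff_distrib by (simp add: abs_le_iff) linarith
          qed
          also have "\<dots> = m * (2 * e) + \<delta> * (\<Sum>l<m. \<bar>r l\<bar>)" by (simp add: sum.distrib sum_distrib_left)
          finally have "(\<Sum>l<m. \<bar>a l - slopes m f l\<bar>) / m \<le> (m * (2 * e) + \<delta> * (\<Sum>l<m. \<bar>r l\<bar>)) / m"
            by (intro divide_right_mono) auto
          also have "\<dots> = 2 * e + \<delta> * ((\<Sum>l<m. \<bar>r l\<bar>) / m)" using m(1) by (simp add: add_divide_distrib)
          also have "\<delta> * ((\<Sum>l<m. \<bar>r l\<bar>) / m) \<le> \<delta> * Cc" using rs \<delta> by (intro mult_left_mono) auto
          finally show ?thesis using \<delta>(3) by simp
        qed
        have f0: "f 0 = 0" using f by (auto simp: sublevel_def rate_def top_unique split: if_splits)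
        have fosc: "\<bar>f u - f (real l / m)\<bar> \<le> e" if "l < m" "real l / m \<le> u" "u \<le> (real l + 1) / m" for l u
        proof -
          have u: "u \<le> 1" using that by (intro order_trans[OF that(3)]) (simp add: divide_le_eq_1)
          have "\<bar>f u - f (real l / m)\<bar> * \<theta> \<le> 1 / c + (u - real l / m) * max (log_mgf \<Phi> \<theta>) (log_mgf \<Phi> (- \<theta>))"
            using c u that \<theta>(1) by (intro sublevel_increment_le[OF fin f]) auto
          also have "(u - real l / m) * max (log_mgf \<Phi> \<theta>) (log_mgf \<Phi> (- \<theta>)) \<le> (1 / m) * m"
          proof (rule mult_mono)
            show "u - real l / m \<le> 1 / m" using that by (simp add: add_divide_distrib)
            show "max (log_mgf \<Phi> \<theta>) (log_mgf \<Phi> (- \<theta>)) \<le> m" using m(3) by (simp add: L)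
            show "0 \<le> max (log_mgf \<Phi> \<theta>) (log_mgf \<Phi> (- \<theta>))" using L_nonneg[of \<theta>] by (simp add: L le_max_iff_disj)
          qed auto
          finally have "\<bar>f u - f (real l / m)\<bar> * \<theta> \<le> e * \<theta>" using m(1) \<theta>(2) by simp
          then show ?thesis using \<theta>(1) by (simp add: mult_le_cancel_right)
        qed
        show "\<exists>x::real. 0 \<le> x \<and> x \<le> exp (real k / c) - real k \<and>
          (\<forall>s::real. 0 \<le> s \<longrightarrow> s \<le> 1 \<longrightarrow> \<bar>(W (x + s * k) \<omega> - W x \<omega>) / k - f s\<bar> \<le> \<epsilon>)"
        proof (intro exI[of _ x] conjI allI impI)
          show "0 \<le> x" by (simp add: x_def)
          show "x \<le> exp (real k / c) - real k" using j(1) by (simp add: x_def distrib_right)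
          fix s :: real assume s: "0 \<le> s" "s \<le> 1"
          have "\<bar>(W (x + s * k) \<omega> - W x \<omega>) / k - polygon m a s\<bar> \<le> 4 * e"
            unfolding a_def slope_def
            by (rule increment_near_polygon[where w = "\<lambda>t. W t \<omega>", OF m(1) elim(2) s i]) (use elim(1) grid in auto)
          moreover have "\<bar>polygon m a s - polygon m (slopes m f) s\<bar> \<le> 3 * e"
            using polygon_diff_le ra by (rule order_trans)
          moreover have "\<bar>f s - polygon m (slopes m f) s\<bar> \<le> 2 * e"
            by (rule polygon_slopes_dist[OF m(1) s f0 fosc])
          ultimately show "\<bar>(W (x + s * k) \<omega> - W x \<omega>) / k - f s\<bar> \<le> \<epsilon>"
            using e unfolding \<epsilon>_eq by linarith
        qed
      qed
    qed
  qed
qed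

end

section \<open>Centred Levy processes\<close>

context levy_process
begin

lemma increment_distr:
  assumes "0 \<le> x" "0 \<le> h" and [measurable]: "f \<in> borel_measurable borel"
  shows "(\<integral>\<^sup>+\<omega>. f (Z (x + h) \<omega> - Z x \<omega>) \<partial>M) = (\<integral>\<^sup>+\<omega>. f (Z h \<omega> - Z 0 \<omega>) \<partial>M)"
proof -
  have [measurable]: "random_variable borel (Z (x + h))" "random_variable borel (Z x)"
    "random_variable borel (Z h)" "random_variable borel (Z 0)"
    using assms by (auto intro!: random_variable_Z)
  have "(\<integral>\<^sup>+\<omega>. f (Z (x + h) \<omega> - Z x \<omega>) \<partial>M) = (\<integral>\<^sup>+y. f y \<partial>distr M borel (\<lambda>\<omega>. Z (x + h) \<omega> - Z x \<omega>))"
    by (subst nn_integral_distr) auto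
  also have "distr M borel (\<lambda>\<omega>. Z (x + h) \<omega> - Z x \<omega>) = distr M borel (\<lambda>\<omega>. Z h \<omega> - Z 0 \<omega>)"
    using assms by (intro stationary_increments)
  also have "(\<integral>\<^sup>+y. f y \<partial>\<dots>) = (\<integral>\<^sup>+\<omega>. f (Z h \<omega> - Z 0 \<omega>) \<partial>M)"
    by (subst nn_integral_distr) auto
  finally show ?thesis .
qed

definition increment_mgf :: "real \<Rightarrow> real \<Rightarrow> real \<Rightarrow> ennreal" where
  "increment_mgf \<mu> \<theta> h = (\<integral>\<^sup>+\<omega>. ennreal (exp (\<theta> * (Z h \<omega> - Z 0 \<omega> - \<mu> * h))) \<partial>M)"

lemma increment_mgf_shift:
  assumes "0 \<le> x" "0 \<le> h"
  shows "(\<integral>\<^sup>+\<omega>. ennreal (exp (\<theta> * ((Z (x + h) \<omega> - \<mu> * (x + h)) - (Z x \<omega> - \<mu> * x)))) \<partial>M) = increment_mgf \<mu> \<theta> h"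
proof -
  have "(\<integral>\<^sup>+\<omega>. ennreal (exp (\<theta> * ((Z (x + h) \<omega> - \<mu> * (x + h)) - (Z x \<omega> - \<mu> * x)))) \<partial>M) =
    (\<integral>\<^sup>+\<omega>. ennreal (exp (\<theta> * ((Z (x + h) \<omega> - Z x \<omega>) - \<mu> * h))) \<partial>M)"
    by (intro nn_integral_cong) (simp add: algebra_simps)
  also have "\<dots> = increment_mgf \<mu> \<theta> h"
    unfolding increment_mgf_def by (rule increment_distr[OF assms, of "\<lambda>y. ennreal (exp (\<theta> * (y - \<mu> * h)))"]) measurable
  finally show ?thesis .
qed

lemma indep_drift_increments:
  fixes t :: "nat \<Rightarrow> real"
  assumes "0 \<le> t 0" "\<And>i. i < m \<Longrightarrow> t i \<le> t (Suc i)"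
  shows "indep_vars (\<lambda>_. borel) (\<lambda>i \<omega>. (Z (t (Suc i)) \<omega> - \<mu> * t (Suc i)) - (Z (t i) \<omega> - \<mu> * t i)) {..<m}"
proof -
  have "indep_vars (\<lambda>_. borel) (\<lambda>i \<omega>. (Z (t (Suc i)) \<omega> - Z (t i) \<omega>) - \<mu> * (t (Suc i) - t i)) {..<m}"
    by (rule indep_vars_compose2[OF independent_increments[of t m]]) (use assms in auto)
  then show ?thesis by (simp add: algebra_simps)
qed

lemma increment_mgf_mult:
  assumes h: "0 \<le> h"
  shows "increment_mgf \<mu> \<theta> (real n * h) = increment_mgf \<mu> \<theta> h ^ n"
proof -
  define X where "X i \<omega> = (Z (real (Suc i) * h) \<omega> - \<mu> * (real (Suc i) * h)) - (Z (real i * h) \<omega> - \<mu> * (real i * h))" for i \<omega>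
  have "indep_vars (\<lambda>_. borel) X {..<n}"
    unfolding X_def using h by (intro indep_drift_increments[of "\<lambda>i. real i * h"]) (auto intro!: mult_right_mono)
  then have ind: "indep_vars (\<lambda>_. borel) (\<lambda>i \<omega>. ennreal (exp (\<theta> * X i \<omega>))) {..<n}"
    by (rule indep_vars_compose2) measurable
  have sum: "(\<Sum>i<n. X i \<omega>) = Z (real n * h) \<omega> - Z 0 \<omega> - \<mu> * (real n * h)" for \<omega>
    unfolding X_def using sum_lessThan_telescope[of "\<lambda>i. Z (real i * h) \<omega> - \<mu> * (real i * h)" n] by simp
  have each: "(\<integral>\<^sup>+\<omega>. ennreal (exp (\<theta> * X i \<omega>)) \<partial>M) = increment_mgf \<mu> \<theta> h" for i
  proof -
    have "real (Suc i) * h = real i * h + h" by (simp add: distrib_right)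
    then show ?thesis unfolding X_def using increment_mgf_shift[of "real i * h" h] h by simp
  qed
  have "increment_mgf \<mu> \<theta> (real n * h) = (\<integral>\<^sup>+\<omega>. (\<Prod>i<n. ennreal (exp (\<theta> * X i \<omega>))) \<partial>M)"
    unfolding increment_mgf_def sum[symmetric] by (simp add: prod_ennreal exp_sum sum_distrib_left)
  also have "\<dots> = (\<Prod>i<n. \<integral>\<^sup>+\<omega>. ennreal (exp (\<theta> * X i \<omega>)) \<partial>M)"
    by (intro indep_vars_nn_integral ind) auto
  finally show ?thesis by (simp add: each)
qed

text \<open>Over \<open>q\<close> steps of length \<open>1 / q\<close> the values multiply to the
  one at time 1, so each is its \<open>q\<close>-th root, and \<open>p\<close> steps give
  \<open>p / q\<close>. This fixes the moment generating functions at rational lengths.\<close>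

lemma centred_exp_moment_increments:
  assumes fin: "\<And>\<theta>. mgf M (Z 1) \<theta> < \<infinity>" and \<mu>: "\<mu> = expectation (Z 1)"
  defines "\<Phi> \<equiv> mgf M (\<lambda>\<omega>. Z 1 \<omega> - \<mu>)"
  shows "exp_moment_increments M (\<lambda>t \<omega>. Z t \<omega> - \<mu> * t) (log_mgf \<Phi>)" and "\<And>\<theta>. \<Phi> \<theta> < \<infinity>"
proof -
  have Z1[measurable]: "random_variable borel (Z 1)" by (rule random_variable_Z) simp
  have iexp: "integrable M (\<lambda>\<omega>. exp (\<theta> * Z 1 \<omega>))" for \<theta>
    using fin[of \<theta>] by (intro integrableI_nonneg) (auto simp: mgf_def)
  have iZ: "integrable M (Z 1)"
  proof (rule Bochner_Integration.integrable_bound)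
    show "integrable M (\<lambda>\<omega>. exp (1 * Z 1 \<omega>) + exp (- 1 * Z 1 \<omega>))" using iexp by (intro Bochner_Integration.integrable_add)
    have "\<bar>x\<bar> \<le> exp x + exp (- x)" for x :: real
      using exp_ge_add_one_self[of x] exp_ge_add_one_self[of "- x"] exp_gt_zero[of x] exp_gt_zero[of "- x"] by linarith
    then show "AE \<omega> in M. norm (Z 1 \<omega>) \<le> norm (exp (1 * Z 1 \<omega>) + exp (- 1 * Z 1 \<omega>))"
      by (auto simp: abs_of_pos add_pos_pos)
  qed simp
  have icexp: "integrable M (\<lambda>\<omega>. exp (\<theta> * (Z 1 \<omega> - \<mu>)))" for \<theta>
  proof -
    have "integrable M (\<lambda>\<omega>. exp (\<theta> * Z 1 \<omega>) * exp (- \<theta> * \<mu>))" using iexp by simp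
    then show ?thesis by (simp add: exp_add[symmetric] algebra_simps)
  qed
  have \<Phi>: "\<Phi> \<theta> = ennreal (expectation (\<lambda>\<omega>. exp (\<theta> * (Z 1 \<omega> - \<mu>))))" for \<theta>
    unfolding \<Phi>_def mgf_def using icexp by (intro nn_integral_eq_integral) auto
  then show \<Phi>_fin: "\<Phi> \<theta> < \<infinity>" for \<theta> by simp
  \<comment> \<open>Integration of \<open>1 + y \<le> exp y\<close> at a multiple of a mean-zero
    variable; centring enters here.\<close>
  have ge1: "1 \<le> expectation (\<lambda>\<omega>. exp (\<theta> * (Z 1 \<omega> - \<mu>)))" for \<theta>
  proof -
    have "1 = expectation (\<lambda>\<omega>. 1 + \<theta> * (Z 1 \<omega> - \<mu>))" using iZ by (simp add: \<mu> prob_space)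
    also have "\<dots> \<le> expectation (\<lambda>\<omega>. exp (\<theta> * (Z 1 \<omega> - \<mu>)))"
      using iZ icexp by (intro integral_mono) auto
    finally show ?thesis .
  qed
  have exp_log: "\<Phi> \<theta> = ennreal (exp (log_mgf \<Phi> \<theta>))" for \<theta>
    using ge1[of \<theta>] by (simp add: log_mgf_def \<Phi>)
  \<comment> \<open>The path starts at 0 only almost surely, so the increment over the unit interval
    agrees with \<open>Z 1\<close> up to a null set.\<close>
  have unit: "increment_mgf \<mu> \<theta> 1 = \<Phi> \<theta>" for \<theta>
    unfolding increment_mgf_def \<Phi>_def mgf_def
  proof (rule nn_integral_cong_AE)
    show "AE \<omega> in M. ennreal (exp (\<theta> * (Z 1 \<omega> - Z 0 \<omega> - \<mu> * 1))) = ennreal (exp (\<theta> * (Z 1 \<omega> - \<mu>)))"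
      using start_zero by eventually_elim simp
  qed
  have rational: "increment_mgf \<mu> \<theta> (real p / real q) = ennreal (exp (real p / real q * log_mgf \<Phi> \<theta>))" if q: "q > 0" for p q :: nat and \<theta>
  proof -
    let ?g = "increment_mgf \<mu> \<theta> (1 / real q)"
    have g: "?g ^ q = ennreal (exp (log_mgf \<Phi> \<theta>))"
      using increment_mgf_mult[of "1 / real q" \<mu> \<theta> q] q by (simp add: unit exp_log[symmetric])
    \<comment> \<open>An infinite value is impossible because its \<open>q\<close>-th power is
      finite; a real root can then be extracted.\<close>
    obtain v where v: "0 \<le> v" "?g = ennreal v"
    proof (cases ?g)
      case top
      then show thesis using g q by (simp add: power_top_ennreal)
    qed auto
    have "v ^ q = exp (log_mgf \<Phi> \<theta>)" using g v by (simp add: ennreal_power)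
    also have "\<dots> = exp (log_mgf \<Phi> \<theta> / q) ^ q" using q by (simp add: exp_of_nat_mult[symmetric])
    finally have veq: "v = exp (log_mgf \<Phi> \<theta> / q)" using v q by (subst (asm) power_eq_iff_eq_base) auto
    have "increment_mgf \<mu> \<theta> (real p / real q) = ?g ^ p"
      using increment_mgf_mult[of "1 / real q" \<mu> \<theta> p] by simp
    also have "\<dots> = ennreal (exp (log_mgf \<Phi> \<theta> / q) ^ p)" using v veq by (simp add: ennreal_power)
    also have "exp (log_mgf \<Phi> \<theta> / q) ^ p = exp (real p / real q * log_mgf \<Phi> \<theta>)" by (simp add: exp_of_nat_mult[symmetric])
    finally show ?thesis .
  qed
  show "exp_moment_increments M (\<lambda>t \<omega>. Z t \<omega> - \<mu> * t) (log_mgf \<Phi>)"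
  proof (unfold_locales)
    fix t :: real assume "0 \<le> t"
    then have [measurable]: "random_variable borel (Z t)" by (rule random_variable_Z)
    show "random_variable borel (\<lambda>\<omega>. Z t \<omega> - \<mu> * t)" by measurable
  next
    fix t :: "nat \<Rightarrow> real" and m assume "0 \<le> t 0" "\<And>i. i < m \<Longrightarrow> t i \<le> t (Suc i)"
    then show "indep_vars (\<lambda>_. borel) (\<lambda>i \<omega>. (Z (t (Suc i)) \<omega> - \<mu> * t (Suc i)) - (Z (t i) \<omega> - \<mu> * t i)) {..<m}"
      by (rule indep_drift_increments)
  next
    fix x \<theta> :: real and p q :: nat assume "0 \<le> x" "0 < real q"
    then show "(\<integral>\<^sup>+\<omega>. ennreal (exp (\<theta> * (Z (x + real p / real q) \<omega> - \<mu> * (x + real p / real q) - (Z x \<omega> - \<mu> * x)))) \<partial>M)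
       = ennreal (exp (real p / real q * log_mgf \<Phi> \<theta>))"
      by (subst increment_mgf_shift) (auto simp: rational)
  next
    show "log_mgf \<Phi> 0 = 0" by (simp add: log_mgf_def \<Phi> prob_space)
  next
    fix \<theta> show "0 \<le> log_mgf \<Phi> \<theta>" using ge1[of \<theta>] by (simp add: log_mgf_def \<Phi>)
  next
    fix \<omega> and t :: real assume \<omega>: "\<omega> \<in> space M" and t: "0 \<le> t"
    have "{0..} \<inter> {t<..} = {t<..}" using t by auto
    moreover have "((\<lambda>t. Z t \<omega>) \<longlongrightarrow> Z t \<omega>) (at t within {0..} \<inter> {t<..})"
      using cadlag_paths[OF \<omega>] t unfolding cadlag_on_def by blast
    ultimately have "((\<lambda>t. Z t \<omega>) \<longlongrightarrow> Z t \<omega>) (at_right t)" by simp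
    then show "((\<lambda>t. Z t \<omega> - \<mu> * t) \<longlongrightarrow> Z t \<omega> - \<mu> * t) (at_right t)"
      by (intro tendsto_intros)
  qed
qed

lemma eta_in_D01:
  assumes \<omega>: "\<omega> \<in> space M" and "0 \<le> x" "0 < l"
  shows "eta Z \<omega> x l \<in> D01"
proof -
  have "cadlag_on {0..1} (\<lambda>s. inverse l * (Z (x + s * l) \<omega> - Z x \<omega>))"
    unfolding cadlag_on_def
  proof (intro ballI conjI)
    fix s :: real assume s: "s \<in> {0..1}"
    let ?t = "x + s * l"
    have t: "?t \<in> {0..}" using assms s by simp
    have inj: "x + u * l \<noteq> ?t" if "u \<noteq> s" for u using that assms by simp
    have lim: "((\<lambda>u. x + u * l) \<longlongrightarrow> ?t) (at s within A)" for A
      by (intro tendsto_intros)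
    have right: "filterlim (\<lambda>u. x + u * l) (at ?t within {0..} \<inter> {?t<..}) (at s within {0..1} \<inter> {s<..})"
      using assms lim by (auto simp: filterlim_at eventually_at_filter intro!: always_eventually)
    have left: "filterlim (\<lambda>u. x + u * l) (at ?t within {0..} \<inter> {..<?t}) (at s within {0..1} \<inter> {..<s})"
      using assms lim by (auto simp: filterlim_at eventually_at_filter intro!: always_eventually)
    have r: "((\<lambda>t. Z t \<omega>) \<longlongrightarrow> Z ?t \<omega>) (at ?t within {0..} \<inter> {?t<..})"
      and "\<exists>z. ((\<lambda>t. Z t \<omega>) \<longlongrightarrow> z) (at ?t within {0..} \<inter> {..<?t})"
      using cadlag_paths[OF \<omega>] t unfolding cadlag_on_def by blast+
    then obtain z where z: "((\<lambda>t. Z t \<omega>) \<longlongrightarrow> z) (at ?t within {0..} \<inter> {..<?t})" by blast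
    show "((\<lambda>s. inverse l * (Z (x + s * l) \<omega> - Z x \<omega>)) \<longlongrightarrow> inverse l * (Z (x + s * l) \<omega> - Z x \<omega>)) (at s within {0..1} \<inter> {s<..})"
      by (intro tendsto_intros filterlim_compose[OF r right])
    have "((\<lambda>s. inverse l * (Z (x + s * l) \<omega> - Z x \<omega>)) \<longlongrightarrow> inverse l * (z - Z x \<omega>)) (at s within {0..1} \<inter> {..<s})"
      by (intro tendsto_intros filterlim_compose[OF z left])
    then show "\<exists>z. ((\<lambda>s. inverse l * (Z (x + s * l) \<omega> - Z x \<omega>)) \<longlongrightarrow> z) (at s within {0..1} \<inter> {..<s})" ..
  qed
  then show ?thesis by (simp add: D01_def eta_def)
qed

end

section \<open>From window lengths to n\<close>

lemma add_drift_in_D01: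
  assumes "f \<in> D01"
  shows "(\<lambda>s. f s + \<mu> * s) \<in> D01"
  unfolding D01_def cadlag_on_def
proof (intro CollectI ballI conjI)
  fix t :: real assume t: "t \<in> {0..1}"
  have r: "(f \<longlongrightarrow> f t) (at t within {0..1} \<inter> {t<..})"
    and "\<exists>l. (f \<longlongrightarrow> l) (at t within {0..1} \<inter> {..<t})"
    using assms t unfolding D01_def cadlag_on_def by blast+
  then obtain l where l: "(f \<longlongrightarrow> l) (at t within {0..1} \<inter> {..<t})" by blast
  show "((\<lambda>s. f s + \<mu> * s) \<longlongrightarrow> f t + \<mu> * t) (at t within {0..1} \<inter> {t<..})" by (intro tendsto_intros r)
  have "((\<lambda>s. f s + \<mu> * s) \<longlongrightarrow> l + \<mu> * t) (at t within {0..1} \<inter> {..<t})" by (intro tendsto_intros l)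
  then show "\<exists>l. ((\<lambda>s. f s + \<mu> * s) \<longlongrightarrow> l) (at t within {0..1} \<inter> {..<t})" ..
qed

text \<open>The almost sure statements hold for all large \<open>k\<close>; composing them with this
  map yields all large \<open>n\<close> without a further Borel-Cantelli argument.\<close>

lemma window_filterlim:
  assumes "c > 0"
  shows "filterlim (\<lambda>n. nat (window c n)) at_top sequentially"
proof -
  have "filterlim (\<lambda>n. c * ln (real n)) at_top sequentially" using assms by real_asymp
  then have "filterlim (\<lambda>n. nat \<lfloor>c * ln (real n)\<rfloor>) at_top sequentially"
    by (intro filterlim_compose[OF filterlim_nat_sequentially] filterlim_compose[OF filterlim_floor_sequentially])
  then show ?thesis by (simp add: window_def)
qed

lemma window_bounds:
  assumes c: "c > 0" and k: "k = nat (window c n)" "k > 0"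
  shows "real_of_int (window c n) = real k" "exp (real k / c) \<le> real n" "real n \<le> exp ((real k + 1) / c)"
proof -
  show w: "real_of_int (window c n) = real k" using k by simp
  have n: "real n > 0"
  proof (rule ccontr)
    assume "\<not> real n > 0"
    then show False using k by (simp add: window_def)
  qed
  have "real k \<le> c * ln (real n)" "c * ln (real n) < real k + 1"
    using w unfolding window_def by linarith+
  then have "real k / c \<le> ln (real n)" "ln (real n) \<le> (real k + 1) / c"
    using c by (auto simp: pos_divide_le_eq pos_le_divide_eq mult.commute)
  then have "exp (real k / c) \<le> exp (ln (real n))" "exp (ln (real n)) \<le> exp ((real k + 1) / c)"
    by (simp_all only: exp_le_cancel_iff)
  then show "exp (real k / c) \<le> real n" "real n \<le> exp ((real k + 1) / c)" using n by simp_all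
qed

theorem theorem5:
  fixes M :: "'a measure" and Z :: "real \<Rightarrow> 'a \<Rightarrow> real" and c \<mu> :: real
  assumes "levy_process M Z"
    and "\<And>\<theta>. mgf M (Z 1) \<theta> < \<infinity>"
    and "c > 0"
    and "\<mu> = prob_space.expectation M (Z 1)"
  shows "FERL M (increments Z c) (add_drift (sublevel (mgf M (\<lambda>\<omega>. Z 1 \<omega> - \<mu>)) (1 / c)) \<mu>)"
proof -
  interpret levy_process M Z by fact
  define \<Phi> where "\<Phi> = mgf M (\<lambda>\<omega>. Z 1 \<omega> - \<mu>)"
  define W where "W t \<omega> = Z t \<omega> - \<mu> * t" for t \<omega>
  have \<Phi>_fin: "\<Phi> \<theta> < \<infinity>" for \<theta>
    unfolding \<Phi>_def by (rule centred_exp_moment_increments(2)[OF assms(2,4)])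
  interpret W: exp_moment_increments M W "log_mgf \<Phi>"
    unfolding W_def \<Phi>_def by (rule centred_exp_moment_increments(1)[OF assms(2,4)])
  \<comment> \<open>The drift over a window contributes exactly \<open>\<mu> * s\<close>, so adding
    the drift to the limit set leaves all distances unchanged.\<close>
  have eta_W: "eta Z \<omega> x (real k) s = (W (x + s * k) \<omega> - W x \<omega>) / k + \<mu> * s" if "k > 0" for k :: nat and x s \<omega>
    using that by (simp add: eta_def W_def field_simps)
  show ?thesis
    unfolding FERL_def \<Phi>_def[symmetric]
  proof (intro allI impI conjI)
    fix \<epsilon> :: real assume \<epsilon>: "\<epsilon> > 0"
    \<comment> \<open>The estimates are nonstrict, whereas the neighbourhoods ask for strict
      inequality.\<close>
    then have e2: "\<epsilon> / 2 > 0" by simp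
    show "AE \<omega> in M. \<forall>\<^sub>F n in sequentially. increments Z c n \<omega> \<subseteq> nbhd_U (add_drift (sublevel \<Phi> (1 / c)) \<mu>) \<epsilon>"
      using W.increments_near_sublevel[OF \<open>c > 0\<close> e2 \<Phi>_fin refl] AE_space
    proof eventually_elim
      case (elim \<omega>)
      from eventually_compose_filterlim[OF elim(1) window_filterlim[OF \<open>c > 0\<close>]]
        eventually_compose_filterlim[OF eventually_gt_at_top[of 0] window_filterlim[OF \<open>c > 0\<close>]]
      show ?case
      proof eventually_elim
        case (elim n)
        define k where "k = nat (window c n)"
        have k: "k > 0" using elim(2) by (simp add: k_def)
        note wb = window_bounds[OF \<open>c > 0\<close> k_def k]
        show ?case
        proof
          fix f assume "f \<in> increments Z c n \<omega>"
          then obtain x where f: "f = eta Z \<omega> x (real k)" and x: "0 \<le> x" "x \<le> real n - real k"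
            by (auto simp: increments_def wb(1))
          obtain g where g: "g \<in> sublevel \<Phi> (1 / c)"
            "\<And>s :: real. 0 \<le> s \<Longrightarrow> s \<le> 1 \<Longrightarrow> \<bar>(W (x + s * k) \<omega> - W x \<omega>) / k - g s\<bar> \<le> \<epsilon> / 2"
            using elim(1)[folded k_def, rule_format, OF x wb(3)] by blast
          have "dist_U f (\<lambda>s. g s + \<mu> * s) \<le> \<epsilon> / 2"
            using g(2) by (intro dist_U_le) (simp add: f eta_W[OF k])
          then have "dist_U f (\<lambda>s. g s + \<mu> * s) < \<epsilon>" using \<epsilon> by simp
          moreover have "f \<in> D01" unfolding f using k x \<open>\<omega> \<in> space M\<close> by (intro eta_in_D01) auto
          ultimately show "f \<in> nbhd_U (add_drift (sublevel \<Phi> (1 / c)) \<mu>) \<epsilon>"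
            using g(1) by (auto simp: nbhd_U_def add_drift_def)
        qed
      qed
    qed
    show "AE \<omega> in M. \<forall>\<^sub>F n in sequentially. add_drift (sublevel \<Phi> (1 / c)) \<mu> \<subseteq> nbhd_U (increments Z c n \<omega>) \<epsilon>"
      using W.sublevel_near_increments[OF \<open>c > 0\<close> e2 \<Phi>_fin refl]
    proof eventually_elim
      case (elim \<omega>)
      from eventually_compose_filterlim[OF elim window_filterlim[OF \<open>c > 0\<close>]]
        eventually_compose_filterlim[OF eventually_gt_at_top[of 0] window_filterlim[OF \<open>c > 0\<close>]]
      show ?case
      proof eventually_elim
        case (elim n)
        define k where "k = nat (window c n)"
        have k: "k > 0" using elim(2) by (simp add: k_def)
        note wb = window_bounds[OF \<open>c > 0\<close> k_def k]
        show ?case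
        proof
          fix h assume "h \<in> add_drift (sublevel \<Phi> (1 / c)) \<mu>"
          then obtain f where h: "h = (\<lambda>s. f s + \<mu> * s)" and f: "f \<in> sublevel \<Phi> (1 / c)"
            by (auto simp: add_drift_def)
          obtain x where x: "0 \<le> x" "x \<le> exp (real k / c) - real k"
            "\<And>s :: real. 0 \<le> s \<Longrightarrow> s \<le> 1 \<Longrightarrow> \<bar>(W (x + s * k) \<omega> - W x \<omega>) / k - f s\<bar> \<le> \<epsilon> / 2"
            using elim(1)[folded k_def, rule_format, OF f] by blast
          have "dist_U h (eta Z \<omega> x (real k)) \<le> \<epsilon> / 2"
          proof (rule dist_U_le)
            fix s :: real assume "0 \<le> s" "s \<le> 1"
            from x(3)[OF this] show "\<bar>h s - eta Z \<omega> x (real k) s\<bar> \<le> \<epsilon> / 2"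
              unfolding h eta_W[OF k] by linarith
          qed
          then have "dist_U h (eta Z \<omega> x (real k)) < \<epsilon>" using \<epsilon> by simp
          moreover have "eta Z \<omega> x (real k) \<in> increments Z c n \<omega>"
            using x wb(2) unfolding increments_def wb(1) by auto
          moreover have "h \<in> D01" unfolding h using f by (intro add_drift_in_D01) (simp add: sublevel_def)
          ultimately show "h \<in> nbhd_U (increments Z c n \<omega>) \<epsilon>" by (auto simp: nbhd_U_def)
        qed
      qed
    qed
  qed
qed

end
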